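(* Let $\Omega^*\subset\mathbb{R}^d$ be a bounded domain of class $C^3$, and let $J$ be a real-valued shape functional which is twice Fréchet differentiable on a neighborhood of $\Omega^*$ in $W^{1,\infty}$. Let $\ell_1=\ell_1[J](\Omega^* )$ and $\ell_2=\ell_2[J](\Omega^* )$. Assume that there are $s_2\in(0,1]$ and a Banach space $X$ with $C^\infty(\partial\Omega^* )\subset X\subset W^{1,\infty}(\partial\Omega^* )$ such that $J$ satisfies both condition $(C_{H^{s_2}})$ and condition $(IT_{H^{s_2},X})$ at $\Omega^*$ (as defined in the context). If $$\ell_1=0\qquad\text{and}\qquad \ell_2(\varphi,\varphi)>0\ \text{ for every }\varphi\in H^{s_2}(\partial\Omega^* )\setminus\{0\},$$ then there exist $\eta>0$ and $c=c(\eta)>0$ such that $$J(\Omega^*_h)\ \ge\ J(\Omega^* )+c\,\|h\|_{H^{s_2}(\partial\Omega^* )}^2\qquad\text{for every } h\in X \text{ with }\|h\|_X\le\eta .$$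
   Context: $\boldsymbol n$ is the outer unit normal of $\partial\Omega$. $C^\infty(\partial\Omega)$ denotes the restrictions to $\partial\Omega$ of $C^\infty$ functions. Normal graphs: for a scalar function $h$ on $\partial\Omega$, small in $W^{1,\infty}(\partial\Omega)$, $\Omega_h$ is the bounded open set close to $\Omega$ with $\partial\Omega_h=\{x+h(x)\boldsymbol n(x):x\in\partial\Omega\}$; equivalently $\Omega_h=(\mathrm{Id}+\xi_h)(\Omega)$ with $\xi_h$ an extension to $\mathbb{R}^d$, small in $W^{1,\infty}$, of $h\boldsymbol n$. Differentiability: $J$ is twice Fréchet differentiable on a neighborhood of $\Omega$ in $W^{1,\infty}$ if $\mathcal J_\Omega:\theta\mapsto J((\mathrm{Id}+\theta)(\Omega))$ is twice Fréchet differentiable on a neighborhood of $0$ in $W^{1,\infty}(\mathbb{R}^d,\mathbb{R}^d)$. Put $j_\Omega(h)=J(\Omega_h)$, and let $\ell_1[J](\Omega)=j_\Omega'(0)$ (a linear form) and $\ell_2[J](\Omega)=j_\Omega''(0)$ (a symmetric bilinear form), first considered on smooth functions on $\partial\Omega$. Condition $(C_{H^{s_2}})$, $s_2\in(0,1]$: a bilinear form $\ell$ acting on $C^\infty(\partial\Omega)$ satisfies it if there exist $s_1\in[0,s_2)$ and $c_1>0$ such that $\ell=\ell_m+\ell_r$, where $\ell_m$ is lower semi-continuous in $H^{s_2}(\partial\Omega)$, $\ell_m(\varphi,\varphi)\ge c_1|\varphi|^2_{H^{s_2}(\partial\Omega)}$ for all $\varphi\in C^\infty(\partial\Omega)$,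 and $\ell_r$ is continuous in $H^{s_1}(\partial\Omega)$. Here $|\cdot|_{H^{s_2}}$ is the $H^{s_2}$ semi-norm; in that case $\ell$ is extended by density to $H^{s_2}(\partial\Omega)$. One says that $J$ satisfies $(C_{H^{s_2}})$ at $\Omega$ if $\ell_2[J](\Omega)$ does. Condition $(IT_{H^{s},X})$, for $s\in[0,1]$ and $X\subset W^{1,\infty}(\partial\Omega)$ a Banach space: $j_\Omega$ is $C^2$ in a neighborhood of $0$ in $X$, and there exist $\eta>0$ and a modulus of continuity $\omega$ (i.e. $\omega(r)\to0$ as $r\to0^+$) such that for every $\Omega_h$ with $\|h\|_X\le\eta$, $$\Big|J(\Omega_h)-J(\Omega)-\ell_1[J](\Omega)(h)-\tfrac12\ell_2[J](\Omega)(h,h)\Big|\le\omega(\|h\|_X)\,\|h\|^2_{H^s(\partial\Omega)} .$$ *)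

theory Defs
  imports "HOL-Analysis.Analysis"
begin

text \<open>
  Conventions. A function on the boundary of \<open>\<Omega>\<close> is represented by a function on the whole space
  that is \<open>0\<close> off \<open>frontier \<Omega>\<close>. A normed function space is a pair of a carrier set \<open>V\<close> and a
  norm \<open>N\<close>, with the pointwise operations: \<open>W\<^sup>1\<^sup>,\<^sup>\<infinity>\<close> of a boundary depends on the term \<open>\<Omega>\<close> and so
  cannot be a type, and Frechet derivatives are therefore relativised to carriers.
\<close>

section \<open>Normed function spaces and Frechet derivatives of functionals\<close>

definition fun_subspace :: "('p \<Rightarrow> 'c::real_vector) set \<Rightarrow> bool" where
  "fun_subspace V \<longleftrightarrow> (\<lambda>_. 0) \<in> V \<and> (\<forall>f\<in>V. \<forall>g\<in>V. (\<lambda>x. f x + g x) \<in> V) \<and>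
     (\<forall>a. \<forall>f\<in>V. (\<lambda>x. a *\<^sub>R f x) \<in> V)"

definition banach_fun_space ::
    "('p \<Rightarrow> 'c::real_vector) set \<Rightarrow> (('p \<Rightarrow> 'c) \<Rightarrow> real) \<Rightarrow> bool" where
  "banach_fun_space V N \<longleftrightarrow> fun_subspace V \<and>
     (\<forall>f\<in>V. 0 \<le> N f \<and> (N f = 0 \<longleftrightarrow> f = (\<lambda>_. 0))) \<and>
     (\<forall>a. \<forall>f\<in>V. N (\<lambda>x. a *\<^sub>R f x) = \<bar>a\<bar> * N f) \<and>
     (\<forall>f\<in>V. \<forall>g\<in>V. N (\<lambda>x. f x + g x) \<le> N f + N g) \<and>
     (\<forall>u :: nat \<Rightarrow> 'p \<Rightarrow> 'c. (\<forall>n. u n \<in> V) \<and>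
        (\<forall>\<epsilon>>0. \<exists>M. \<forall>m\<ge>M. \<forall>n\<ge>M. N (\<lambda>x. u m x - u n x) < \<epsilon>) \<longrightarrow>
        (\<exists>f\<in>V. (\<lambda>n. N (\<lambda>x. u n x - f x)) \<longlonglongrightarrow> 0))"

definition linear_form ::
    "('p \<Rightarrow> 'c::real_vector) set \<Rightarrow> (('p \<Rightarrow> 'c) \<Rightarrow> real) \<Rightarrow> bool" where
  "linear_form V L \<longleftrightarrow> (\<forall>f\<in>V. \<forall>g\<in>V. L (\<lambda>x. f x + g x) = L f + L g) \<and>
     (\<forall>a. \<forall>f\<in>V. L (\<lambda>x. a *\<^sub>R f x) = a * L f)"

definition bilinear_form ::
    "('p \<Rightarrow> 'c::real_vector) set \<Rightarrow> (('p \<Rightarrow> 'c) \<Rightarrow> ('p \<Rightarrow> 'c) \<Rightarrow> real) \<Rightarrow> bool" where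
  "bilinear_form V B \<longleftrightarrow> (\<forall>f\<in>V. linear_form V (B f)) \<and> (\<forall>g\<in>V. linear_form V (\<lambda>f. B f g))"

definition has_fdiff ::
    "('p \<Rightarrow> 'c::real_vector) set \<Rightarrow> (('p \<Rightarrow> 'c) \<Rightarrow> real) \<Rightarrow> (('p \<Rightarrow> 'c) \<Rightarrow> real) \<Rightarrow>
     (('p \<Rightarrow> 'c) \<Rightarrow> real) \<Rightarrow> ('p \<Rightarrow> 'c) \<Rightarrow> bool" where
  "has_fdiff V N F D f \<longleftrightarrow> linear_form V D \<and> (\<exists>K. \<forall>k\<in>V. \<bar>D k\<bar> \<le> K * N k) \<and>
     (\<forall>\<epsilon>>0. \<exists>\<delta>>0. \<forall>k\<in>V. N k < \<delta> \<longrightarrow> \<bar>F (\<lambda>x. f x + k x) - F f - D k\<bar> \<le> \<epsilon> * N k)"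

text \<open>The derivative is unique on \<open>V\<close>; off \<open>V\<close> it is set to \<open>0\<close>.\<close>

definition fdiff ::
    "('p \<Rightarrow> 'c::real_vector) set \<Rightarrow> (('p \<Rightarrow> 'c) \<Rightarrow> real) \<Rightarrow> (('p \<Rightarrow> 'c) \<Rightarrow> real) \<Rightarrow>
     ('p \<Rightarrow> 'c) \<Rightarrow> ('p \<Rightarrow> 'c) \<Rightarrow> real" where
  "fdiff V N F f = (THE D. has_fdiff V N F D f \<and> (\<forall>k. k \<notin> V \<longrightarrow> D k = 0))"

text \<open>\<open>B\<close> is the derivative at \<open>f\<close> of \<open>fdiff V N F\<close>, for the operator norm on the dual of \<open>V\<close>.\<close>

definition has_fdiff2 ::
    "('p \<Rightarrow> 'c::real_vector) set \<Rightarrow> (('p \<Rightarrow> 'c) \<Rightarrow> real) \<Rightarrow> (('p \<Rightarrow> 'c) \<Rightarrow> real) \<Rightarrow>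
     (('p \<Rightarrow> 'c) \<Rightarrow> ('p \<Rightarrow> 'c) \<Rightarrow> real) \<Rightarrow> ('p \<Rightarrow> 'c) \<Rightarrow> bool" where
  "has_fdiff2 V N F B f \<longleftrightarrow> bilinear_form V B \<and>
     (\<exists>K. \<forall>k\<in>V. \<forall>m\<in>V. \<bar>B k m\<bar> \<le> K * N k * N m) \<and>
     (\<exists>r>0. \<forall>k\<in>V. N k < r \<longrightarrow> (\<exists>D. has_fdiff V N F D (\<lambda>x. f x + k x))) \<and>
     (\<forall>\<epsilon>>0. \<exists>\<delta>>0. \<forall>k\<in>V. N k < \<delta> \<longrightarrow>
        (\<forall>m\<in>V. \<bar>fdiff V N F (\<lambda>x. f x + k x) m - fdiff V N F f m - B k m\<bar> \<le> \<epsilon> * N k * N m))"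

definition fdiff2 ::
    "('p \<Rightarrow> 'c::real_vector) set \<Rightarrow> (('p \<Rightarrow> 'c) \<Rightarrow> real) \<Rightarrow> (('p \<Rightarrow> 'c) \<Rightarrow> real) \<Rightarrow>
     ('p \<Rightarrow> 'c) \<Rightarrow> ('p \<Rightarrow> 'c) \<Rightarrow> ('p \<Rightarrow> 'c) \<Rightarrow> real" where
  "fdiff2 V N F f =
     (THE B. has_fdiff2 V N F B f \<and> (\<forall>k m. k \<notin> V \<or> m \<notin> V \<longrightarrow> B k m = 0))"

definition twice_fdifferentiable_near_0 ::
    "('p \<Rightarrow> 'c::real_vector) set \<Rightarrow> (('p \<Rightarrow> 'c) \<Rightarrow> real) \<Rightarrow> (('p \<Rightarrow> 'c) \<Rightarrow> real) \<Rightarrow> bool" where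
  "twice_fdifferentiable_near_0 V N F \<longleftrightarrow>
     (\<exists>r>0. \<forall>f\<in>V. N f < r \<longrightarrow> (\<exists>B. has_fdiff2 V N F B f))"

definition C2_near_0 ::
    "('p \<Rightarrow> 'c::real_vector) set \<Rightarrow> (('p \<Rightarrow> 'c) \<Rightarrow> real) \<Rightarrow> (('p \<Rightarrow> 'c) \<Rightarrow> real) \<Rightarrow> bool" where
  "C2_near_0 V N F \<longleftrightarrow>
     (\<exists>r>0. \<forall>f\<in>V. N f < r \<longrightarrow> (\<exists>B. has_fdiff2 V N F B f) \<and>
        (\<forall>\<epsilon>>0. \<exists>\<delta>>0. \<forall>k\<in>V. N k < \<delta> \<longrightarrow>
           (\<forall>l\<in>V. \<forall>m\<in>V. \<bar>fdiff2 V N F (\<lambda>x. f x + k x) l m - fdiff2 V N F f l m\<bar>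
              \<le> \<epsilon> * N l * N m)))"

section \<open>Smooth functions, domains of class \<open>C\<^sup>k\<close>, outer normal\<close>

primrec Ck_fun :: "nat \<Rightarrow> ('a::euclidean_space \<Rightarrow> real) \<Rightarrow> bool" where
  "Ck_fun 0 f \<longleftrightarrow> continuous_on UNIV f"
| "Ck_fun (Suc k) f \<longleftrightarrow>
     (\<exists>f'. (\<forall>x. (f has_derivative f' x) (at x)) \<and> (\<forall>v. Ck_fun k (\<lambda>x. f' x v)))"

text \<open>Near each boundary point, \<open>\<Omega>\<close> is the part above a \<open>C\<^sup>k\<close> graph in some unit direction \<open>e\<close>; the
  invariance of \<open>\<gamma>\<close> along \<open>e\<close> makes it a function of the remaining coordinates.\<close>

definition Ck_boundary :: "nat \<Rightarrow> 'a::euclidean_space set \<Rightarrow> bool" where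
  "Ck_boundary k \<Omega> \<longleftrightarrow> (\<forall>x\<in>frontier \<Omega>. \<exists>r>0. \<exists>e \<gamma>. norm e = 1 \<and> Ck_fun k \<gamma> \<and>
     (\<forall>y t. \<gamma> (y + t *\<^sub>R e) = \<gamma> y) \<and> \<Omega> \<inter> ball x r = {y \<in> ball x r. \<gamma> y < y \<bullet> e})"

definition bounded_Ck_domain :: "nat \<Rightarrow> 'a::euclidean_space set \<Rightarrow> bool" where
  "bounded_Ck_domain k \<Omega> \<longleftrightarrow>
     \<Omega> \<noteq> {} \<and> open \<Omega> \<and> connected \<Omega> \<and> bounded \<Omega> \<and> Ck_boundary k \<Omega>"

text \<open>The unit vector \<open>\<nu>\<close> such that \<open>\<Omega>\<close> agrees to first order at \<open>x\<close> with the half-space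
  \<open>{y. (y - x) \<bullet> \<nu> < 0}\<close>.\<close>

definition outer_normal :: "'a::euclidean_space set \<Rightarrow> 'a \<Rightarrow> 'a" where
  "outer_normal \<Omega> x = (THE \<nu>. norm \<nu> = 1 \<and>
     (\<forall>\<epsilon>>0. \<exists>\<delta>>0. \<forall>y. 0 < norm (y - x) \<and> norm (y - x) < \<delta> \<longrightarrow>
        ((y - x) \<bullet> \<nu> < - \<epsilon> * norm (y - x) \<longrightarrow> y \<in> \<Omega>) \<and>
        ((y - x) \<bullet> \<nu> > \<epsilon> * norm (y - x) \<longrightarrow> y \<notin> \<Omega>)))"

definition Cinf_boundary :: "'a::euclidean_space set \<Rightarrow> ('a \<Rightarrow> real) set" where
  "Cinf_boundary \<Omega> =
     {\<lambda>x. if x \<in> frontier \<Omega> then \<Phi> x else 0 | \<Phi>. \<forall>k. Ck_fun k \<Phi>}"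

text \<open>\<open>W\<^sup>1\<^sup>,\<^sup>\<infinity>\<close> on the whole space or on a compact boundary of class \<open>C\<^sup>3\<close>, through the Lipschitz
  representatives (the ones for which the deformations below make sense).\<close>

definition W1inf :: "'a::metric_space set \<Rightarrow> ('a \<Rightarrow> 'b::real_normed_vector) set" where
  "W1inf S = {f. (\<forall>x. x \<notin> S \<longrightarrow> f x = 0) \<and> bounded (f ` S) \<and> (\<exists>L. L-lipschitz_on S f)}"

definition W1inf_norm :: "'a::metric_space set \<Rightarrow> ('a \<Rightarrow> 'b::real_normed_vector) \<Rightarrow> real" where
  "W1inf_norm S f = (SUP x\<in>S. norm (f x)) + Inf {L. L-lipschitz_on S f}"

section \<open>Surface measure and Sobolev spaces on the boundary\<close>

definition hausdorff_content :: "nat \<Rightarrow> real \<Rightarrow> 'a::metric_space set \<Rightarrow> ennreal" where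
  "hausdorff_content m \<delta> A =
     (INF C \<in> {C :: nat \<Rightarrow> 'a set. A \<subseteq> (\<Union>i. C i) \<and> (\<forall>i. bounded (C i) \<and> diameter (C i) \<le> \<delta>)}.
        \<Sum>i. if C i = {} then 0
            else ennreal (unit_ball_vol (real m) * (diameter (C i) / 2) ^ m))"

definition hausdorff_measure :: "nat \<Rightarrow> 'a::metric_space measure" where
  "hausdorff_measure m =
     measure_of UNIV (sets borel) (\<lambda>A. SUP \<delta>\<in>{0<..}. hausdorff_content m \<delta> A)"

definition surface_measure :: "'a::euclidean_space set \<Rightarrow> 'a measure" where
  "surface_measure \<Omega> = restrict_space (hausdorff_measure (DIM('a) - 1)) (frontier \<Omega>)"

definition tangential_gradient :: "'a::euclidean_space set \<Rightarrow> ('a \<Rightarrow> real) \<Rightarrow> 'a \<Rightarrow> 'a" where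
  "tangential_gradient \<Omega> \<phi> x = (THE g. g \<bullet> outer_normal \<Omega> x = 0 \<and>
     (\<phi> has_derivative (\<lambda>v. g \<bullet> v)) (at x within frontier \<Omega>))"

text \<open>\<open>H\<^sup>1\<close> of the boundary is the completion of the smooth functions: \<open>g\<close> is the tangential
  gradient of \<open>\<phi>\<close> if \<open>(\<phi>, g)\<close> is an \<open>L\<^sup>2\<close>-limit of pairs \<open>(\<psi>, tangential_gradient \<Omega> \<psi>)\<close>.\<close>

definition has_H1_gradient ::
    "'a::euclidean_space set \<Rightarrow> ('a \<Rightarrow> real) \<Rightarrow> ('a \<Rightarrow> 'a) \<Rightarrow> bool" where
  "has_H1_gradient \<Omega> \<phi> g \<longleftrightarrow> g \<in> borel_measurable (surface_measure \<Omega>) \<and>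
     (\<exists>\<psi> :: nat \<Rightarrow> 'a \<Rightarrow> real. (\<forall>n. \<psi> n \<in> Cinf_boundary \<Omega>) \<and>
        (\<lambda>n. \<integral>\<^sup>+x. ennreal ((\<psi> n x - \<phi> x)\<^sup>2) \<partial>surface_measure \<Omega>) \<longlonglongrightarrow> 0 \<and>
        (\<lambda>n. \<integral>\<^sup>+x. ennreal ((norm (tangential_gradient \<Omega> (\<psi> n) x - g x))\<^sup>2)
               \<partial>surface_measure \<Omega>) \<longlonglongrightarrow> 0)"

text \<open>Squared \<open>H\<^sup>s\<close> semi-norm, \<open>0 \<le> s \<le> 1\<close>: the Gagliardo-Slobodeckij double integral for
  \<open>0 < s < 1\<close> and the \<open>L\<^sup>2\<close> norm of the tangential gradient for \<open>s = 1\<close>. That gradient is unique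
  almost everywhere, so the infimum only serves to give \<open>\<infinity>\<close> off \<open>H\<^sup>1\<close>. \<open>H\<^sup>0\<close> is \<open>L\<^sup>2\<close>.\<close>

definition Hs_semi_sq :: "real \<Rightarrow> 'a::euclidean_space set \<Rightarrow> ('a \<Rightarrow> real) \<Rightarrow> ennreal" where
  "Hs_semi_sq s \<Omega> \<phi> =
     (if s = 0 then 0
      else if s < 1 then
        \<integral>\<^sup>+x. (\<integral>\<^sup>+y. ennreal ((\<phi> x - \<phi> y)\<^sup>2 / norm (x - y) powr (real (DIM('a) - 1) + 2 * s))
           \<partial>surface_measure \<Omega>) \<partial>surface_measure \<Omega>
      else INF g \<in> {g. has_H1_gradient \<Omega> \<phi> g}.
        \<integral>\<^sup>+x. ennreal ((norm (g x))\<^sup>2) \<partial>surface_measure \<Omega>)"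

definition Hs_norm_sq :: "real \<Rightarrow> 'a::euclidean_space set \<Rightarrow> ('a \<Rightarrow> real) \<Rightarrow> ennreal" where
  "Hs_norm_sq s \<Omega> \<phi> =
     (\<integral>\<^sup>+x. ennreal ((\<phi> x)\<^sup>2) \<partial>surface_measure \<Omega>) + Hs_semi_sq s \<Omega> \<phi>"

definition Hs :: "real \<Rightarrow> 'a::euclidean_space set \<Rightarrow> ('a \<Rightarrow> real) set" where
  "Hs s \<Omega> = {\<phi>. (\<forall>x. x \<notin> frontier \<Omega> \<longrightarrow> \<phi> x = 0) \<and>
     \<phi> \<in> borel_measurable (surface_measure \<Omega>) \<and> Hs_norm_sq s \<Omega> \<phi> < \<infinity>}"

definition Hs_seminorm :: "real \<Rightarrow> 'a::euclidean_space set \<Rightarrow> ('a \<Rightarrow> real) \<Rightarrow> real" where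
  "Hs_seminorm s \<Omega> \<phi> = sqrt (enn2real (Hs_semi_sq s \<Omega> \<phi>))"

definition Hs_norm :: "real \<Rightarrow> 'a::euclidean_space set \<Rightarrow> ('a \<Rightarrow> real) \<Rightarrow> real" where
  "Hs_norm s \<Omega> \<phi> = sqrt (enn2real (Hs_norm_sq s \<Omega> \<phi>))"

section \<open>Shape derivatives\<close>

text \<open>An extension \<open>\<xi>\<close> of \<open>h \<nu>\<close> with norm below \<open>1\<close> has Lipschitz constant below \<open>1\<close>, so
  \<open>Id + \<xi>\<close> is a homeomorphism of the space and the image of \<open>\<Omega>\<close> does not depend on \<open>\<xi>\<close>.\<close>

definition normal_graph :: "'a::euclidean_space set \<Rightarrow> ('a \<Rightarrow> real) \<Rightarrow> 'a set" where
  "normal_graph \<Omega> h = (THE U. \<exists>\<xi> \<in> W1inf UNIV. W1inf_norm UNIV \<xi> < 1 \<and>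
     (\<forall>x\<in>frontier \<Omega>. \<xi> x = h x *\<^sub>R outer_normal \<Omega> x) \<and> U = (\<lambda>x. x + \<xi> x) ` \<Omega>)"

definition shape_fun :: "('a::euclidean_space set \<Rightarrow> real) \<Rightarrow> 'a set \<Rightarrow> ('a \<Rightarrow> real) \<Rightarrow> real" where
  "shape_fun J \<Omega> h = J (normal_graph \<Omega> h)"

definition shape_twice_differentiable ::
    "('a::euclidean_space set \<Rightarrow> real) \<Rightarrow> 'a set \<Rightarrow> bool" where
  "shape_twice_differentiable J \<Omega> \<longleftrightarrow>
     twice_fdifferentiable_near_0 (W1inf UNIV :: ('a \<Rightarrow> 'a) set) (W1inf_norm UNIV)
       (\<lambda>\<theta>. J ((\<lambda>x. x + \<theta> x) ` \<Omega>))"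

definition shape_l1 :: "('a::euclidean_space set \<Rightarrow> real) \<Rightarrow> 'a set \<Rightarrow> ('a \<Rightarrow> real) \<Rightarrow> real" where
  "shape_l1 J \<Omega> =
     fdiff (W1inf (frontier \<Omega>)) (W1inf_norm (frontier \<Omega>)) (shape_fun J \<Omega>) (\<lambda>_. 0)"

definition shape_l2 ::
    "('a::euclidean_space set \<Rightarrow> real) \<Rightarrow> 'a set \<Rightarrow> ('a \<Rightarrow> real) \<Rightarrow> ('a \<Rightarrow> real) \<Rightarrow> real" where
  "shape_l2 J \<Omega> =
     fdiff2 (W1inf (frontier \<Omega>)) (W1inf_norm (frontier \<Omega>)) (shape_fun J \<Omega>) (\<lambda>_. 0)"

section \<open>The two conditions\<close>

definition smooth_nhds ::
    "real \<Rightarrow> 'a::euclidean_space set \<Rightarrow> ('a \<Rightarrow> real) \<Rightarrow> ('a \<Rightarrow> real) filter" where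
  "smooth_nhds s \<Omega> \<phi> =
     (INF \<epsilon>\<in>{0<..}. principal {\<psi> \<in> Cinf_boundary \<Omega>. Hs_norm_sq s \<Omega> (\<lambda>x. \<psi> x - \<phi> x) < \<epsilon>})"

text \<open>The value at \<open>(\<phi>, \<phi>)\<close> of the extension of \<open>l\<close> by density to \<open>H\<^sup>s\<close>. As the main part of \<open>l\<close> is
  only assumed lower semicontinuous, the extension is the lower limit along smooth functions; it is
  the limit, i.e. the usual extension, if \<open>l\<close> is \<open>H\<^sup>s\<close>-continuous, and in general may be \<open>\<infinity>\<close>.\<close>

definition density_ext ::
    "real \<Rightarrow> 'a::euclidean_space set \<Rightarrow> (('a \<Rightarrow> real) \<Rightarrow> ('a \<Rightarrow> real) \<Rightarrow> real) \<Rightarrow>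
     ('a \<Rightarrow> real) \<Rightarrow> ereal" where
  "density_ext s \<Omega> l \<phi> = Liminf (smooth_nhds s \<Omega> \<phi>) (\<lambda>\<psi>. ereal (l \<psi> \<psi>))"

definition form_lsc ::
    "real \<Rightarrow> 'a::euclidean_space set \<Rightarrow> (('a \<Rightarrow> real) \<Rightarrow> ('a \<Rightarrow> real) \<Rightarrow> real) \<Rightarrow> bool" where
  "form_lsc s \<Omega> l \<longleftrightarrow> (\<forall>\<phi>\<in>Cinf_boundary \<Omega>.
     ereal (l \<phi> \<phi>) \<le> Liminf (smooth_nhds s \<Omega> \<phi>) (\<lambda>\<psi>. ereal (l \<psi> \<psi>)))"

definition form_continuous ::
    "real \<Rightarrow> 'a::euclidean_space set \<Rightarrow> (('a \<Rightarrow> real) \<Rightarrow> ('a \<Rightarrow> real) \<Rightarrow> real) \<Rightarrow> bool" where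
  "form_continuous s \<Omega> l \<longleftrightarrow> (\<exists>K. \<forall>\<phi>\<in>Cinf_boundary \<Omega>. \<forall>\<psi>\<in>Cinf_boundary \<Omega>.
     \<bar>l \<phi> \<psi>\<bar> \<le> K * Hs_norm s \<Omega> \<phi> * Hs_norm s \<Omega> \<psi>)"

definition condition_C ::
    "real \<Rightarrow> 'a::euclidean_space set \<Rightarrow> (('a \<Rightarrow> real) \<Rightarrow> ('a \<Rightarrow> real) \<Rightarrow> real) \<Rightarrow> bool" where
  "condition_C s2 \<Omega> l \<longleftrightarrow> (\<exists>s1 c1 lm lr. 0 \<le> s1 \<and> s1 < s2 \<and> 0 < c1 \<and>
     bilinear_form (Cinf_boundary \<Omega>) lm \<and> bilinear_form (Cinf_boundary \<Omega>) lr \<and>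
     (\<forall>\<phi>\<in>Cinf_boundary \<Omega>. \<forall>\<psi>\<in>Cinf_boundary \<Omega>. l \<phi> \<psi> = lm \<phi> \<psi> + lr \<phi> \<psi>) \<and>
     form_lsc s2 \<Omega> lm \<and>
     (\<forall>\<phi>\<in>Cinf_boundary \<Omega>. lm \<phi> \<phi> \<ge> c1 * (Hs_seminorm s2 \<Omega> \<phi>)\<^sup>2) \<and>
     form_continuous s1 \<Omega> lr)"

text \<open>For \<open>h \<in> X\<close>, which need not be smooth, the second derivative is evaluated through its extension
  to \<open>H\<^sup>s\<close>. If \<open>X\<close> embeds continuously in \<open>H\<^sup>s\<close>, uniqueness of second order Taylor expansions on
  \<open>X\<close> makes this value equal to the second derivative of \<open>shape_fun J \<Omega>\<close> on \<open>X\<close> at \<open>(h, h)\<close>.\<close>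

definition condition_IT ::
    "real \<Rightarrow> ('a::euclidean_space \<Rightarrow> real) set \<Rightarrow> (('a \<Rightarrow> real) \<Rightarrow> real) \<Rightarrow>
     ('a set \<Rightarrow> real) \<Rightarrow> 'a set \<Rightarrow> bool" where
  "condition_IT s X nX J \<Omega> \<longleftrightarrow> C2_near_0 X nX (shape_fun J \<Omega>) \<and>
     (\<exists>\<eta>>0. \<exists>\<omega> :: real \<Rightarrow> real. (\<omega> \<longlongrightarrow> 0) (at_right 0) \<and>
        (\<forall>h\<in>X. nX h \<le> \<eta> \<longrightarrow>
           \<bar>ereal (J (normal_graph \<Omega> h) - J \<Omega> - shape_l1 J \<Omega> h)
              - ereal (1/2) * density_ext s \<Omega> (shape_l2 J \<Omega>) h\<bar>
           \<le> ereal (\<omega> (nX h) * (Hs_norm s \<Omega> h)\<^sup>2)))"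

end

theory Submission
  imports Defs "HOL-Library.Diagonal_Subsequence"
begin

text \<open>
  It suffices to show that \<open>l\<^sub>2\<close> is coercive on smooth functions: its extension by lower limits is
  then coercive on \<open>X\<close>, and condition (IT) absorbs the remainder. By the splitting in condition (C)
  and an Ehrling inequality, \<open>l\<^sub>2\<close> satisfies a Garding inequality in \<open>H\<^sup>s\<close> modulo \<open>L\<^sup>2\<close>. Minimise it
  on the unit sphere of \<open>L\<^sup>2\<close>. A minimising sequence is bounded in \<open>H\<^sup>s\<close>, so a subsequence converges in
  \<open>L\<^sup>2\<close>; the parallelogram identity then makes it Cauchy in \<open>H\<^sup>s\<close>, and positivity at its limit shows
  that the minimum is positive.

  The compactness and the Ehrling inequality for the boundary rest on comparing the Hausdorff measure
  in a graph chart, up to constants, with Lebesgue measure on a cylinder around it.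
\<close>

section \<open>Cylinders\<close>

text \<open>The main part of the form is only lower semicontinuous, so the extension
  \<open>density_ext\<close> may be infinite and need not be the limit along approximating smooth
  functions. Hence homogeneity, the parallelogram identity and the Garding inequality are used on
  smooth functions only. The limit of a minimising sequence enters through one inequality:
  \<open>density_ext\<close> there is at most the infimum. For this the sequence must enter every
  neighbourhood of the filter \<open>smooth_nhds\<close>, that is, converge strongly in H^s; weak
  convergence would not do. Once the infimum \<Lambda> is known to be positive,
  \<open>L2 f \<le> l f f / \<Lambda>\<close> absorbs the L^2 term of the Garding inequality.

  Comparing measures up to constants is enough because every estimate made in a chart bounds one
  nonnegative integral by another. The cylinder has a fixed height, so a slab of horizontal radius D
  in it has volume of order D^(d-1), the order of surface measure.\<close>

definition proj_away :: "'a::euclidean_space \<Rightarrow> 'a \<Rightarrow> 'a" where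
  "proj_away e z = z - (z \<bullet> e) *\<^sub>R e"

text \<open>Half-open in the direction \<open>e\<close>, so that translates stacked along
  \<open>e\<close> are disjoint and their volumes add up.\<close>

definition slab :: "'a::euclidean_space \<Rightarrow> real \<Rightarrow> real \<Rightarrow> 'a set" where
  "slab e D h = {z. norm (proj_away e z) \<le> D \<and> 0 \<le> z \<bullet> e \<and> z \<bullet> e < h}"

lemma proj_away_simps:
  "proj_away e (x + y) = proj_away e x + proj_away e y"
  "proj_away e (x - y) = proj_away e x - proj_away e y"
  "proj_away e (- x) = - proj_away e x"
  "proj_away e (t *\<^sub>R x) = t *\<^sub>R proj_away e x"
  "proj_away e 0 = 0"
  by (simp_all add: proj_away_def algebra_simps inner_diff_left inner_add_left)

lemma continuous_on_proj_away [continuous_intros]: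
  "continuous_on S f \<Longrightarrow> continuous_on S (\<lambda>x. proj_away e (f x))"
  unfolding proj_away_def by (intro continuous_intros)

lemma proj_away_self: "norm e = 1 \<Longrightarrow> proj_away e e = 0"
  by (simp add: proj_away_def dot_square_norm)

lemma norm_proj_away_sq: "norm e = 1 \<Longrightarrow> (norm z)\<^sup>2 = (norm (proj_away e z))\<^sup>2 + (z \<bullet> e)\<^sup>2"
proof -
  assume "norm e = 1"
  then have "e \<bullet> e = 1" by (simp add: dot_square_norm)
  then show ?thesis unfolding proj_away_def power2_norm_eq_inner
    by (simp add: inner_diff_left inner_diff_right inner_commute power2_eq_square)
qed

lemma norm_proj_away_le: "norm e = 1 \<Longrightarrow> norm (proj_away e z) \<le> norm z"
  using norm_proj_away_sq[of e z] by (metis le_add_same_cancel1 norm_ge_zero power2_le_imp_le zero_le_power2)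

lemma norm_le_proj_away: "norm e = 1 \<Longrightarrow> norm z \<le> norm (proj_away e z) + \<bar>z \<bullet> e\<bar>"
proof -
  assume "norm e = 1"
  moreover have "z = proj_away e z + (z \<bullet> e) *\<^sub>R e" by (simp add: proj_away_def)
  ultimately show ?thesis by (metis norm_triangle_ineq norm_scaleR mult.right_neutral)
qed

lemma slab_measurable [measurable]: "slab e D h \<in> sets borel"
proof -
  have "(\<lambda>z. norm (proj_away e z)) \<in> borel_measurable borel" "(\<lambda>z. z \<bullet> e) \<in> borel_measurable borel"
    by (auto intro!: borel_measurable_continuous_onI continuous_intros)
  then show ?thesis unfolding slab_def by measurable
qed

lemma emeasure_lborel_shift:
  fixes a :: "'a::euclidean_space"
  assumes [measurable]: "A \<in> sets borel"
  shows "emeasure lborel {z. z - a \<in> A} = emeasure lborel A"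
proof -
  have "emeasure lborel A = emeasure (distr lborel borel ((+) (-a))) A"
    by (simp add: lborel_distr_plus)
  also have "\<dots> = emeasure lborel ((+) (-a) -` A)"
    by (subst emeasure_distr) auto
  also have "(+) (-a) -` A = {z. z - a \<in> A}" by auto
  finally show ?thesis by simp
qed

lemma emeasure_lborel_scale:
  fixes A :: "'a::euclidean_space set"
  assumes "A \<in> sets borel" "D > 0"
  shows "emeasure lborel {z. z /\<^sub>R D \<in> A} = ennreal (D ^ DIM('a)) * emeasure lborel A"
proof -
  have eq: "{z. z /\<^sub>R D \<in> A} = (\<lambda>x. D *\<^sub>R x + 0) ` A"
  proof (intro equalityI subsetI)
    fix z assume "z \<in> {z. z /\<^sub>R D \<in> A}"
    then have "z = D *\<^sub>R (z /\<^sub>R D) + 0" "z /\<^sub>R D \<in> A" using assms by auto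
    then show "z \<in> (\<lambda>x. D *\<^sub>R x + 0) ` A" by blast
  qed (use assms in auto)
  have m: "{z. z /\<^sub>R D \<in> A} \<in> sets borel" 
    using measurable_sets_borel[of "\<lambda>z. z /\<^sub>R D" borel A] assms by (simp add: vimage_def)
  have "emeasure lborel {z. z /\<^sub>R D \<in> A} = emeasure lebesgue {z. z /\<^sub>R D \<in> A}"
    using m by simp
  also have "\<dots> = ennreal (D ^ DIM('a)) * emeasure lebesgue A"
    unfolding eq using assms by (subst emeasure_lebesgue_affine) auto
  finally show ?thesis using assms by simp
qed

text \<open>The tall slab is a stack of \<open>n\<close> translates of the slab of height
  \<open>h\<close>; the induction adds the top one.\<close>

lemma emeasure_slab_mult:
  assumes e: "norm e = 1" and h: "h \<ge> 0"
  shows "emeasure lborel (slab e D (real n * h)) = of_nat n * emeasure lborel (slab e D h)"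
proof (induction n)
  case 0
  have "slab e D 0 = {}" by (auto simp: slab_def)
  then show ?case by simp
next
  case (Suc n)
  let ?a = "(real n * h) *\<^sub>R e"
  have p: "proj_away e (z - ?a) = proj_away e z" for z
    by (simp add: proj_away_simps proj_away_self e)
  have i: "(z - ?a) \<bullet> e = z \<bullet> e - real n * h" for z
    using e by (simp add: inner_diff_left dot_square_norm)
  have le: "real n * h \<ge> 0" using h by simp
  have eq: "{z. z - ?a \<in> slab e D h}
      = {z. norm (proj_away e z) \<le> D \<and> real n * h \<le> z \<bullet> e \<and> z \<bullet> e < real n * h + h}"
    unfolding slab_def mem_Collect_eq p i by auto
  have "slab e D (real (Suc n) * h) = slab e D (real n * h) \<union> {z. z - ?a \<in> slab e D h}"
    unfolding eq using h by (auto simp: slab_def distrib_right intro: order_trans[OF le])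
  moreover have "slab e D (real n * h) \<inter> {z. z - ?a \<in> slab e D h} = {}"
    unfolding eq by (auto simp: slab_def)
  moreover have "{z. z - ?a \<in> slab e D h} \<in> sets borel"
    using measurable_sets_borel[of "\<lambda>z. z - ?a" borel "slab e D h"] by (simp add: vimage_def)
  ultimately have "emeasure lborel (slab e D (real (Suc n) * h))
      = emeasure lborel (slab e D (real n * h)) + emeasure lborel (slab e D h)"
    by (simp add: plus_emeasure[symmetric] emeasure_lborel_shift)
  then show ?case using Suc by (simp add: distrib_right add.commute)
qed

text \<open>With height equal to radius, the slab is a dilate of the unit slab.\<close>

lemma emeasure_slab_square:
  fixes e :: "'a::euclidean_space"
  assumes "D > 0"
  shows "emeasure lborel (slab e D D) = ennreal (D ^ DIM('a)) * emeasure lborel (slab e 1 1)"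
proof -
  have "slab e D D = {z. z /\<^sub>R D \<in> slab e 1 1}"
    using assms by (auto simp: slab_def proj_away_simps field_simps)
  then show ?thesis using emeasure_lborel_scale[OF slab_measurable assms, of e 1 1] by simp
qed

lemma slab_unit_bounds:
  fixes e :: "'a::euclidean_space"
  assumes e: "norm e = 1"
  shows "0 < emeasure lborel (slab e 1 1)" "emeasure lborel (slab e 1 1) < \<infinity>"
proof -
  have "ball (e /\<^sub>R 2) (1/2) \<subseteq> slab e 1 1"
  proof
    fix z assume "z \<in> ball (e /\<^sub>R 2) (1/2)"
    then have w: "norm (z - e /\<^sub>R 2) < 1/2" by (simp add: dist_norm norm_minus_commute)
    have "norm (proj_away e z) = norm (proj_away e (z - e /\<^sub>R 2))"
      using e by (simp add: proj_away_simps proj_away_self)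
    also have "\<dots> < 1/2" using norm_proj_away_le[OF e, of "z - e /\<^sub>R 2"] w by linarith
    finally have 1: "norm (proj_away e z) \<le> 1" by simp
    have "\<bar>(z - e /\<^sub>R 2) \<bullet> e\<bar> < 1/2" using Cauchy_Schwarz_ineq2[of "z - e /\<^sub>R 2" e] e w by simp
    then have "\<bar>z \<bullet> e - 1/2\<bar> < 1/2" using e by (simp add: inner_diff_left dot_square_norm)
    then have "0 \<le> z \<bullet> e" "z \<bullet> e < 1" by linarith+
    then show "z \<in> slab e 1 1" using 1 by (simp add: slab_def)
  qed
  then have "emeasure lborel (ball (e /\<^sub>R 2) (1/2)) \<le> emeasure lborel (slab e 1 1)"
    by (intro emeasure_mono) auto
  moreover have "0 < emeasure lborel (ball (e /\<^sub>R 2) (1/2))"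
    by (subst emeasure_ball) (auto intro!: mult_pos_pos)
  ultimately show "0 < emeasure lborel (slab e 1 1)" by (simp add: less_le_trans)
  have "slab e 1 1 \<subseteq> ball 0 3"
  proof
    fix z assume "z \<in> slab e 1 1"
    then show "z \<in> ball 0 3" using norm_le_proj_away[OF e, of z] by (auto simp: slab_def)
  qed
  then have "emeasure lborel (slab e 1 1) \<le> emeasure lborel (ball (0::'a) 3)"
    by (intro emeasure_mono) auto
  then show "emeasure lborel (slab e 1 1) < \<infinity>"
    using emeasure_lborel_ball_finite le_less_trans by blast
qed

lemma slab_mono: "D \<le> D' \<Longrightarrow> h \<le> h' \<Longrightarrow> slab e D h \<subseteq> slab e D' h'"
  by (auto simp: slab_def)

text \<open>About \<open>H / D\<close> slabs of height \<open>D\<close>, each of volume a constant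
  times \<open>D ^ DIM('a)\<close>, fill the slab of height \<open>H\<close>. Rounding
  \<open>H / D\<close> to an integer costs a factor 2, harmless as only the order of magnitude
  matters. The upper bound includes \<open>D = 0\<close>, since a covering set may be a single
  point.\<close>

lemma emeasure_slab_bounds:
  fixes e :: "'a::euclidean_space"
  assumes e: "norm e = 1" and H: "H > 0"
  shows "\<exists>k>0. \<forall>D. 0 < D \<longrightarrow> D \<le> H \<longrightarrow>
      ennreal (k * D ^ (DIM('a) - 1)) \<le> emeasure lborel (slab e D H)"
    and "\<exists>K>0. \<forall>D. 0 \<le> D \<longrightarrow> D \<le> H \<longrightarrow>
      emeasure lborel (slab e D H) \<le> ennreal (K * D ^ (DIM('a) - 1))"
proof -
  let ?m = "DIM('a) - 1"
  define \<kappa> where "\<kappa> = measure lborel (slab e 1 1)"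
  have \<kappa>: "emeasure lborel (slab e 1 1) = ennreal \<kappa>"
    using slab_unit_bounds[OF e] by (simp add: \<kappa>_def emeasure_eq_ennreal_measure)
  have \<kappa>pos: "\<kappa> > 0" using slab_unit_bounds(1)[OF e] \<kappa> by simp
  have dim: "D ^ DIM('a) = D * D ^ ?m" for D :: real
    by (metis DIM_positive power_eq_if less_numeral_extra(3))
  have mult: "emeasure lborel (slab e D (real n * D)) = ennreal (real n * D * D ^ ?m * \<kappa>)" if "D > 0" for D n
    using that \<kappa>pos by (simp add: emeasure_slab_mult[OF e] emeasure_slab_square \<kappa> dim
        ennreal_of_nat_eq_real_of_nat ennreal_mult[symmetric] mult.assoc)
  have lower: "ennreal (\<kappa> * H / 2 * D ^ ?m) \<le> emeasure lborel (slab e D H)" if D: "0 < D" "D \<le> H" for D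
  proof -
    define n where "n = nat \<lfloor>H / D\<rfloor>"
    have "real n = of_int \<lfloor>H / D\<rfloor>" using D by (simp add: n_def)
    then have n: "real n \<le> H / D" "H / D < real n + 1" by linarith+
    moreover have "1 \<le> H / D" using D by simp
    ultimately have "real n * 2 > H / D" 
      by (smt (verit) of_nat_less_iff of_nat_1 less_one of_nat_0 not_less)
    then have "H / 2 \<le> real n * D" using D by (simp add: field_simps)
    then have "\<kappa> * H / 2 * D ^ ?m \<le> real n * D * D ^ ?m * \<kappa>"
      using mult_right_mono[of "H/2" "real n * D" "D ^ ?m * \<kappa>"] \<kappa>pos D by (simp add: mult_ac)
    then have "ennreal (\<kappa> * H / 2 * D ^ ?m) \<le> emeasure lborel (slab e D (real n * D))"
      by (simp add: mult[OF D(1)] ennreal_leI)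
    also have "\<dots> \<le> emeasure lborel (slab e D H)"
      using n(1) D by (intro emeasure_mono slab_mono) (auto simp: field_simps)
    finally show ?thesis .
  qed
  have upper: "emeasure lborel (slab e D H) \<le> ennreal (2 * \<kappa> * H * D ^ ?m)" if D: "0 < D" "D \<le> H" for D
  proof -
    define n where "n = nat \<lceil>H / D\<rceil>"
    have "real n = of_int \<lceil>H / D\<rceil>" using D by (simp add: n_def)
    then have n: "H / D \<le> real n" "real n \<le> H / D + 1" by linarith+
    moreover have "1 \<le> H / D" using D by simp
    ultimately have "real n \<le> 2 * (H / D)" by linarith
    then have *: "real n * D \<le> 2 * H" using D by (simp add: field_simps)
    have "emeasure lborel (slab e D H) \<le> emeasure lborel (slab e D (real n * D))"
      using n(1) D by (intro emeasure_mono slab_mono) (auto simp: field_simps)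
    also have "\<dots> = ennreal (real n * D * D ^ ?m * \<kappa>)" by (rule mult[OF D(1)])
    also have "\<dots> \<le> ennreal (2 * \<kappa> * H * D ^ ?m)"
      using mult_right_mono[OF *, of "D ^ ?m * \<kappa>"] \<kappa>pos D by (intro ennreal_leI) (simp add: mult_ac)
    finally show ?thesis .
  qed
  \<comment> \<open>The exponent is \<open>0\<close> in dimension one, where
    \<open>0 ^ 0 = 1\<close>. Letting \<open>D\<close> decrease to \<open>0\<close> treats this case
    and the higher dimensions at once.\<close>
  have upper0: "emeasure lborel (slab e 0 H) \<le> ennreal (2 * \<kappa> * H * 0 ^ ?m)"
  proof (rule tendsto_lowerbound)
    have "((\<lambda>D. 2 * \<kappa> * H * D ^ ?m) \<longlongrightarrow> 2 * \<kappa> * H * 0 ^ ?m) (at_right (0::real))"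
      by (intro tendsto_intros)
    then show "((\<lambda>D. ennreal (2 * \<kappa> * H * D ^ ?m)) \<longlongrightarrow> ennreal (2 * \<kappa> * H * 0 ^ ?m)) (at_right 0)"
      by (rule tendsto_ennrealI)
    have "\<forall>\<^sub>F D in at_right 0. D \<in> {0<..<H}"
      using H by (rule eventually_at_right_real)
    then show "\<forall>\<^sub>F D in at_right 0. emeasure lborel (slab e 0 H) \<le> ennreal (2 * \<kappa> * H * D ^ ?m)"
    proof eventually_elim
      case (elim D)
      have "emeasure lborel (slab e 0 H) \<le> emeasure lborel (slab e D H)"
        using elim by (intro emeasure_mono slab_mono) auto
      then show ?case using upper[of D] elim by auto
    qed
  qed simp
  show "\<exists>k>0. \<forall>D. 0 < D \<longrightarrow> D \<le> H \<longrightarrow>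
      ennreal (k * D ^ (DIM('a) - 1)) \<le> emeasure lborel (slab e D H)"
    using \<kappa>pos H lower by (intro exI[of _ "\<kappa> * H / 2"]) auto
  have "emeasure lborel (slab e D H) \<le> ennreal (2 * \<kappa> * H * D ^ ?m)" if "0 \<le> D" "D \<le> H" for D
    using that upper upper0 by (cases "D = 0") auto
  then show "\<exists>K>0. \<forall>D. 0 \<le> D \<longrightarrow> D \<le> H \<longrightarrow>
      emeasure lborel (slab e D H) \<le> ennreal (K * D ^ (DIM('a) - 1))"
    using \<kappa>pos H by (intro exI[of _ "2 * \<kappa> * H"]) auto
qed

section \<open>Hausdorff measure of a graph\<close>

lemma sets_hausdorff_measure [simp, measurable_cong]: "sets (hausdorff_measure m) = sets borel"
  and space_hausdorff_measure [simp]: "space (hausdorff_measure m) = UNIV"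
  unfolding hausdorff_measure_def using sets.sigma_sets_eq[of borel] 
  by (simp_all add: sets_measure_of space_measure_of)

abbreviation hausdorff_outer :: "nat \<Rightarrow> 'a::metric_space set \<Rightarrow> ennreal" where
  "hausdorff_outer m A \<equiv> (SUP \<delta>\<in>{0<..}. hausdorff_content m \<delta> A)"

text \<open>\<open>measure_of\<close> yields either the outer measure or \<open>0\<close>, so upper
  bounds hold unconditionally.\<close>

lemma emeasure_hausdorff_le: "emeasure (hausdorff_measure m) A \<le> hausdorff_outer m A"
  unfolding hausdorff_measure_def emeasure_measure_of_conv by simp

text \<open>\<open>measure_of\<close> returns the zero measure unless the set function is countably additive. Instead of
  proving additivity of the Hausdorff outer measure, lower bounds are stated for the case that some
  set has nonzero measure; if there is none, every Sobolev norm on the boundary vanishes.\<close>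

lemma emeasure_hausdorff_eq:
  fixes A B :: "'a::metric_space set"
  assumes "emeasure (hausdorff_measure m) B \<noteq> 0" "A \<in> sets borel"
  shows "emeasure (hausdorff_measure m) A = hausdorff_outer m A"
  using assms sets.sigma_sets_eq[of borel] 
  unfolding hausdorff_measure_def emeasure_measure_of_conv by (auto split: if_splits)

lemma hausdorff_content_antimono:
  "\<delta> \<le> \<delta>' \<Longrightarrow> hausdorff_content m \<delta>' A \<le> hausdorff_content m \<delta> A"
  unfolding hausdorff_content_def by (rule INF_superset_mono) (auto intro: order_trans)

lemma hausdorff_content_le_finite_cover:
  fixes A :: "'a::euclidean_space set"
  assumes "finite F" "A \<subseteq> (\<Union>p\<in>F. ball p r)" "r > 0"
  shows "hausdorff_content m (2 * r) A \<le> of_nat (card F) * ennreal (unit_ball_vol (real m) * r ^ m)"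
proof -
  obtain f where f: "bij_betw f {0..<card F} F"
    using ex_bij_betw_nat_finite[OF assms(1)] by blast
  \<comment> \<open>Padding with empty sets is free: \<open>hausdorff_content\<close> assigns them
    \<open>0\<close> explicitly, which matters for \<open>m = 0\<close>, where
    \<open>(0 / 2) ^ 0 = 1\<close>.\<close>
  define C where "C i = (if i < card F then ball (f i) r else {})" for i
  have diam: "diameter (C i) \<le> 2 * r" for i
    unfolding C_def using assms(3) by simp
  have "A \<subseteq> (\<Union>i. C i)"
  proof
    fix x assume "x \<in> A"
    then obtain p where "p \<in> F" "x \<in> ball p r" using assms(2) by blast
    moreover have "p \<in> f ` {0..<card F}" using f \<open>p \<in> F\<close> by (simp add: bij_betw_def)
    ultimately obtain i where "i < card F" "x \<in> ball (f i) r" by auto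
    then have "x \<in> C i" by (simp add: C_def)
    then show "x \<in> (\<Union>i. C i)" by blast
  qed
  then have "hausdorff_content m (2 * r) A
      \<le> (\<Sum>i. if C i = {} then 0 else ennreal (unit_ball_vol (real m) * (diameter (C i) / 2) ^ m))"
    unfolding hausdorff_content_def using diam by (intro INF_lower) (auto simp: C_def)
  also have "\<dots> = (\<Sum>i<card F. if C i = {} then 0 else ennreal (unit_ball_vol (real m) * (diameter (C i) / 2) ^ m))"
    by (rule suminf_finite) (auto simp: C_def)
  also have "\<dots> \<le> (\<Sum>i<card F. ennreal (unit_ball_vol (real m) * r ^ m))"
  proof (rule sum_mono)
    fix i assume "i \<in> {..<card F}"
    have "(diameter (C i) / 2) ^ m \<le> r ^ m" if "C i \<noteq> {}"
      using diam[of i] diameter_ge_0[of "C i"] by (intro power_mono) (auto simp: C_def)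
    then show "(if C i = {} then 0 else ennreal (unit_ball_vol (real m) * (diameter (C i) / 2) ^ m))
        \<le> ennreal (unit_ball_vol (real m) * r ^ m)"
      by (auto intro!: ennreal_leI mult_left_mono)
  qed
  finally show ?thesis by simp
qed

text \<open>\<open>G\<close> parametrises the piece of \<open>S\<close> over the cylinder: it moves points along \<open>e\<close> only. Keeping the
  full-dimensional cylinder as the parameter domain avoids introducing \<open>(d-1)\<close>-dimensional Lebesgue
  measure.\<close>

locale graph_chart =
  fixes S :: "'a::euclidean_space set" and x0 e :: 'a and \<rho> L :: real and G :: "'a \<Rightarrow> 'a"
    and Z :: "'a set"
  defines "Z \<equiv> {z. norm (proj_away e (z - x0)) < \<rho> \<and> \<bar>(z - x0) \<bullet> e\<bar> < \<rho>}"
  assumes norm_e: "norm e = 1" and rho: "\<rho> > 0" and L: "L \<ge> 1" and compact_S: "compact S"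
    and G_vertical: "\<And>z. proj_away e (G z) = proj_away e z"
    and G_continuous: "continuous_on UNIV G"
    and G_in: "\<And>z. z \<in> Z \<Longrightarrow> G z \<in> S"
    and G_id: "\<And>p. p \<in> S \<Longrightarrow> dist x0 p < \<rho> \<Longrightarrow> G p = p"
    and G_lipschitz: "\<And>z w. z \<in> Z \<Longrightarrow> w \<in> Z \<Longrightarrow> norm (G z - G w) \<le> L * norm (proj_away e (z - w))"
begin

lemma ee: "e \<bullet> e = 1" using norm_e by (simp add: dot_square_norm)

lemma open_Z: "open Z"
  unfolding Z_def by (intro open_Collect_conj open_Collect_less continuous_intros)

lemma G_measurable [measurable]: "G \<in> borel_measurable borel"
  using G_continuous by (rule borel_measurable_continuous_onI)

lemma Z_measurable [measurable]: "Z \<in> sets borel"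
  using open_Z by simp

lemma ball_subset_Z: "ball x0 \<rho> \<subseteq> Z"
proof
  fix z assume "z \<in> ball x0 \<rho>"
  then have "norm (z - x0) < \<rho>" by (simp add: dist_norm norm_minus_commute)
  then show "z \<in> Z"
    using norm_proj_away_le[OF norm_e, of "z - x0"] Cauchy_Schwarz_ineq2[of "z - x0" e] norm_e
    by (simp add: Z_def)
qed

lemma proj_le_G: "norm (proj_away e (z - w)) \<le> norm (G z - G w)"
  using norm_proj_away_le[OF norm_e, of "G z - G w"] by (simp add: proj_away_simps G_vertical)

lemma Z_finite: "emeasure lborel Z < \<infinity>"
proof -
  have "Z \<subseteq> ball x0 (2 * \<rho>)"
  proof
    fix z assume "z \<in> Z"
    then show "z \<in> ball x0 (2 * \<rho>)" using norm_le_proj_away[OF norm_e, of "z - x0"]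
      by (simp add: Z_def dist_norm norm_minus_commute)
  qed
  then have "emeasure lborel Z \<le> emeasure lborel (ball x0 (2 * \<rho>))" by (intro emeasure_mono) auto
  then show ?thesis using emeasure_lborel_ball_finite le_less_trans by blast
qed

lemma shifted_slab_measurable: "{z. z - a \<in> slab e D h} \<in> sets borel"
  using measurable_sets_borel[of "\<lambda>z. z - a" borel "slab e D h"] by (simp add: vimage_def)

text \<open>\<open>G\<close> does not change horizontal parts. So all points of the cylinder that
  \<open>G\<close> sends into a covering set \<open>U i\<close> lie in one slab whose radius is the
  diameter of \<open>U i\<close>; summing the slab volumes over a cover gives the content.\<close>

lemma volume_le_hausdorff_outer:
  "\<exists>C\<ge>0. \<forall>A. emeasure lborel {z \<in> Z. G z \<in> A} \<le> ennreal C * hausdorff_outer (DIM('a) - 1) A"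
proof -
  let ?m = "DIM('a) - 1"
  have "2 * \<rho> > 0" using rho by simp
  from emeasure_slab_bounds(2)[OF norm_e this] obtain K where K0: "0 < K \<and> (\<forall>D. 0 \<le> D \<longrightarrow> D \<le> 2 * \<rho> \<longrightarrow>
      emeasure lborel (slab e D (2 * \<rho>)) \<le> ennreal (K * D ^ ?m))" by (rule exE)
  then have K: "0 < K"
    "\<And>D. 0 \<le> D \<Longrightarrow> D \<le> 2 * \<rho> \<Longrightarrow> emeasure lborel (slab e D (2 * \<rho>)) \<le> ennreal (K * D ^ ?m)"
    by simp_all
  define \<omega> where "\<omega> = unit_ball_vol (real ?m)"
  have \<omega>: "\<omega> > 0" by (simp add: \<omega>_def)
  \<comment> \<open>Chosen so that \<open>K * D ^ ?m = C * (\<omega> * (D / 2) ^ ?m)\<close>, the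
    term of the Hausdorff content.\<close>
  define C where "C = K * 2 ^ ?m / \<omega>"
  have "emeasure lborel {z \<in> Z. G z \<in> A} \<le> ennreal C * hausdorff_content ?m (2 * \<rho>) A" for A
  proof -
    have "emeasure lborel {z \<in> Z. G z \<in> A} \<le> ennreal C * (\<Sum>i. if U i = {} then 0
            else ennreal (\<omega> * (diameter (U i) / 2) ^ ?m))"
      if U: "A \<subseteq> (\<Union>i. U i)" "\<And>i. bounded (U i) \<and> diameter (U i) \<le> 2 * \<rho>" for U :: "nat \<Rightarrow> 'a set"
    proof -
      \<comment> \<open>The set on the left need not be measurable, so it is enclosed in a Borel set
        \<open>T\<close> before volumes are added.\<close>
      have "\<exists>T. T \<in> sets borel \<and> {z \<in> Z. G z \<in> U i} \<subseteq> T \<and> emeasure lborel T \<le>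
          ennreal C * (if U i = {} then 0 else ennreal (\<omega> * (diameter (U i) / 2) ^ ?m))" for i
      proof (cases "{z \<in> Z. G z \<in> U i} = {}")
        case True
        then show ?thesis by (intro exI[of _ "{}"]) auto
      next
        case False
        then obtain w where w: "w \<in> Z" "G w \<in> U i" by auto
        \<comment> \<open>\<open>w\<close> lowered to the bottom of the cylinder: a slab of height
          \<open>2 * \<rho>\<close> based there spans its whole height.\<close>
        define a where "a = w - ((w - x0) \<bullet> e + \<rho>) *\<^sub>R e"
        let ?T = "{z. z - a \<in> slab e (diameter (U i)) (2 * \<rho>)}"
        have p: "proj_away e (z - a) = proj_away e (z - w)" for z
          by (simp add: a_def proj_away_simps proj_away_self norm_e)
        have i: "(z - a) \<bullet> e = (z - x0) \<bullet> e + \<rho>" for z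
          by (simp add: a_def inner_diff_left inner_add_left ee)
        have "{z \<in> Z. G z \<in> U i} \<subseteq> ?T"
        proof
          fix z assume z: "z \<in> {z \<in> Z. G z \<in> U i}"
          have "norm (proj_away e (z - a)) \<le> norm (G z - G w)" unfolding p by (rule proj_le_G)
          also have "\<dots> \<le> diameter (U i)"
            using diameter_bounded_bound[of "U i" "G z" "G w"] U(2) z w by (auto simp: dist_norm)
          finally show "z \<in> ?T" using z unfolding slab_def mem_Collect_eq i by (auto simp: Z_def)
        qed
        moreover have "emeasure lborel ?T \<le> ennreal (K * diameter (U i) ^ ?m)"
          using emeasure_lborel_shift[OF slab_measurable, of a e "diameter (U i)" "2 * \<rho>"]
            K(2)[of "diameter (U i)"] diameter_ge_0[of "U i"] U(2) by simp
        moreover have "K * diameter (U i) ^ ?m = C * (\<omega> * (diameter (U i) / 2) ^ ?m)"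
          using \<omega> by (simp add: C_def power_divide)
        ultimately show ?thesis using w(2) K(1) \<omega> diameter_ge_0[of "U i"] U(2)
          by (intro exI[of _ ?T] conjI shifted_slab_measurable) (auto simp: ennreal_mult[symmetric] C_def)
      qed
      then have "\<forall>i. \<exists>T. T \<in> sets borel \<and> {z \<in> Z. G z \<in> U i} \<subseteq> T \<and> emeasure lborel T \<le>
          ennreal C * (if U i = {} then 0 else ennreal (\<omega> * (diameter (U i) / 2) ^ ?m))" by (rule allI)
      from choice[OF this] obtain T where "\<forall>i. T i \<in> sets borel \<and> {z \<in> Z. G z \<in> U i} \<subseteq> T i \<and> emeasure lborel (T i) \<le>
          ennreal C * (if U i = {} then 0 else ennreal (\<omega> * (diameter (U i) / 2) ^ ?m))" by (rule exE)
      then have T: "\<And>i. T i \<in> sets borel" "\<And>i. {z \<in> Z. G z \<in> U i} \<subseteq> T i"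
        "\<And>i. emeasure lborel (T i) \<le> ennreal C * (if U i = {} then 0 else ennreal (\<omega> * (diameter (U i) / 2) ^ ?m))"
        by simp_all
      have "{z \<in> Z. G z \<in> A} \<subseteq> (\<Union>i. T i)" using U(1) T(2) by fastforce
      then have "emeasure lborel {z \<in> Z. G z \<in> A} \<le> emeasure lborel (\<Union>i. T i)"
        using T(1) by (intro emeasure_mono) auto
      also have "\<dots> \<le> (\<Sum>i. emeasure lborel (T i))"
        using T(1) by (intro emeasure_subadditive_countably) auto
      also have "\<dots> \<le> (\<Sum>i. ennreal C * (if U i = {} then 0 else ennreal (\<omega> * (diameter (U i) / 2) ^ ?m)))"
        using T(3) by (intro suminf_le) auto
      finally show ?thesis by simp
    qed
    note * = this
    have "C > 0" using K \<omega> by (simp add: C_def)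
    then have cC: "ennreal C \<noteq> 0" by simp
    \<comment> \<open>The content is an infimum over covers, so the constant is moved to the other
      side before \<open>INF_greatest\<close> applies.\<close>
    have "emeasure lborel {z \<in> Z. G z \<in> A} / ennreal C \<le> hausdorff_content ?m (2 * \<rho>) A"
      unfolding hausdorff_content_def \<omega>_def[symmetric]
      by (rule INF_greatest) (use * cC in \<open>auto intro!: divide_le_posI_ennreal simp: zero_less_iff_neq_zero mult.commute\<close>)
    then have "ennreal C * (emeasure lborel {z \<in> Z. G z \<in> A} / ennreal C) \<le> ennreal C * hausdorff_content ?m (2 * \<rho>) A"
      by (rule mult_left_mono) simp
    then show ?thesis using cC by (simp add: ennreal_times_divide mult_divide_eq_ennreal mult.commute[of "ennreal C" "emeasure _ _"])
  qed
  moreover have "hausdorff_content ?m (2 * \<rho>) A \<le> hausdorff_outer ?m A" for A :: "'a set"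
    using rho by (intro SUP_upper) auto
  ultimately have "emeasure lborel {z \<in> Z. G z \<in> A} \<le> ennreal C * hausdorff_outer ?m A" for A
    by (meson mult_left_mono order_trans zero_le)
  moreover have "C \<ge> 0" using K \<omega> by (simp add: C_def)
  ultimately show ?thesis by blast
qed

text \<open>Vitali covering: cover \<open>A\<close> by balls of radius \<delta> and keep a disjoint
  subfamily whose fivefold enlargements still cover \<open>A\<close>. Near each kept centre the
  cylinder contains a slab of radius proportional to \<delta> which \<open>G\<close> maps close to
  \<open>A\<close>, and these slabs are disjoint. So the number of balls times \<delta>^(d-1) is at
  most a constant times the volume of the points that \<open>G\<close> maps within \<delta> of
  \<open>A\<close>. Since \<open>A\<close> is closed, these sets decrease to the preimage of
  \<open>A\<close> as \<delta> tends to 0.\<close>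

lemma hausdorff_outer_compact_le:
  "\<exists>C\<ge>0. \<forall>A. compact A \<longrightarrow> A \<subseteq> S \<inter> cball x0 (\<rho> / 2) \<longrightarrow>
     hausdorff_outer (DIM('a) - 1) A \<le> ennreal C * emeasure lborel {z \<in> Z. G z \<in> A}"
proof -
  let ?m = "DIM('a) - 1"
  define \<omega> where "\<omega> = unit_ball_vol (real ?m)"
  have \<omega>: "\<omega> > 0" by (simp add: \<omega>_def)
  from emeasure_slab_bounds(1)[OF norm_e rho] obtain k where k0: "0 < k \<and> (\<forall>D. 0 < D \<longrightarrow> D \<le> \<rho> \<longrightarrow>
      ennreal (k * D ^ ?m) \<le> emeasure lborel (slab e D \<rho>))" by (rule exE)
  then have k: "0 < k"
    "\<And>D. 0 < D \<Longrightarrow> D \<le> \<rho> \<Longrightarrow> ennreal (k * D ^ ?m) \<le> emeasure lborel (slab e D \<rho>)"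
    by simp_all
  \<comment> \<open>If slabs of radius \<open>c * \<delta>\<close> about two centres met, the
    Lipschitz bound would put the centres within
    \<open>2 * (L * c) * \<delta> = \<delta> / 2\<close>, but disjoint balls of radius \<delta> have
    centres at least \<delta> apart.\<close>
  define c where "c = 1 / (4 * L)"
  have c: "c > 0" "c \<le> 1/4" "L * c = 1/4" using L by (auto simp: c_def field_simps)
  define C where "C = \<omega> * 5 ^ ?m / (k * c ^ ?m)"
  have C: "C > 0" using \<omega> k c by (simp add: C_def)
  have "hausdorff_outer ?m A \<le> ennreal C * emeasure lborel {z \<in> Z. G z \<in> A}"
    if A: "compact A" "A \<subseteq> S \<inter> cball x0 (\<rho> / 2)" for A
  \<comment> \<open>\<open>infdist\<close> to the empty set is \<open>0\<close>, so for empty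
    \<open>A\<close> the sets \<open>E\<close> below would not shrink to the preimage of
    \<open>A\<close>.\<close>
  proof (cases "A = {}")
    case True
    have "hausdorff_content ?m \<delta> A \<le> 0" if "\<delta> > 0" for \<delta>
      using hausdorff_content_le_finite_cover[of "{}" A "\<delta> / 2" ?m] that True by simp
    then have "hausdorff_outer ?m A \<le> 0" by (intro SUP_least) auto
    then show ?thesis by (metis order_trans zero_le)
  next
    case False
    have AZ: "p \<in> Z" "G p = p" if "p \<in> A" for p
    proof -
      have "p \<in> S" "dist x0 p < \<rho>" using that A(2) rho by fastforce+
      then show "p \<in> Z" "G p = p" using ball_subset_Z G_id by auto
    qed
    define E where "E \<delta> = {z \<in> Z. infdist (G z) A \<le> \<delta>}" for \<delta>
    have E_meas [measurable]: "E \<delta> \<in> sets borel" for \<delta>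
    proof -
      have "(\<lambda>z. infdist (G z) A) \<in> borel_measurable borel"
        by (intro borel_measurable_continuous_onI continuous_on_infdist G_continuous)
      then show ?thesis unfolding E_def by measurable
    qed
    have main: "hausdorff_content ?m (10 * \<delta>) A \<le> ennreal C * emeasure lborel (E \<delta>)"
      if \<delta>: "0 < \<delta>" "\<delta> \<le> \<rho>" for \<delta>
    proof -
      have cover: "A \<subseteq> (\<Union>a\<in>A. ball a \<delta>)" using \<delta> by auto
      obtain D where D: "D \<subseteq> A" "finite D" "A \<subseteq> (\<Union>a\<in>D. ball a \<delta>)"
        by (rule compactE_image[OF A(1) open_ball cover])
      obtain F where "countable F" and F: "F \<subseteq> D" "pairwise (\<lambda>i j. disjnt (ball i \<delta>) (ball j \<delta>)) F"
        "A \<subseteq> (\<Union>i\<in>F. ball i (5 * \<delta>))"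
        by (rule Vitali_covering_lemma_balls[where S=A and K=D and a="\<lambda>x. x" and r="\<lambda>_. \<delta>" and B=\<delta>])
          (use D(3) \<delta> in auto)
      have finF: "finite F" using F(1) D(2) finite_subset by blast
      \<comment> \<open>\<open>p\<close> moved vertically to the level of \<open>x0\<close>, so that
        the slab of height \<rho> above it stays in the upper half of the cylinder.\<close>
      define p' where "p' p = p - ((p - x0) \<bullet> e) *\<^sub>R e" for p
      define T where "T p = {z. z - p' p \<in> slab e (c * \<delta>) \<rho>}" for p
      have pp: "proj_away e (z - p' p) = proj_away e (z - p)" for z p
        by (simp add: p'_def proj_away_simps proj_away_self norm_e)
      have ip: "(z - p' p) \<bullet> e = (z - x0) \<bullet> e" for z p
        by (simp add: p'_def inner_diff_left inner_add_left ee)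
      have TE: "z \<in> E \<delta>" "norm (proj_away e (z - p)) \<le> c * \<delta>" if "p \<in> F" "z \<in> T p" for p z
      proof -
        have pA: "p \<in> A" using that F(1) D(1) by auto
        have z: "norm (proj_away e (z - p)) \<le> c * \<delta>" "0 \<le> (z - x0) \<bullet> e" "(z - x0) \<bullet> e < \<rho>"
          using that(2) unfolding T_def slab_def mem_Collect_eq pp ip by auto
        then show "norm (proj_away e (z - p)) \<le> c * \<delta>" by simp
        have "proj_away e (z - x0) = proj_away e (z - p) + proj_away e (p - x0)"
          by (simp add: proj_away_simps)
        then have 1: "norm (proj_away e (z - x0)) \<le> norm (proj_away e (z - p)) + norm (proj_away e (p - x0))"
          by (simp only: norm_triangle_ineq)
        have "p \<in> cball x0 (\<rho> / 2)" using pA A(2) by blast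
        then have 2: "norm (proj_away e (p - x0)) \<le> \<rho> / 2"
          using norm_proj_away_le[OF norm_e, of "p - x0"] by (simp add: dist_norm norm_minus_commute)
        have "c * \<delta> \<le> 1/4 * \<rho>" using c \<delta> by (intro mult_mono) auto
        then have "norm (proj_away e (z - x0)) < \<rho>" using 1 2 z(1) rho by linarith
        then have zZ: "z \<in> Z" using z by (simp add: Z_def)
        have "dist (G z) p \<le> L * norm (proj_away e (z - p))"
          using G_lipschitz[OF zZ AZ(1)[OF pA]] AZ(2)[OF pA] by (simp add: dist_norm)
        also have "\<dots> \<le> L * (c * \<delta>)" using z(1) L by (intro mult_left_mono) auto
        also have "\<dots> = \<delta> / 4" using c(3) by (simp add: mult.assoc[symmetric])
        finally have "infdist (G z) A \<le> \<delta>" using infdist_le[OF pA, of "G z"] \<delta> by linarith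
        then show "z \<in> E \<delta>" using zZ by (simp add: E_def)
      qed
      have disj: "disjoint_family_on T F"
        unfolding disjoint_family_on_def
      proof (intro ballI impI)
        fix p q assume pq: "p \<in> F" "q \<in> F" "p \<noteq> q"
        have far: "\<delta> \<le> dist p q"
        proof -
          have "disjnt (ball p \<delta>) (ball q \<delta>)" using F(2) pq by (simp add: pairwise_def)
          then have "q \<notin> ball p \<delta>" using \<delta>(1) by (auto simp: disjnt_iff)
          then show ?thesis by simp
        qed
        show "T p \<inter> T q = {}"
        proof (rule ccontr)
          assume "T p \<inter> T q \<noteq> {}"
          then obtain z where z: "z \<in> T p" "z \<in> T q" by auto
          have A2: "p \<in> A" "q \<in> A" using pq F(1) D(1) by auto
          have 1: "dist p q \<le> L * norm (proj_away e (p - q))"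
            using G_lipschitz[OF AZ(1)[OF A2(1)] AZ(1)[OF A2(2)]]
            unfolding AZ(2)[OF A2(1)] AZ(2)[OF A2(2)] dist_norm .
          have "proj_away e (p - q) = proj_away e (z - q) - proj_away e (z - p)"
            by (simp add: proj_away_simps)
          then have "norm (proj_away e (p - q)) \<le> norm (proj_away e (z - q)) + norm (proj_away e (z - p))"
            by (simp only: norm_triangle_ineq4)
          then have "norm (proj_away e (p - q)) \<le> c * \<delta> + c * \<delta>"
            using TE(2)[OF pq(1) z(1)] TE(2)[OF pq(2) z(2)] by linarith
          then have "L * norm (proj_away e (p - q)) \<le> L * (c * \<delta> + c * \<delta>)"
            using L by (intro mult_left_mono) auto
          with 1 have "dist p q \<le> L * (c * \<delta> + c * \<delta>)" by linarith
          also have "\<dots> = 2 * (L * c) * \<delta>" by (simp add: algebra_simps)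
          also have "\<dots> = \<delta> / 2" using c(3) by simp
          finally show False using far \<delta> by linarith
        qed
      qed
      have T_meas: "T p \<in> sets borel" for p
        unfolding T_def by (rule shifted_slab_measurable)
      have cd: "0 < c * \<delta>" "c * \<delta> \<le> \<rho>" using c \<delta> mult_mono[OF c(2) \<delta>(2)] rho by auto
      have "of_nat (card F) * ennreal (k * (c * \<delta>) ^ ?m) = (\<Sum>p\<in>F. ennreal (k * (c * \<delta>) ^ ?m))"
        by simp
      also have "\<dots> \<le> (\<Sum>p\<in>F. emeasure lborel (T p))"
        using k(2)[OF cd] by (intro sum_mono) (simp add: T_def emeasure_lborel_shift)
      also have "\<dots> = emeasure lborel (\<Union>p\<in>F. T p)"
      proof (rule sum_emeasure[OF _ disj finF])
        show "T ` F \<subseteq> sets lborel" using T_meas by (simp add: image_subset_iff)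
      qed
      also have "\<dots> \<le> emeasure lborel (E \<delta>)"
      proof (rule emeasure_mono)
        show "(\<Union>p\<in>F. T p) \<subseteq> E \<delta>" using TE(1) by (simp add: UN_subset_iff subset_eq)
      qed simp
      finally have 1: "of_nat (card F) * ennreal (k * (c * \<delta>) ^ ?m) \<le> emeasure lborel (E \<delta>)" .
      have "hausdorff_content ?m (10 * \<delta>) A \<le> of_nat (card F) * ennreal (\<omega> * (5 * \<delta>) ^ ?m)"
        using hausdorff_content_le_finite_cover[OF finF F(3), of ?m] \<delta> by (simp add: \<omega>_def)
      also have "\<omega> * (5 * \<delta>) ^ ?m = C * (k * (c * \<delta>) ^ ?m)"
        using k c \<delta> by (simp add: C_def power_mult_distrib)
      also have "ennreal \<dots> = ennreal C * ennreal (k * (c * \<delta>) ^ ?m)"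
        using C k cd by (intro ennreal_mult) auto
      also have "of_nat (card F) * (ennreal C * ennreal (k * (c * \<delta>) ^ ?m))
          = ennreal C * (of_nat (card F) * ennreal (k * (c * \<delta>) ^ ?m))" by (simp add: mult_ac)
      also have "\<dots> \<le> ennreal C * emeasure lborel (E \<delta>)" using 1 by (intro mult_left_mono) auto
      finally show ?thesis .
    qed
    define d where "d n = \<rho> / real (Suc n)" for n
    have d: "0 < d n" "d n \<le> \<rho>" "n \<le> n' \<Longrightarrow> d n' \<le> d n" for n n'
      using rho by (auto simp: d_def field_simps)
    have dlim: "d \<longlonglongrightarrow> 0" unfolding d_def using tendsto_mult[OF tendsto_const[of \<rho>] LIMSEQ_inverse_real_of_nat] by (simp add: divide_inverse)
    have "(\<lambda>n. emeasure lborel (E (d n))) \<longlonglongrightarrow> emeasure lborel (\<Inter>n. E (d n))"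
    proof (rule Lim_emeasure_decseq)
      show "antimono (\<lambda>n. E (d n))" 
      proof (rule antimonoI, rule subsetI)
        fix n n' z assume "n \<le> n'" "z \<in> E (d n')"
        then show "z \<in> E (d n)" using d(3)[of n n'] by (simp add: E_def)
      qed
      show "emeasure lborel (E (d n)) \<noteq> \<infinity>" for n
      proof -
        have "emeasure lborel (E (d n)) \<le> emeasure lborel Z" by (intro emeasure_mono) (auto simp: E_def)
        then show ?thesis using Z_finite by (metis infinity_ennreal_def leD top.not_eq_extremum)
      qed
    qed auto
    moreover have "(\<Inter>n. E (d n)) = {z \<in> Z. G z \<in> A}"
    proof -
      have in_A: "G z \<in> A" if "\<forall>n. infdist (G z) A \<le> d n" for z
      proof -
        have "infdist (G z) A \<le> 0" using LIMSEQ_le_const[OF dlim] that by blast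
        then have "infdist (G z) A = 0" using infdist_nonneg[of "G z" A] by linarith
        then show ?thesis using in_closed_iff_infdist_zero[OF compact_imp_closed[OF A(1)] False] by simp
      qed
      show ?thesis
      proof (intro equalityI subsetI)
        fix z assume "z \<in> (\<Inter>n. E (d n))"
        then have "z \<in> Z" "\<forall>n. infdist (G z) A \<le> d n" by (simp_all add: E_def)
        then show "z \<in> {z \<in> Z. G z \<in> A}" using in_A by simp
      next
        fix z assume "z \<in> {z \<in> Z. G z \<in> A}"
        then show "z \<in> (\<Inter>n. E (d n))" using d(1) by (simp add: E_def less_imp_le)
      qed
    qed
    ultimately have lim: "(\<lambda>n. ennreal C * emeasure lborel (E (d n))) \<longlonglongrightarrow> ennreal C * emeasure lborel {z \<in> Z. G z \<in> A}"
      by (intro ennreal_tendsto_cmult) auto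
    show ?thesis
    proof (rule SUP_least)
      fix \<delta>0 :: real assume "\<delta>0 \<in> {0<..}"
      then have "eventually (\<lambda>n. d n < \<delta>0 / 10) sequentially"
        by (intro order_tendstoD(2)[OF dlim]) auto
      then have "eventually (\<lambda>n. hausdorff_content ?m \<delta>0 A \<le> ennreal C * emeasure lborel (E (d n))) sequentially"
      proof eventually_elim
        case (elim n)
        then have "hausdorff_content ?m \<delta>0 A \<le> hausdorff_content ?m (10 * d n) A"
          by (intro hausdorff_content_antimono) simp
        also have "\<dots> \<le> ennreal C * emeasure lborel (E (d n))" by (rule main[OF d(1,2)])
        finally show ?case .
      qed
      then show "hausdorff_content ?m \<delta>0 A \<le> ennreal C * emeasure lborel {z \<in> Z. G z \<in> A}"
        by (intro tendsto_lowerbound[OF lim]) auto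
    qed
  qed
  then show ?thesis using C by (intro exI[of _ C]) auto
qed

end

text \<open>Otherwise \<open>simp\<close> turns the dimension \<open>DIM('a) - 1\<close> of the surface measure into
  \<open>DIM('a) - Suc 0\<close>, and the facts about that measure no longer apply.\<close>

declare One_nat_def [simp del]

section \<open>Surface integrals in a chart\<close>

lemma nn_integral_le_cmult:
  assumes "sets N1 = sets N2" "\<And>A. A \<in> sets N1 \<Longrightarrow> emeasure N1 A \<le> c * emeasure N2 A"
    "f \<in> borel_measurable N2"
  shows "(\<integral>\<^sup>+x. f x \<partial>N1) \<le> c * (\<integral>\<^sup>+x. f x \<partial>N2)"
proof -
  have "N1 \<le> scale_measure c N2"
    using assms by (subst le_measure) auto
  then have "(\<integral>\<^sup>+x. f x \<partial>N1) \<le> (\<integral>\<^sup>+x. f x \<partial>scale_measure c N2)"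
    using assms by (intro nn_integral_mono_measure) auto
  then show ?thesis using assms(3) by (simp add: nn_integral_scale_measure)
qed

context graph_chart
begin

abbreviation "M \<equiv> restrict_space (hausdorff_measure (DIM('a) - 1)) S"
abbreviation "W \<equiv> restrict_space lborel Z"

lemma S_borel [measurable]: "S \<in> sets borel" using compact_S by (simp add: borel_compact)

lemma sets_M: "A \<in> sets M \<longleftrightarrow> A \<in> sets borel \<and> A \<subseteq> S"
  by (subst sets_restrict_space_iff) auto

lemma emeasure_M: "A \<subseteq> S \<Longrightarrow> emeasure M A = emeasure (hausdorff_measure (DIM('a) - 1)) A"
  by (subst emeasure_restrict_space) auto

text \<open>The covering argument gives the bound for compact sets only; inner regularity carries it
  to Borel sets.\<close>

lemma measure_upper:
  "\<exists>C\<ge>0. \<forall>A\<in>sets M. emeasure M (A \<inter> cball x0 (\<rho> / 2)) \<le> ennreal C * emeasure lborel {z \<in> Z. G z \<in> A}"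
proof -
  let ?H = "hausdorff_measure (DIM('a) - 1) :: 'a measure"
  define K0 where "K0 = S \<inter> cball x0 (\<rho> / 2)"
  have K0: "compact K0" unfolding K0_def using compact_S by (simp add: compact_Int_closed)
  then have K0m [measurable]: "K0 \<in> sets borel" by (rule borel_compact)
  from hausdorff_outer_compact_le obtain C where C0: "C \<ge> 0 \<and> (\<forall>A. compact A \<longrightarrow> A \<subseteq> S \<inter> cball x0 (\<rho> / 2) \<longrightarrow>
     hausdorff_outer (DIM('a) - 1) A \<le> ennreal C * emeasure lborel {z \<in> Z. G z \<in> A})" by (rule exE)
  have C: "emeasure ?H A \<le> ennreal C * emeasure lborel {z \<in> Z. G z \<in> A}" if "compact A" "A \<subseteq> K0" for A
    using C0 that emeasure_hausdorff_le[of "DIM('a) - 1" A] unfolding K0_def by (blast intro: order_trans)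
  \<comment> \<open>Inner regularity is for finite Borel measures on the whole space, so the
    Hausdorff measure is cut down to \<open>K0\<close> by a density. The bound for compact sets,
    applied to \<open>K0\<close> itself, gives finiteness.\<close>
  define H' where "H' = density ?H (indicator K0)"
  have H': "emeasure H' A = emeasure ?H (A \<inter> K0)" if "A \<in> sets borel" for A
    using that unfolding H'_def by (subst emeasure_density) (auto simp: Int_commute simp flip: indicator_inter_arith)
  have fin: "emeasure H' (space H') \<noteq> \<infinity>"
  proof -
    have "emeasure lborel {z \<in> Z. G z \<in> K0} \<le> emeasure lborel Z" by (intro emeasure_mono) auto
    then have "emeasure lborel {z \<in> Z. G z \<in> K0} < \<infinity>" using Z_finite by (rule le_less_trans)
    then have "ennreal C * emeasure lborel {z \<in> Z. G z \<in> K0} < \<infinity>"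
      by (simp add: ennreal_mult_less_top)
    then have "emeasure ?H K0 < \<infinity>" using C[OF K0 order_refl] by (rule le_less_trans[rotated])
    then show ?thesis using H'[of UNIV] by (simp add: H'_def)
  qed
  have "emeasure M (A \<inter> cball x0 (\<rho> / 2)) \<le> ennreal C * emeasure lborel {z \<in> Z. G z \<in> A}"
    if A: "A \<in> sets M" for A
  proof -
    have A': "A \<in> sets borel" "A \<subseteq> S" using A by (auto simp: sets_M)
    have eq: "A \<inter> cball x0 (\<rho> / 2) = A \<inter> K0" using A' by (auto simp: K0_def)
    have "emeasure M (A \<inter> cball x0 (\<rho> / 2)) = emeasure H' (A \<inter> K0)"
      using A' by (subst emeasure_M) (auto simp: eq H')
    also have "\<dots> = (SUP K\<in>{K. K \<subseteq> A \<inter> K0 \<and> compact K}. emeasure H' K)"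
      using fin A' by (intro inner_regular) (auto simp: H'_def)
    also have "\<dots> \<le> ennreal C * emeasure lborel {z \<in> Z. G z \<in> A}"
    proof (rule SUP_least)
      fix K assume "K \<in> {K. K \<subseteq> A \<inter> K0 \<and> compact K}"
      then have K: "compact K" "K \<subseteq> K0" "K \<subseteq> A" by auto
      have "emeasure H' K = emeasure ?H K"
        using K H'[of K] by (simp add: borel_compact Int_absorb2)
      also have "\<dots> \<le> ennreal C * emeasure lborel {z \<in> Z. G z \<in> K}" using C K by blast
      also have "\<dots> \<le> ennreal C * emeasure lborel {z \<in> Z. G z \<in> A}"
        using K A' by (intro mult_left_mono emeasure_mono) auto
      finally show "emeasure H' K \<le> ennreal C * emeasure lborel {z \<in> Z. G z \<in> A}" .
    qed
    finally show ?thesis .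
  qed
  then show ?thesis using C0 by blast
qed

text \<open>The set \<open>B\<close> certifies that \<open>measure_of\<close> has not collapsed to
  zero, so surface measure is the outer measure.\<close>

lemma measure_lower:
  assumes "emeasure M B \<noteq> 0"
  shows "\<exists>C\<ge>0. \<forall>A\<in>sets M. emeasure lborel {z \<in> Z. G z \<in> A} \<le> ennreal C * emeasure M A"
proof -
  let ?H = "hausdorff_measure (DIM('a) - 1) :: 'a measure"
  have B: "B \<in> sets M" using assms emeasure_notin_sets by blast
  then have "emeasure ?H B \<noteq> 0" using assms emeasure_M sets_M by metis
  note eq = emeasure_hausdorff_eq[OF this]
  from volume_le_hausdorff_outer obtain C where C: "C \<ge> 0 \<and> (\<forall>A. emeasure lborel {z \<in> Z. G z \<in> A}
    \<le> ennreal C * hausdorff_outer (DIM('a) - 1) A)" by (rule exE)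
  then have "emeasure lborel {z \<in> Z. G z \<in> A} \<le> ennreal C * emeasure M A" if "A \<in> sets M" for A
    using that eq[of A] emeasure_M[of A] by (simp add: sets_M)
  then show ?thesis using C by blast
qed

lemma G_measurable_M: "G \<in> W \<rightarrow>\<^sub>M M"
proof (rule measurable_restrict_space2)
  show "G \<in> W \<rightarrow>\<^sub>M hausdorff_measure (DIM('a) - 1)"
    by (intro measurable_restrict_space1) (simp add: measurable_cong_sets[OF sets_lborel sets_hausdorff_measure])
qed (use G_in in \<open>auto simp: space_restrict_space\<close>)

lemma emeasure_distr_W:
  assumes "A \<in> sets M"
  shows "emeasure (distr W M G) A = emeasure lborel {z \<in> Z. G z \<in> A}"
proof -
  have "emeasure (distr W M G) A = emeasure W (G -` A \<inter> space W)"
    by (rule emeasure_distr[OF G_measurable_M assms])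
  also have "G -` A \<inter> space W = {z \<in> Z. G z \<in> A}" by (auto simp: space_restrict_space)
  finally show ?thesis by (subst (asm) emeasure_restrict_space) auto
qed

text \<open>The right side is an integral against the image measure of the cylinder under
  \<open>G\<close>, so an inequality between measures suffices. The indicator stems from
  \<open>measure_upper\<close>, which is confined to the half-size ball.\<close>

lemma nn_integral_upper:
  "\<exists>C\<ge>0. \<forall>f\<in>borel_measurable M.
     (\<integral>\<^sup>+x. f x * indicator (cball x0 (\<rho> / 2)) x \<partial>M) \<le> ennreal C * (\<integral>\<^sup>+z. f (G z) \<partial>W)"
proof -
  from measure_upper obtain C where C: "C \<ge> 0 \<and> (\<forall>A\<in>sets M. emeasure M (A \<inter> cball x0 (\<rho> / 2)) \<le> ennreal C * emeasure lborel {z \<in> Z. G z \<in> A})"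
    by (rule exE)
  have ind: "(indicator (cball x0 (\<rho> / 2)) :: 'a \<Rightarrow> ennreal) \<in> borel_measurable M"
    by (intro measurable_restrict_space1 borel_measurable_indicator) simp
  have "(\<integral>\<^sup>+x. f x * indicator (cball x0 (\<rho> / 2)) x \<partial>M) \<le> ennreal C * (\<integral>\<^sup>+z. f (G z) \<partial>W)"
    if f: "f \<in> borel_measurable M" for f
  proof -
    have "(\<integral>\<^sup>+x. f x * indicator (cball x0 (\<rho> / 2)) x \<partial>M)
        = (\<integral>\<^sup>+x. f x \<partial>density M (indicator (cball x0 (\<rho> / 2))))"
      using f ind by (subst nn_integral_density) (auto simp: mult.commute)
    also have "\<dots> \<le> ennreal C * (\<integral>\<^sup>+x. f x \<partial>distr W M G)"
    proof (rule nn_integral_le_cmult)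
      fix A assume "A \<in> sets (density M (indicator (cball x0 (\<rho> / 2))))"
      then have A: "A \<in> sets M" by simp
      have "A \<inter> cball x0 (\<rho> / 2) \<in> sets M" using A by (auto simp: sets_M)
      then have "emeasure (density M (indicator (cball x0 (\<rho> / 2)))) A = emeasure M (A \<inter> cball x0 (\<rho> / 2))"
        using A ind by (subst emeasure_density) (auto simp: Int_commute simp flip: indicator_inter_arith)
      then show "emeasure (density M (indicator (cball x0 (\<rho> / 2)))) A \<le> ennreal C * emeasure (distr W M G) A"
        using C A by (simp add: emeasure_distr_W)
    qed (use f in auto)
    also have "(\<integral>\<^sup>+x. f x \<partial>distr W M G) = (\<integral>\<^sup>+z. f (G z) \<partial>W)"
      using f G_measurable_M by (subst nn_integral_distr) auto
    finally show ?thesis .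
  qed
  then show ?thesis using C by blast
qed

lemma nn_integral_lower:
  assumes "emeasure M B \<noteq> 0"
  shows "\<exists>C\<ge>0. \<forall>f\<in>borel_measurable M. (\<integral>\<^sup>+z. f (G z) \<partial>W) \<le> ennreal C * (\<integral>\<^sup>+x. f x \<partial>M)"
proof -
  from measure_lower[OF assms] obtain C where C: "C \<ge> 0 \<and> (\<forall>A\<in>sets M. emeasure lborel {z \<in> Z. G z \<in> A} \<le> ennreal C * emeasure M A)"
    by (rule exE)
  have "(\<integral>\<^sup>+z. f (G z) \<partial>W) \<le> ennreal C * (\<integral>\<^sup>+x. f x \<partial>M)" if f: "f \<in> borel_measurable M" for f
  proof -
    have "(\<integral>\<^sup>+z. f (G z) \<partial>W) = (\<integral>\<^sup>+x. f x \<partial>distr W M G)"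
      using f G_measurable_M by (subst nn_integral_distr) auto
    also have "\<dots> \<le> ennreal C * (\<integral>\<^sup>+x. f x \<partial>M)"
      using C f by (intro nn_integral_le_cmult) (auto simp: emeasure_distr_W)
    finally show ?thesis .
  qed
  then show ?thesis using C by blast
qed

lemma emeasure_M_finite: "emeasure M (S \<inter> cball x0 (\<rho> / 2)) < \<infinity>"
proof -
  from measure_upper obtain C where C: "C \<ge> 0 \<and> (\<forall>A\<in>sets M. emeasure M (A \<inter> cball x0 (\<rho> / 2)) \<le> ennreal C * emeasure lborel {z \<in> Z. G z \<in> A})"
    by (rule exE)
  have "emeasure lborel {z \<in> Z. G z \<in> S} \<le> emeasure lborel Z" by (intro emeasure_mono) auto
  then have "emeasure lborel {z \<in> Z. G z \<in> S} < \<infinity>" using Z_finite by (rule le_less_trans)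
  then have "ennreal C * emeasure lborel {z \<in> Z. G z \<in> S} < \<infinity>" by (simp add: ennreal_mult_less_top)
  moreover have "emeasure M (S \<inter> cball x0 (\<rho> / 2)) \<le> ennreal C * emeasure lborel {z \<in> Z. G z \<in> S}"
    using C by (simp add: sets_M)
  ultimately show ?thesis by (rule le_less_trans[rotated])
qed

text \<open>By the Lipschitz bound, \<open>G\<close> maps the slab of radius
  \<open>t / (4 * L)\<close> at \<open>x\<close> into \<open>ball x t\<close>, and the volume of
  that slab is of order t^(d-1).\<close>

lemma ahlfors_lower:
  assumes "emeasure M B \<noteq> 0"
  shows "\<exists>c>0. \<forall>x\<in>S \<inter> ball x0 (\<rho> / 2). \<forall>t. 0 < t \<longrightarrow> t \<le> \<rho> \<longrightarrow>
    ennreal (c * t ^ (DIM('a) - 1)) \<le> emeasure M (S \<inter> ball x t)"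
proof -
  let ?m = "DIM('a) - 1"
  from measure_lower[OF assms] obtain C where C: "C \<ge> 0 \<and> (\<forall>A\<in>sets M. emeasure lborel {z \<in> Z. G z \<in> A} \<le> ennreal C * emeasure M A)"
    by (rule exE)
  from emeasure_slab_bounds(1)[OF norm_e rho] obtain k where k0: "0 < k \<and> (\<forall>D. 0 < D \<longrightarrow> D \<le> \<rho> \<longrightarrow>
      ennreal (k * D ^ ?m) \<le> emeasure lborel (slab e D \<rho>))" by (rule exE)
  have key: "ennreal (k * (1 / (4 * L)) ^ ?m * t ^ ?m) \<le> ennreal C * emeasure M (S \<inter> ball x t)"
    if x: "x \<in> S \<inter> ball x0 (\<rho> / 2)" and t: "0 < t" "t \<le> \<rho>" for x t
  proof -
    define D where "D = t / (4 * L)"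
    have D: "0 < D" "D \<le> t / 4" "L * D = t / 4" using t L by (auto simp: D_def field_simps)
    define a where "a = x - ((x - x0) \<bullet> e) *\<^sub>R e"
    have pa: "proj_away e (z - a) = proj_away e (z - x)" for z
      by (simp add: a_def proj_away_simps proj_away_self norm_e)
    have ia: "(z - a) \<bullet> e = (z - x0) \<bullet> e" for z
      by (simp add: a_def inner_diff_left inner_add_left ee)
    have xd: "norm (x - x0) < \<rho> / 2" using x by (simp add: dist_norm norm_minus_commute)
    have xZ: "x \<in> Z" "G x = x" using x ball_subset_Z rho G_id[of x] by (auto simp: subset_eq)
    have sub: "{z. z - a \<in> slab e D \<rho>} \<subseteq> {z \<in> Z. G z \<in> S \<inter> ball x t}"
    proof
      fix z assume "z \<in> {z. z - a \<in> slab e D \<rho>}"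
      then have z: "norm (proj_away e (z - x)) \<le> D" "0 \<le> (z - x0) \<bullet> e" "(z - x0) \<bullet> e < \<rho>"
        unfolding slab_def mem_Collect_eq pa ia by auto
      have "proj_away e (z - x0) = proj_away e (z - x) + proj_away e (x - x0)"
        by (simp add: proj_away_simps)
      then have "norm (proj_away e (z - x0)) \<le> norm (proj_away e (z - x)) + norm (proj_away e (x - x0))"
        by (simp only: norm_triangle_ineq)
      then have "norm (proj_away e (z - x0)) < \<rho>"
        using z(1) xd D t norm_proj_away_le[OF norm_e, of "x - x0"] by linarith
      then have zZ: "z \<in> Z" using z by (simp add: Z_def)
      have "norm (G z - x) \<le> L * norm (proj_away e (z - x))"
        using G_lipschitz[OF zZ xZ(1)] unfolding xZ(2) .
      also have "\<dots> \<le> L * D" using z(1) L by (intro mult_left_mono) auto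
      finally have "norm (G z - x) < t" using D t by linarith
      then show "z \<in> {z \<in> Z. G z \<in> S \<inter> ball x t}" using zZ G_in
        by (simp add: dist_norm norm_minus_commute)
    qed
    have "k * (1 / (4 * L)) ^ ?m * t ^ ?m = k * D ^ ?m"
      by (simp add: D_def power_divide)
    then have "ennreal (k * (1 / (4 * L)) ^ ?m * t ^ ?m) = ennreal (k * D ^ ?m)" by (simp only:)
    also have "\<dots> \<le> emeasure lborel (slab e D \<rho>)"
      using k0 D t by simp
    also have "\<dots> = emeasure lborel {z. z - a \<in> slab e D \<rho>}" by (simp add: emeasure_lborel_shift)
    also have "\<dots> \<le> emeasure lborel {z \<in> Z. G z \<in> S \<inter> ball x t}"
      by (intro emeasure_mono sub) simp
    also have "\<dots> \<le> ennreal C * emeasure M (S \<inter> ball x t)"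
    proof -
      have "S \<inter> ball x t \<in> sets M" by (simp add: sets_M)
      then show ?thesis using C by blast
    qed
    finally show ?thesis .
  qed
  \<comment> \<open>Division by \<open>C + 1\<close>, because \<open>C\<close> may be
    \<open>0\<close>.\<close>
  define c where "c = k * (1 / (4 * L)) ^ ?m / (C + 1)"
  have "c > 0" using k0 L C by (auto simp: c_def intro!: divide_pos_pos mult_pos_pos)
  moreover have "ennreal (c * t ^ ?m) \<le> emeasure M (S \<inter> ball x t)"
    if "x \<in> S \<inter> ball x0 (\<rho> / 2)" "0 < t" "t \<le> \<rho>" for x t
  proof (cases "emeasure M (S \<inter> ball x t)")
    case (real r)
    have "ennreal (k * (1 / (4 * L)) ^ ?m * t ^ ?m) \<le> ennreal (C * r)"
      using key[OF that] real(1) C unfolding real(2) by (simp only: ennreal_mult)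
    then have "k * (1 / (4 * L)) ^ ?m * t ^ ?m \<le> C * r" using real C by (subst (asm) ennreal_le_iff) auto
    also have "C * r \<le> (C + 1) * r" using real(1) by (intro mult_right_mono) auto
    finally have le: "k * (1 / (4 * L)) ^ ?m * t ^ ?m \<le> (C + 1) * r" .
    have "C + 1 > 0" using C by linarith
    then have "k * (1 / (4 * L)) ^ ?m * t ^ ?m / (C + 1) \<le> r"
      using le by (simp only: pos_divide_le_eq mult.commute[of r])
    then have "c * t ^ ?m \<le> r" by (simp only: c_def times_divide_eq_left)
    then show ?thesis using real by (simp add: ennreal_leI)
  qed simp
  ultimately show ?thesis by blast
qed

end

section \<open>Charts, normal and tangential gradient\<close>

text \<open>Chart estimates integrate along the segment between two points of the cylinder, which
  must not leave it.\<close>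

lemma convex_cylinder: "convex {z. norm (proj_away e (z - x0)) < \<rho> \<and> \<bar>(z - x0) \<bullet> e\<bar> < \<rho>}"
proof -
  have "convex {z. norm (proj_away e (z - x0)) < \<rho>}"
  proof (rule convexI)
    fix x y :: 'a and s t :: real
    assume a: "x \<in> {z. norm (proj_away e (z - x0)) < \<rho>}" "y \<in> {z. norm (proj_away e (z - x0)) < \<rho>}" "0 \<le> s" "0 \<le> t" "s + t = 1"
    have "s *\<^sub>R x + t *\<^sub>R y - x0 = s *\<^sub>R (x - x0) + t *\<^sub>R (y - x0)"
      using a(5) by (simp add: algebra_simps flip: scaleR_add_left)
    then have "proj_away e (s *\<^sub>R x + t *\<^sub>R y - x0) = s *\<^sub>R proj_away e (x - x0) + t *\<^sub>R proj_away e (y - x0)"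
      by (simp add: proj_away_simps)
    moreover have "s *\<^sub>R proj_away e (x - x0) + t *\<^sub>R proj_away e (y - x0) \<in> ball 0 \<rho>"
      using a by (intro convexD[OF convex_ball]) auto
    ultimately show "s *\<^sub>R x + t *\<^sub>R y \<in> {z. norm (proj_away e (z - x0)) < \<rho>}" by simp
  qed
  moreover have "{z. \<bar>(z - x0) \<bullet> e\<bar> < \<rho>} = {z. e \<bullet> z < \<rho> + x0 \<bullet> e} \<inter> {z. e \<bullet> z > x0 \<bullet> e - \<rho>}"
    by (auto simp: inner_diff_left inner_commute[of e])
  then have "convex {z. \<bar>(z - x0) \<bullet> e\<bar> < \<rho>}"
    by (simp only:) (intro convex_Int convex_halfspace_lt convex_halfspace_gt)
  ultimately have "convex ({z. norm (proj_away e (z - x0)) < \<rho>} \<inter> {z. \<bar>(z - x0) \<bullet> e\<bar> < \<rho>})"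
    by (rule convex_Int)
  then show ?thesis by (simp add: Int_def)
qed

lemma Ck_fun_continuous: "Ck_fun k f \<Longrightarrow> continuous_on UNIV f"
proof (cases k)
  case (Suc j)
  assume "Ck_fun k f"
  then obtain f' where "\<forall>x. (f has_derivative f' x) (at x)" using Suc by auto
  then have "continuous (at x) f" for x
    using has_derivative_continuous[of f "f' x" x UNIV] by simp
  then show ?thesis using continuous_at_imp_continuous_on by blast
qed simp

lemma Ck_fun_C1:
  assumes "Ck_fun (Suc k) f"
  shows "\<exists>f'. (\<forall>x. (f has_derivative f' x) (at x)) \<and> (\<forall>v. continuous_on UNIV (\<lambda>x. f' x v))"
proof -
  from assms obtain f' where f': "\<forall>x. (f has_derivative f' x) (at x)" "\<forall>v. Ck_fun k (\<lambda>x. f' x v)"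
    by auto
  then have "\<forall>v. continuous_on UNIV (\<lambda>x. f' x v)" using Ck_fun_continuous by blast
  with f'(1) show ?thesis by blast
qed

section \<open>The graph description near one boundary point\<close>

locale local_graph =
  fixes \<Omega> :: "'a::euclidean_space set" and x0 :: 'a and r :: real and e :: 'a
    and \<gamma> :: "'a \<Rightarrow> real" and \<gamma>' :: "'a \<Rightarrow> 'a \<Rightarrow> real"
  assumes open_\<Omega>: "open \<Omega>" and bounded_\<Omega>: "bounded \<Omega>" and r: "r > 0" and norm_e: "norm e = 1"
    and x0: "x0 \<in> frontier \<Omega>"
    and \<gamma>': "\<And>y. (\<gamma> has_derivative \<gamma>' y) (at y)" and \<gamma>'_cont: "\<And>v. continuous_on UNIV (\<lambda>y. \<gamma>' y v)"
    and \<gamma>_inv: "\<And>y t. \<gamma> (y + t *\<^sub>R e) = \<gamma> y"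
    and above: "\<Omega> \<inter> ball x0 r = {y \<in> ball x0 r. \<gamma> y < y \<bullet> e}"
begin

text \<open>Near \<open>x0\<close>, \<open>u\<close> is a defining function of \<Omega>, negative
  inside; \<open>n\<close> is its gradient, and \<open>G\<close> slides a point along
  \<open>e\<close> onto the zero set of \<open>u\<close>.\<close>

definition "u y = \<gamma> y - y \<bullet> e"
definition "n y = (\<Sum>b\<in>Basis. \<gamma>' y b *\<^sub>R b) - e"
definition "G y = y + u y *\<^sub>R e"

lemma ee: "e \<bullet> e = 1" using norm_e by (simp add: dot_square_norm)

lemma continuous_\<gamma>: "continuous_on UNIV \<gamma>"
  by (intro continuous_at_imp_continuous_on ballI has_derivative_continuous[OF \<gamma>'])

lemma continuous_u: "continuous_on UNIV u"
  unfolding u_def by (intro continuous_intros continuous_\<gamma>)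

lemma continuous_G: "continuous_on UNIV G"
  unfolding G_def by (intro continuous_intros continuous_u)

lemma continuous_n: "continuous_on UNIV n"
  unfolding n_def by (intro continuous_intros \<gamma>'_cont)

lemma n_inner: "n y \<bullet> v = \<gamma>' y v - v \<bullet> e"
proof -
  interpret linear "\<gamma>' y" using \<gamma>' has_derivative_linear by blast
  have "\<gamma>' y v = \<gamma>' y (\<Sum>b\<in>Basis. (v \<bullet> b) *\<^sub>R b)" by (simp add: euclidean_representation)
  also have "\<dots> = (\<Sum>b\<in>Basis. \<gamma>' y b *\<^sub>R b) \<bullet> v"
    by (simp add: sum scale inner_sum_left inner_commute[of v] mult.commute)
  finally show ?thesis by (simp add: n_def inner_diff_left inner_commute[of e])
qed

lemma u_derivative: "(u has_derivative (\<lambda>v. n y \<bullet> v)) (at y)"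
proof -
  have "(u has_derivative (\<lambda>v. \<gamma>' y v - v \<bullet> e)) (at y)"
    unfolding u_def[abs_def] by (intro derivative_intros \<gamma>')
  then show ?thesis by (simp add: n_inner)
qed

lemma G_derivative: "(G has_derivative (\<lambda>v. v + (n y \<bullet> v) *\<^sub>R e)) (at y)"
  unfolding G_def[abs_def]
  by (rule has_derivative_add[OF has_derivative_ident has_derivative_scaleR_left[OF u_derivative]])

text \<open>\<gamma> is constant along \<open>e\<close>, so only the term
  \<open>y \<bullet> e\<close> of \<open>u\<close> varies in that direction. This also keeps
  \<open>n\<close> away from \<open>0\<close>.\<close>

lemma n_e: "n y \<bullet> e = -1"
proof -
  have "((\<lambda>t. \<gamma> (y + t *\<^sub>R e)) has_derivative (\<lambda>t. \<gamma>' y (t *\<^sub>R e))) (at 0)"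
  proof (rule has_derivative_compose[of "\<lambda>t. y + t *\<^sub>R e"])
    show "((\<lambda>t. y + t *\<^sub>R e) has_derivative (\<lambda>t. t *\<^sub>R e)) (at 0)"
      by (auto intro!: derivative_eq_intros)
    show "(\<gamma> has_derivative \<gamma>' y) (at (y + 0 *\<^sub>R e))" using \<gamma>'[of y] by simp
  qed
  moreover have "((\<lambda>t. \<gamma> (y + t *\<^sub>R e)) has_derivative (\<lambda>t. 0)) (at (0::real))"
    unfolding \<gamma>_inv by simp
  ultimately have "(\<lambda>t. \<gamma>' y (t *\<^sub>R e)) = (\<lambda>t. 0)" by (rule has_derivative_unique)
  then have "\<gamma>' y (1 *\<^sub>R e) = 0" by (rule fun_cong)
  then show ?thesis by (simp add: n_inner ee)
qed

lemma n_nonzero: "n y \<noteq> 0" using n_e[of y] by auto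

lemma u_G: "u (G y) = 0"
  by (simp add: u_def G_def \<gamma>_inv inner_add_left ee)

lemma in_\<Omega>_iff: "z \<in> ball x0 r \<Longrightarrow> z \<in> \<Omega> \<longleftrightarrow> u z < 0"
proof -
  assume z: "z \<in> ball x0 r"
  have "z \<in> \<Omega> \<inter> ball x0 r \<longleftrightarrow> z \<in> {y \<in> ball x0 r. \<gamma> y < y \<bullet> e}" by (simp only: above)
  then show ?thesis using z by (simp add: u_def)
qed

text \<open>A point with \<open>u > 0\<close> has a neighbourhood that misses \<Omega>; a zero of
  \<open>u\<close> is approached from inside along \<open>e\<close>, where \<open>u\<close>
  decreases at unit rate.\<close>

lemma frontier_iff: "y \<in> ball x0 r \<Longrightarrow> y \<in> frontier \<Omega> \<longleftrightarrow> u y = 0"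
proof -
  assume y: "y \<in> ball x0 r"
  note in\<Omega> = in_\<Omega>_iff
  have fr: "frontier \<Omega> = closure \<Omega> - \<Omega>" using open_\<Omega> by (simp add: frontier_def interior_open)
  show ?thesis
  proof
    assume yf: "y \<in> frontier \<Omega>"
    then have "u y \<ge> 0" using in\<Omega>[OF y] fr by auto
    moreover have "\<not> u y > 0"
    proof
      assume "u y > 0"
      let ?V = "ball x0 r \<inter> {z. u z > 0}"
      have "open ?V" by (intro open_Int open_ball open_Collect_less continuous_u continuous_on_const)
      moreover have "?V \<inter> \<Omega> = {}" using in\<Omega> by fastforce
      ultimately have "?V \<inter> closure \<Omega> = {}" using open_Int_closure_eq_empty by blast
      then show False using \<open>u y > 0\<close> y yf fr by auto
    qed
    ultimately show "u y = 0" by simp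
  next
    assume uy: "u y = 0"
    have "y \<notin> \<Omega>" using in\<Omega>[OF y] uy by simp
    moreover have "y \<in> closure \<Omega>"
      unfolding closure_approachable
    proof (intro allI impI)
      fix d :: real assume d: "d > 0"
      define t where "t = min (d / 2) ((r - dist x0 y) / 2)"
      have t: "t > 0" "t < d" "t < r - dist x0 y" using d y by (auto simp: t_def min_def)
      have "dist x0 (y + t *\<^sub>R e) \<le> dist x0 y + dist y (y + t *\<^sub>R e)" by (rule dist_triangle)
      also have "dist y (y + t *\<^sub>R e) = t" using t norm_e by (simp add: dist_norm)
      finally have b: "y + t *\<^sub>R e \<in> ball x0 r" using t by simp
      have "u (y + t *\<^sub>R e) = u y - t" by (simp add: u_def \<gamma>_inv inner_add_left ee)
      then have "y + t *\<^sub>R e \<in> \<Omega>" using in\<Omega>[OF b] uy t by simp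
      moreover have "dist (y + t *\<^sub>R e) y < d" using t norm_e by (simp add: dist_norm)
      ultimately show "\<exists>z\<in>\<Omega>. dist z y < d" by blast
    qed
    ultimately show "y \<in> frontier \<Omega>" using fr by blast
  qed
qed

text \<open>The first-order expansion of \<open>u\<close> gives the half-space property. For
  uniqueness, if \<mu> and \<nu> both have it and differ, then a small step from \<open>y\<close>
  along \<open>\<nu> - \<mu>\<close> leads outside \<Omega> according to \<nu> and inside according
  to \<mu>.\<close>

lemma outer_normal_eq:
  assumes y: "y \<in> ball x0 r" "y \<in> frontier \<Omega>"
  shows "outer_normal \<Omega> y = n y /\<^sub>R norm (n y)"
proof -
  define \<nu> where "\<nu> = n y /\<^sub>R norm (n y)"
  have nn: "norm (n y) > 0" using n_nonzero by simp
  have \<nu>1: "norm \<nu> = 1" using n_nonzero by (simp add: \<nu>_def)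
  have uy: "u y = 0" using frontier_iff y by blast
  have half: "\<exists>\<delta>>0. \<forall>z. 0 < norm (z - y) \<and> norm (z - y) < \<delta> \<longrightarrow>
        ((z - y) \<bullet> \<nu> < - \<epsilon> * norm (z - y) \<longrightarrow> z \<in> \<Omega>) \<and>
        ((z - y) \<bullet> \<nu> > \<epsilon> * norm (z - y) \<longrightarrow> z \<notin> \<Omega>)" if \<epsilon>: "\<epsilon> > 0" for \<epsilon>
  proof -
    have "\<epsilon> * norm (n y) > 0" using \<epsilon> nn by simp
    then obtain d where d: "d > 0" "\<And>z. norm (z - y) < d \<Longrightarrow>
        norm (u z - u y - n y \<bullet> (z - y)) \<le> \<epsilon> * norm (n y) * norm (z - y)"
      using u_derivative[of y] unfolding has_derivative_at_alt by blast
    define \<delta> where "\<delta> = min d (r - dist x0 y)"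
    have "\<delta> > 0" using d y by (simp add: \<delta>_def)
    moreover have "((z - y) \<bullet> \<nu> < - \<epsilon> * norm (z - y) \<longrightarrow> z \<in> \<Omega>) \<and>
        ((z - y) \<bullet> \<nu> > \<epsilon> * norm (z - y) \<longrightarrow> z \<notin> \<Omega>)" if z: "norm (z - y) < \<delta>" for z
    proof -
      have b: "z \<in> ball x0 r" using z dist_triangle[of x0 z y] by (simp add: \<delta>_def dist_norm norm_minus_commute)
      have "\<bar>u z - n y \<bullet> (z - y)\<bar> \<le> \<epsilon> * norm (n y) * norm (z - y)"
        using d(2)[of z] z uy by (simp add: \<delta>_def)
      moreover have "n y \<bullet> (z - y) = norm (n y) * ((z - y) \<bullet> \<nu>)"
        using nn by (simp add: \<nu>_def inner_commute)
      ultimately have *: "\<bar>u z - norm (n y) * ((z - y) \<bullet> \<nu>)\<bar> \<le> norm (n y) * (\<epsilon> * norm (z - y))"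
        by (simp add: mult_ac)
      have in\<Omega>: "z \<in> \<Omega> \<longleftrightarrow> u z < 0" by (rule in_\<Omega>_iff[OF b])
      show ?thesis
      proof (intro conjI impI)
        assume "(z - y) \<bullet> \<nu> < - \<epsilon> * norm (z - y)"
        then have "norm (n y) * ((z - y) \<bullet> \<nu>) < norm (n y) * (- \<epsilon> * norm (z - y))"
          using nn by (intro mult_strict_left_mono)
        then show "z \<in> \<Omega>" using * in\<Omega> by (simp add: abs_le_iff)
      next
        assume "(z - y) \<bullet> \<nu> > \<epsilon> * norm (z - y)"
        then have "norm (n y) * ((z - y) \<bullet> \<nu>) > norm (n y) * (\<epsilon> * norm (z - y))"
          using nn by (intro mult_strict_left_mono)
        then show "z \<notin> \<Omega>" using * in\<Omega> by (simp add: abs_le_iff)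
      qed
    qed
    ultimately show ?thesis by blast
  qed
  show ?thesis unfolding outer_normal_def \<nu>_def[symmetric]
  proof (rule the_equality)
    show "norm \<nu> = 1 \<and> (\<forall>\<epsilon>>0. \<exists>\<delta>>0. \<forall>z. 0 < norm (z - y) \<and> norm (z - y) < \<delta> \<longrightarrow>
        ((z - y) \<bullet> \<nu> < - \<epsilon> * norm (z - y) \<longrightarrow> z \<in> \<Omega>) \<and>
        ((z - y) \<bullet> \<nu> > \<epsilon> * norm (z - y) \<longrightarrow> z \<notin> \<Omega>))"
      using \<nu>1 half by blast
  next
    fix \<mu>
    assume \<mu>: "norm \<mu> = 1 \<and> (\<forall>\<epsilon>>0. \<exists>\<delta>>0. \<forall>z. 0 < norm (z - y) \<and> norm (z - y) < \<delta> \<longrightarrow>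
        ((z - y) \<bullet> \<mu> < - \<epsilon> * norm (z - y) \<longrightarrow> z \<in> \<Omega>) \<and>
        ((z - y) \<bullet> \<mu> > \<epsilon> * norm (z - y) \<longrightarrow> z \<notin> \<Omega>))"
    show "\<mu> = \<nu>"
    proof (rule ccontr)
      assume ne: "\<mu> \<noteq> \<nu>"
      define v where "v = \<nu> - \<mu>"
      define c where "c = v \<bullet> \<nu>"
      have v0: "norm v > 0" using ne by (simp add: v_def)
      have nn': "\<nu> \<bullet> \<nu> = 1" "\<mu> \<bullet> \<mu> = 1" using \<nu>1 \<mu> by (simp_all add: dot_square_norm)
      have "v \<bullet> v = 2 * c" by (simp add: v_def c_def inner_diff_left inner_diff_right nn' inner_commute)
      moreover have "v \<bullet> v > 0" using v0 by simp
      ultimately have c: "c > 0" by simp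
      have c': "v \<bullet> \<mu> = - c" by (simp add: v_def c_def inner_diff_left inner_diff_right nn' inner_commute)
      \<comment> \<open>Half of \<open>v \<bullet> \<nu> / norm v\<close>, which is also
        \<open>- (v \<bullet> \<mu>) / norm v\<close>, so both half-space conditions are met
        strictly along \<open>v\<close>.\<close>
      define \<epsilon> where "\<epsilon> = c / (2 * norm v)"
      have \<epsilon>: "\<epsilon> > 0" using c v0 by (simp add: \<epsilon>_def)
      from half[OF \<epsilon>] obtain d1 where d1: "d1 > 0 \<and> (\<forall>z. 0 < norm (z - y) \<and> norm (z - y) < d1 \<longrightarrow>
        ((z - y) \<bullet> \<nu> < - \<epsilon> * norm (z - y) \<longrightarrow> z \<in> \<Omega>) \<and>
        ((z - y) \<bullet> \<nu> > \<epsilon> * norm (z - y) \<longrightarrow> z \<notin> \<Omega>))" by (rule exE)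
      from \<mu> \<epsilon> obtain d2 where d2: "d2 > 0 \<and> (\<forall>z. 0 < norm (z - y) \<and> norm (z - y) < d2 \<longrightarrow>
        ((z - y) \<bullet> \<mu> < - \<epsilon> * norm (z - y) \<longrightarrow> z \<in> \<Omega>) \<and>
        ((z - y) \<bullet> \<mu> > \<epsilon> * norm (z - y) \<longrightarrow> z \<notin> \<Omega>))" by blast
      define t where "t = min d1 d2 / (2 * norm v)"
      have t: "t > 0" using d1 d2 v0 by (simp add: t_def)
      define z where "z = y + t *\<^sub>R v"
      have zn: "norm (z - y) = t * norm v" "t * norm v = min d1 d2 / 2"
      proof -
        show "norm (z - y) = t * norm v" using t by (simp add: z_def)
        show "t * norm v = min d1 d2 / 2" using v0 by (simp add: t_def)
      qed
      have z: "0 < norm (z - y)" "norm (z - y) < d1" "norm (z - y) < d2" using zn d1 d2 by auto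
      have "\<epsilon> * norm (z - y) = t * c / 2" using v0 by (simp add: zn(1) \<epsilon>_def)
      moreover have "(z - y) \<bullet> \<nu> = t * c" "(z - y) \<bullet> \<mu> = - (t * c)" by (simp_all add: z_def c_def c')
      moreover have "t * c > 0" using t c by simp
      ultimately have "(z - y) \<bullet> \<nu> > \<epsilon> * norm (z - y)" "(z - y) \<bullet> \<mu> < - \<epsilon> * norm (z - y)" by simp_all
      then have "z \<notin> \<Omega>" "z \<in> \<Omega>" using d1 d2 z by blast+
      then show False by simp
    qed
  qed
qed

text \<open>\<phi> is differentiable only relative to the boundary. As \<open>G\<close> maps a full
  neighbourhood of \<open>z\<close> into the boundary, the composition is differentiable in the
  ordinary sense, where derivatives are unique.\<close>

lemma derivative_along_chart:
  assumes D: "(\<phi> has_derivative D) (at (G z) within frontier \<Omega>)" and z: "G z \<in> ball x0 r"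
  shows "((\<lambda>y. \<phi> (G y)) has_derivative (\<lambda>v. D (v + (n z \<bullet> v) *\<^sub>R e))) (at z)"
proof -
  define V where "V = {y. G y \<in> ball x0 r}"
  have oV: "open V" "z \<in> V"
    using z continuous_G open_vimage[of "ball x0 r" G] by (auto simp: V_def vimage_def)
  have "G ` V \<subseteq> frontier \<Omega>" using frontier_iff u_G by (auto simp: V_def)
  then have "(\<phi> has_derivative D) (at (G z) within G ` V)" using D has_derivative_subset by blast
  moreover have "(G has_derivative (\<lambda>v. v + (n z \<bullet> v) *\<^sub>R e)) (at z within V)"
    using G_derivative by (rule has_derivative_at_withinI)
  ultimately have "((\<lambda>y. \<phi> (G y)) has_derivative (\<lambda>v. D (v + (n z \<bullet> v) *\<^sub>R e))) (at z within V)"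
    by (rule has_derivative_in_compose[rotated])
  then show ?thesis using at_within_open[OF oV(2,1)] by simp
qed

lemma G_frontier: "y \<in> ball x0 r \<Longrightarrow> y \<in> frontier \<Omega> \<Longrightarrow> G y = y"
  using frontier_iff by (simp add: G_def)

text \<open>\<open>u\<close> vanishes on the boundary, so \<open>n y\<close> represents the zero
  derivative relative to it and a multiple of the normal may be subtracted from \<open>a\<close>.
  For uniqueness, two tangential candidates \<open>g\<close> and \<open>h\<close> agree on all
  \<open>v + (n y \<bullet> v) *\<^sub>R e\<close>; the choice \<open>v = g - h\<close>, which is
  orthogonal to \<open>n y\<close>, gives \<open>g = h\<close>.\<close>

lemma tangential_gradient_chart_formula:
  assumes y: "y \<in> ball x0 r" "y \<in> frontier \<Omega>"
    and a: "(\<phi> has_derivative (\<lambda>v. a \<bullet> v)) (at y within frontier \<Omega>)"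
  defines "\<nu> \<equiv> outer_normal \<Omega> y"
  shows "tangential_gradient \<Omega> \<phi> y = a - (a \<bullet> \<nu>) *\<^sub>R \<nu>" (is ?eq)
    and "(\<phi> has_derivative (\<lambda>v. tangential_gradient \<Omega> \<phi> y \<bullet> v)) (at y within frontier \<Omega>)"
proof -
  define g where "g = a - (a \<bullet> \<nu>) *\<^sub>R \<nu>"
  have \<nu>: "\<nu> = n y /\<^sub>R norm (n y)" unfolding \<nu>_def by (rule outer_normal_eq[OF y])
  have "norm \<nu> = 1" using n_nonzero by (simp add: \<nu>)
  then have \<nu>\<nu>: "\<nu> \<bullet> \<nu> = 1" by (simp add: dot_square_norm)
  have orth: "g \<bullet> \<nu> = 0" by (simp add: g_def inner_diff_left \<nu>\<nu>)
  have "(u has_derivative (\<lambda>v. n y \<bullet> v)) (at y within frontier \<Omega>)"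
    using u_derivative by (rule has_derivative_at_withinI)
  then have "((\<lambda>_. 0) has_derivative (\<lambda>v. n y \<bullet> v)) (at y within frontier \<Omega>)"
  proof (rule has_derivative_transform_within)
    show "0 < r - dist x0 y" using y by simp
    fix z assume "z \<in> frontier \<Omega>" "dist z y < r - dist x0 y"
    moreover then have "z \<in> ball x0 r" using dist_triangle[of x0 z y] by (simp add: dist_commute)
    ultimately show "u z = 0" using frontier_iff by blast
  qed (use y in auto)
  then have "((\<lambda>x. \<phi> x - (a \<bullet> \<nu> / norm (n y)) * 0) has_derivative
      (\<lambda>v. a \<bullet> v - (a \<bullet> \<nu> / norm (n y)) * (n y \<bullet> v))) (at y within frontier \<Omega>)"
    using a by (intro has_derivative_diff has_derivative_mult_right)
  moreover have "a \<bullet> v - (a \<bullet> \<nu> / norm (n y)) * (n y \<bullet> v) = g \<bullet> v" for v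
    by (simp add: g_def inner_diff_left \<nu> field_simps)
  ultimately have gd: "(\<phi> has_derivative (\<lambda>v. g \<bullet> v)) (at y within frontier \<Omega>)" by simp
  have "tangential_gradient \<Omega> \<phi> y = g"
    unfolding tangential_gradient_def \<nu>_def[symmetric]
  proof (rule the_equality)
    show "g \<bullet> \<nu> = 0 \<and> (\<phi> has_derivative (\<lambda>v. g \<bullet> v)) (at y within frontier \<Omega>)"
      using orth gd by blast
  next
    fix h assume h: "h \<bullet> \<nu> = 0 \<and> (\<phi> has_derivative (\<lambda>v. h \<bullet> v)) (at y within frontier \<Omega>)"
    have Gy: "G y = y" using G_frontier y by blast
    have "(\<lambda>v. g \<bullet> (v + (n y \<bullet> v) *\<^sub>R e)) = (\<lambda>v. h \<bullet> (v + (n y \<bullet> v) *\<^sub>R e))"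
      using derivative_along_chart[of \<phi> "\<lambda>v. g \<bullet> v" y] derivative_along_chart[of \<phi> "\<lambda>v. h \<bullet> v" y]
        gd h y(1) has_derivative_unique unfolding Gy by blast
    from fun_cong[OF this, of "g - h"]
    have "(g - h) \<bullet> ((g - h) + (n y \<bullet> (g - h)) *\<^sub>R e) = 0" by (simp add: inner_diff_left)
    moreover have "n y \<bullet> (g - h) = 0"
    proof -
      have "n y = norm (n y) *\<^sub>R \<nu>" using n_nonzero by (simp add: \<nu>)
      then show ?thesis using orth h by (metis inner_commute inner_diff_left inner_scaleR_left right_minus_eq mult_zero_right diff_self)
    qed
    ultimately have "(g - h) \<bullet> (g - h) = 0" by simp
    then show "h = g" by simp
  qed
  then show ?eq "(\<phi> has_derivative (\<lambda>v. tangential_gradient \<Omega> \<phi> y \<bullet> v)) (at y within frontier \<Omega>)"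
    using gd by (simp_all add: g_def)
qed

text \<open>The derivative of \<open>G\<close> is \<open>v + (n y \<bullet> v) *\<^sub>R e\<close>,
  of norm at most \<open>1 + norm (n y)\<close>. The bound on \<open>n\<close> is exported too,
  because tangential derivatives along the chart are estimated with it.\<close>

lemma chart_exists:
  "\<exists>\<rho> L. graph_chart (frontier \<Omega>) x0 e \<rho> L G \<and>
     (\<forall>z. norm (proj_away e (z - x0)) < \<rho> \<longrightarrow> \<bar>(z - x0) \<bullet> e\<bar> < \<rho> \<longrightarrow> G z \<in> ball x0 r \<and> norm (n z) \<le> L - 1)"
proof -
  have "x0 \<in> ball x0 r" using r by simp
  then have Gx0: "G x0 = x0" using G_frontier x0 by blast
  have "open (G -` ball x0 r)" using continuous_G by (intro open_vimage) auto
  moreover have "x0 \<in> G -` ball x0 r" using Gx0 r by simp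
  ultimately obtain d where d: "d > 0" "ball x0 d \<subseteq> G -` ball x0 r" using open_contains_ball by blast
  \<comment> \<open>Points of the cylinder of size \<rho> are at distance up to
    \<open>2 * \<rho>\<close> from its centre, which must stay below \<open>d\<close> and
    \<open>r\<close>.\<close>
  define \<rho> where "\<rho> = min (d / 4) (r / 4)"
  have \<rho>: "\<rho> > 0" "2 * \<rho> < d" "2 * \<rho> < r" using d r by (auto simp: \<rho>_def min_def)
  define Z where "Z = {z. norm (proj_away e (z - x0)) < \<rho> \<and> \<bar>(z - x0) \<bullet> e\<bar> < \<rho>}"
  have Zsub: "Z \<subseteq> cball x0 (2 * \<rho>)"
  proof
    fix z assume "z \<in> Z"
    then show "z \<in> cball x0 (2 * \<rho>)" using norm_le_proj_away[OF norm_e, of "z - x0"]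
      by (simp add: Z_def dist_norm norm_minus_commute)
  qed
  have Gr: "G z \<in> ball x0 r" if "z \<in> Z" for z
  proof -
    have "z \<in> ball x0 d" using that Zsub \<rho> by fastforce
    then show ?thesis using d by blast
  qed
  have "bounded (n ` cball x0 (2 * \<rho>))"
    by (intro compact_imp_bounded compact_continuous_image continuous_on_subset[OF continuous_n]) auto
  then obtain N where N: "N > 0" "\<forall>y\<in>n ` cball x0 (2 * \<rho>). norm y \<le> N"
    using bounded_pos by blast
  define L where "L = 1 + N"
  have conv: "convex Z" unfolding Z_def by (rule convex_cylinder)
  have lip: "norm (G z - G w) \<le> L * norm (z - w)" if "z \<in> Z" "w \<in> Z" for z w
  proof (rule differentiable_bound[OF conv _ _ that])
    fix y assume y: "y \<in> Z"
    show "(G has_derivative (\<lambda>v. v + (n y \<bullet> v) *\<^sub>R e)) (at y within Z)"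
      using G_derivative by (rule has_derivative_at_withinI)
    have nN: "norm (n y) \<le> N" using N y Zsub by blast
    show "onorm (\<lambda>v. v + (n y \<bullet> v) *\<^sub>R e) \<le> L"
    proof (rule onorm_le)
      fix v
      have "norm (v + (n y \<bullet> v) *\<^sub>R e) \<le> norm v + \<bar>n y \<bullet> v\<bar>"
        using norm_triangle_ineq[of v "(n y \<bullet> v) *\<^sub>R e"] norm_e by simp
      also have "\<bar>n y \<bullet> v\<bar> \<le> norm (n y) * norm v" by (rule Cauchy_Schwarz_ineq2)
      also have "\<dots> \<le> N * norm v" using nN by (rule mult_right_mono) simp
      finally show "norm (v + (n y \<bullet> v) *\<^sub>R e) \<le> L * norm v" by (simp add: L_def algebra_simps)
    qed
  qed
  have "graph_chart (frontier \<Omega>) x0 e \<rho> L G"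
  proof
    show "norm e = 1" "0 < \<rho>" "1 \<le> L" using norm_e \<rho> N by (auto simp: L_def)
    show "compact (frontier \<Omega>)" using bounded_\<Omega> by (simp add: compact_frontier_bounded)
    show "proj_away e (G z) = proj_away e z" for z
      by (simp add: G_def proj_away_simps proj_away_self norm_e)
    show "continuous_on UNIV G" by (rule continuous_G)
    show "G z \<in> frontier \<Omega>" if "z \<in> {z. norm (proj_away e (z - x0)) < \<rho> \<and> \<bar>(z - x0) \<bullet> e\<bar> < \<rho>}" for z
      using that Gr[of z] frontier_iff[of "G z"] u_G by (simp add: Z_def)
    show "G p = p" if "p \<in> frontier \<Omega>" "dist x0 p < \<rho>" for p
      using that \<rho> G_frontier[of p] by simp
    fix z w assume "z \<in> {z. norm (proj_away e (z - x0)) < \<rho> \<and> \<bar>(z - x0) \<bullet> e\<bar> < \<rho>}"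
      "w \<in> {z. norm (proj_away e (z - x0)) < \<rho> \<and> \<bar>(z - x0) \<bullet> e\<bar> < \<rho>}"
    then have zw: "z \<in> Z" "w \<in> Z" by (simp_all add: Z_def)
    \<comment> \<open>\<open>w\<close> moved vertically to the height of \<open>z\<close>.
      \<open>G\<close> ignores the move and \<open>z - w'\<close> is horizontal, so the ordinary
      Lipschitz bound becomes one in terms of \<open>proj_away\<close>.\<close>
    define w' where "w' = w + ((z - w) \<bullet> e) *\<^sub>R e"
    have pw: "proj_away e (w' - x0) = proj_away e (w - x0)"
      by (simp add: w'_def proj_away_simps proj_away_self norm_e)
    have iw: "(w' - x0) \<bullet> e = (z - x0) \<bullet> e"
      by (simp add: w'_def inner_diff_left inner_add_left ee)
    have "w' \<in> Z" using zw unfolding Z_def mem_Collect_eq pw iw by simp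
    moreover have "G w' = G w"
      unfolding G_def w'_def u_def \<gamma>_inv by (simp add: inner_add_left ee algebra_simps)
    moreover have "z - w' = proj_away e (z - w)"
      by (simp add: w'_def proj_away_def)
    ultimately show "norm (G z - G w) \<le> L * norm (proj_away e (z - w))"
      using lip[OF zw(1), of w'] by simp
  qed
  moreover have "\<forall>z. norm (proj_away e (z - x0)) < \<rho> \<longrightarrow> \<bar>(z - x0) \<bullet> e\<bar> < \<rho> \<longrightarrow> G z \<in> ball x0 r \<and> norm (n z) \<le> L - 1"
    using Gr N Zsub by (auto simp: Z_def L_def)
  ultimately show ?thesis by blast
qed

end

text \<open>Dyadic shells: on \<open>t k / 2 < f x \<le> t k\<close> the integrand is comparable
  with \<open>t k powr a\<close>, and the shell has measure at most \<open>K * t k ^ m\<close>. The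
  resulting series is geometric with ratio \<open>q = (1/2) powr (a + real m) < 1\<close>. Points
  with \<open>f x = 0\<close> contribute nothing, as \<open>0 powr a = 0\<close>.\<close>

lemma nn_integral_powr_finite:
  fixes f :: "'b \<Rightarrow> real" and R K a :: real and m :: nat
  assumes f [measurable]: "f \<in> borel_measurable N"
    and range: "\<And>x. x \<in> space N \<Longrightarrow> 0 \<le> f x \<and> f x \<le> R"
    and R: "R > 0" and K: "K \<ge> 0" and a: "a + real m > 0"
    and vol: "\<And>t. 0 < t \<Longrightarrow> t \<le> R \<Longrightarrow> emeasure N {x \<in> space N. f x \<le> t} \<le> ennreal (K * t ^ m)"
  shows "(\<integral>\<^sup>+x. ennreal (f x powr a) \<partial>N) < \<infinity>"
proof -
  define t where "t k = R / 2 ^ k" for k :: nat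
  have t: "0 < t k" "t k \<le> R" for k using R by (auto simp: t_def divide_le_eq_1 field_simps)
  define A where "A k = {x \<in> space N. f x \<le> t k}" for k
  have A [measurable]: "A k \<in> sets N" for k unfolding A_def by measurable
  \<comment> \<open>On a dyadic shell the powers of \<open>f x\<close> and \<open>t k\<close> differ
    by at most this factor, whatever the sign of \<open>a\<close>.\<close>
  define c where "c = (2::real) powr \<bar>a\<bar>"
  define q where "q = (1/2::real) powr (a + real m)"
  have q: "0 < q" "q < 1" using a powr_less_mono2[of "a + real m" "1/2" 1] by (auto simp: q_def)
  have pointwise: "ennreal (f x powr a) \<le> (\<Sum>k. ennreal (c * t k powr a) * indicator (A k) x)"
    if x: "x \<in> space N" for x
  proof (cases "f x = 0")
    case False
    then have fx: "0 < f x" "f x \<le> R" using range[OF x] by auto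
    obtain k0 where "R / f x < 2 ^ k0" using real_arch_pow[of 2 "R / f x"] by auto
    then have k0: "t k0 < f x" using fx by (simp add: t_def field_simps)
    define j where "j = (LEAST k. t k < f x)"
    have j: "t j < f x" unfolding j_def by (rule LeastI[of "\<lambda>k. t k < f x", OF k0])
    have "j \<noteq> 0" using j fx by (intro notI) (simp add: t_def)
    then obtain k where k: "j = Suc k" using not0_implies_Suc by blast
    have fk: "f x \<le> t k"
      using not_less_Least[of k "\<lambda>k. t k < f x"] k unfolding j_def[symmetric] by simp
    have "t (Suc k) = t k / 2" by (simp add: t_def)
    then have fk': "t k / 2 < f x" using j k by simp
    have "f x powr a \<le> c * t k powr a"
    proof (cases "a \<ge> 0")
      case True
      have "f x powr a \<le> t k powr a" using True fk fx by (intro powr_mono2) auto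
      moreover have "1 * t k powr a \<le> c * t k powr a"
        using True by (intro mult_right_mono) (auto simp: c_def ge_one_powr_ge_zero)
      ultimately show ?thesis by simp
    next
      case False
      have "f x powr a \<le> (t k / 2) powr a" using False fk' t[of k] by (intro powr_mono2') auto
      also have "\<dots> = c * t k powr a" using False t[of k]
        by (simp add: powr_divide c_def powr_minus field_simps)
      finally show ?thesis .
    qed
    then have "ennreal (f x powr a) \<le> ennreal (c * t k powr a) * indicator (A k) x"
      using fk x by (simp add: A_def ennreal_leI)
    also have "\<dots> = (\<Sum>i\<in>{k}. ennreal (c * t i powr a) * indicator (A i) x)"
      by (simp only: sum.insert[OF finite.emptyI] empty_iff not_False_eq_True sum.empty add_0_right)
    also have "\<dots> \<le> (\<Sum>i. ennreal (c * t i powr a) * indicator (A i) x)"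
      by (rule sum_le_suminf) auto
    finally show ?thesis .
  qed simp
  have summand: "ennreal (c * t k powr a) * emeasure N (A k) \<le> ennreal (c * K * R powr (a + real m) * q ^ k)" for k
  proof -
    have "t k ^ m = t k powr real m" using t[of k] by (simp add: powr_realpow)
    then have "t k powr a * t k ^ m = t k powr (a + real m)" by (simp add: powr_add)
    also have "t k powr (a + real m) = R powr (a + real m) * q powr real k"
    proof -
      have "t k = R * (1/2) powr real k" by (simp add: t_def powr_realpow power_divide)
      then show ?thesis using R by (simp add: powr_mult q_def powr_powr mult.commute)
    qed
    also have "q powr real k = q ^ k" using q by (simp add: powr_realpow)
    finally have eq: "t k powr a * t k ^ m = R powr (a + real m) * q ^ k" .
    have "ennreal (c * t k powr a) * emeasure N (A k) \<le> ennreal (c * t k powr a) * ennreal (K * t k ^ m)"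
      using vol[OF t] unfolding A_def by (intro mult_left_mono) auto
    also have "\<dots> = ennreal (c * K * (t k powr a * t k ^ m))"
      using K t[of k] by (subst ennreal_mult[symmetric]) (auto simp: c_def mult_ac)
    finally show ?thesis unfolding eq by (simp add: mult_ac)
  qed
  have "(\<integral>\<^sup>+x. ennreal (f x powr a) \<partial>N) \<le> (\<integral>\<^sup>+x. (\<Sum>k. ennreal (c * t k powr a) * indicator (A k) x) \<partial>N)"
    using pointwise by (intro nn_integral_mono) auto
  also have "\<dots> = (\<Sum>k. ennreal (c * t k powr a) * emeasure N (A k))"
    by (subst nn_integral_suminf) (auto simp: nn_integral_cmult)
  also have "\<dots> \<le> (\<Sum>k. ennreal (c * K * R powr (a + real m) * q ^ k))"
    using summand by (intro suminf_le) auto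
  also have "\<dots> = ennreal (\<Sum>k. c * K * R powr (a + real m) * q ^ k)"
    using q K by (intro suminf_ennreal2) (auto simp: c_def intro!: summable_mult summable_geometric)
  also have "\<dots> < \<infinity>" by simp
  finally show ?thesis .
qed

text \<open>This is \<open>0 \<le> \<integral>(f' - (f 1 - f 0))\<^sup>2\<close>.\<close>

lemma sq_increment_le:
  fixes f f' :: "real \<Rightarrow> real"
  assumes d: "\<And>t. t \<in> {0..1} \<Longrightarrow> (f has_real_derivative f' t) (at t)"
    and c: "continuous_on {0..1} f'"
  shows "ennreal ((f 1 - f 0)\<^sup>2) \<le> (\<integral>\<^sup>+t\<in>{0..1}. ennreal ((f' t)\<^sup>2) \<partial>lborel)"
proof -
  define I where "I = f 1 - f 0"
  have f'I: "(f' has_integral I) {0..1}"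
    unfolding I_def using d
    by (intro fundamental_theorem_of_calculus)
      (auto simp: has_real_derivative_iff_has_vector_derivative[symmetric] intro: has_field_derivative_at_within)
  have "(\<lambda>t. (f' t)\<^sup>2) integrable_on {0..1}"
    by (intro integrable_continuous_real continuous_intros c)
  then obtain Q where Q: "((\<lambda>t. (f' t)\<^sup>2) has_integral Q) {0..1}" by (auto simp: integrable_on_def)
  have "((\<lambda>t. (f' t)\<^sup>2 - 2 * I * f' t + I\<^sup>2) has_integral (Q - 2 * I * I + I\<^sup>2)) {0..1}"
    using has_integral_add[OF has_integral_diff[OF Q has_integral_mult_right[OF f'I, of "2 * I"]]
        has_integral_const_real[of "I\<^sup>2" 0 1]] by simp
  then have "0 \<le> Q - 2 * I * I + I\<^sup>2"
    by (rule has_integral_nonneg) (metis (no_types, opaque_lifting) power2_diff zero_le_power2 diff_add_eq mult.assoc mult.commute)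
  then have IQ: "I\<^sup>2 \<le> Q" by (simp add: power2_eq_square)
  have "(\<integral>\<^sup>+t. ennreal (indicat_real {0..1} t *\<^sub>R (f' t)\<^sup>2) \<partial>lborel) = ennreal Q"
  proof (rule nn_integral_has_integral_lborel)
    show "(\<lambda>t. indicat_real {0..1} t *\<^sub>R (f' t)\<^sup>2) \<in> borel_measurable borel"
      by (intro borel_measurable_continuous_on_indicator continuous_intros c) auto
    have "(\<lambda>t. indicat_real {0..1} t *\<^sub>R (f' t)\<^sup>2) = (\<lambda>t. if t \<in> {0..1} then (f' t)\<^sup>2 else 0)"
      by (auto simp: indicator_def)
    then show "((\<lambda>t. indicat_real {0..1} t *\<^sub>R (f' t)\<^sup>2) has_integral Q) UNIV"
      using Q by (simp only: has_integral_restrict_UNIV)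
  qed simp
  moreover have "ennreal (indicat_real {0..1} t *\<^sub>R (f' t)\<^sup>2) = ennreal ((f' t)\<^sup>2) * indicator {0..1} t" for t
    by (auto simp: indicator_def)
  ultimately show ?thesis using IQ by (simp add: I_def ennreal_leI)
qed

section \<open>Smooth functions and tangential gradients on the whole boundary\<close>

lemma Ck_fun_const: "Ck_fun k (\<lambda>_. c)"
proof (induction k arbitrary: c)
  case (Suc k)
  show ?case unfolding Ck_fun.simps
    by (rule exI[of _ "\<lambda>_ _. 0"]) (use Suc[of 0] in simp)
qed simp

lemma Ck_fun_add: "Ck_fun k f \<Longrightarrow> Ck_fun k g \<Longrightarrow> Ck_fun k (\<lambda>x. f x + g x)"
proof (induction k arbitrary: f g)
  case (Suc k)
  from Suc.prems obtain f' g' where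
    "\<forall>x. (f has_derivative f' x) (at x)" "\<forall>v. Ck_fun k (\<lambda>x. f' x v)"
    "\<forall>x. (g has_derivative g' x) (at x)" "\<forall>v. Ck_fun k (\<lambda>x. g' x v)" by auto
  then have "(\<forall>x. ((\<lambda>x. f x + g x) has_derivative (\<lambda>v. f' x v + g' x v)) (at x))"
    "\<forall>v. Ck_fun k (\<lambda>x. f' x v + g' x v)"
    using Suc.IH has_derivative_add by blast+
  then show ?case unfolding Ck_fun.simps by (intro exI[of _ "\<lambda>x v. f' x v + g' x v"]) simp
qed (simp add: continuous_on_add)

lemma Ck_fun_cmult: "Ck_fun k f \<Longrightarrow> Ck_fun k (\<lambda>x. c * f x)"
proof (induction k arbitrary: f)
  case (Suc k)
  from Suc.prems obtain f' where
    "\<forall>x. (f has_derivative f' x) (at x)" "\<forall>v. Ck_fun k (\<lambda>x. f' x v)" by auto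
  then have "(\<forall>x. ((\<lambda>x. c * f x) has_derivative (\<lambda>v. c * f' x v)) (at x))"
    "\<forall>v. Ck_fun k (\<lambda>x. c * f' x v)"
    using Suc.IH has_derivative_mult_right by blast+
  then show ?case unfolding Ck_fun.simps by (intro exI[of _ "\<lambda>x v. c * f' x v"]) simp
qed (simp add: continuous_on_mult_left)

text \<open>The class is written \<open>Suc k\<close> so that at least one derivative is available
  for the charts.\<close>

locale regular_domain =
  fixes \<Omega> :: "'a::euclidean_space set" and k :: nat
  assumes domain: "bounded_Ck_domain (Suc k) \<Omega>"
begin

abbreviation "M \<equiv> surface_measure \<Omega>"
abbreviation "F \<equiv> frontier \<Omega>"
abbreviation "S \<equiv> Cinf_boundary \<Omega>"

lemma compact_F: "compact F"
  using domain by (simp add: bounded_Ck_domain_def compact_frontier_bounded)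

lemma local_graph_exists:
  assumes "x0 \<in> F"
  obtains r e \<gamma> \<gamma>' where "local_graph \<Omega> x0 r e \<gamma> \<gamma>'"
proof -
  from assms domain obtain r e \<gamma> where *: "r > 0" "norm e = 1" "Ck_fun (Suc k) \<gamma>"
    "\<forall>y t. \<gamma> (y + t *\<^sub>R e) = \<gamma> y" "\<Omega> \<inter> ball x0 r = {y \<in> ball x0 r. \<gamma> y < y \<bullet> e}"
    unfolding bounded_Ck_domain_def Ck_boundary_def by meson
  from Ck_fun_C1[OF *(3)] obtain \<gamma>' where \<gamma>': "\<forall>x. (\<gamma> has_derivative \<gamma>' x) (at x)"
    "\<forall>v. continuous_on UNIV (\<lambda>x. \<gamma>' x v)" by blast
  have "local_graph \<Omega> x0 r e \<gamma> \<gamma>'"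
    using * \<gamma>' assms domain by unfold_locales (auto simp: bounded_Ck_domain_def)
  then show thesis by (rule that)
qed

lemma Cinf_subspace: "fun_subspace S"
  unfolding fun_subspace_def
proof (intro conjI ballI allI)
  show "(\<lambda>_. 0) \<in> S" unfolding Cinf_boundary_def
    using Ck_fun_const[of _ "0::real"] by (intro CollectI exI[of _ "\<lambda>_. 0"]) auto
next
  fix f g assume "f \<in> S" "g \<in> S"
  then obtain \<Phi> \<Psi> where "f = (\<lambda>x. if x \<in> F then \<Phi> x else 0)" "\<forall>k. Ck_fun k \<Phi>"
    "g = (\<lambda>x. if x \<in> F then \<Psi> x else 0)" "\<forall>k. Ck_fun k \<Psi>" unfolding Cinf_boundary_def by blast
  then show "(\<lambda>x. f x + g x) \<in> S" unfolding Cinf_boundary_def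
    by (intro CollectI exI[of _ "\<lambda>x. \<Phi> x + \<Psi> x"]) (auto simp: Ck_fun_add)
next
  fix f and a :: real assume "f \<in> S"
  then obtain \<Phi> where "f = (\<lambda>x. if x \<in> F then \<Phi> x else 0)" "\<forall>k. Ck_fun k \<Phi>"
    unfolding Cinf_boundary_def by blast
  then show "(\<lambda>x. a *\<^sub>R f x) \<in> S" unfolding Cinf_boundary_def
    by (intro CollectI exI[of _ "\<lambda>x. a * \<Phi> x"]) (auto simp: Ck_fun_cmult)
qed

lemma Cinf_0: "(\<lambda>_. 0) \<in> S"
  and Cinf_add: "f \<in> S \<Longrightarrow> g \<in> S \<Longrightarrow> (\<lambda>x. f x + g x) \<in> S"
  and Cinf_cmult: "f \<in> S \<Longrightarrow> (\<lambda>x. c * f x) \<in> S"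
  using Cinf_subspace unfolding fun_subspace_def by auto

lemma Cinf_diff: "f \<in> S \<Longrightarrow> g \<in> S \<Longrightarrow> (\<lambda>x. f x - g x) \<in> S"
  using Cinf_add[of f "\<lambda>x. -1 * g x"] Cinf_cmult[of g "-1"] by simp

text \<open>\<open>a\<close> is the gradient of a smooth extension. It depends on the extension, its
  tangential part does not.\<close>

lemma Cinf_gradient:
  assumes "f \<in> S"
  shows "\<exists>a. continuous_on UNIV a \<and> (\<forall>y\<in>F. (f has_derivative (\<lambda>v. a y \<bullet> v)) (at y within F))"
proof -
  from assms obtain \<Phi> where \<Phi>: "f = (\<lambda>x. if x \<in> F then \<Phi> x else 0)" "\<forall>k. Ck_fun k \<Phi>"
    unfolding Cinf_boundary_def by blast
  from \<Phi>(2) have "Ck_fun (Suc 0) \<Phi>" by blast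
  from Ck_fun_C1[OF this] obtain \<Phi>' where "\<forall>x. (\<Phi> has_derivative \<Phi>' x) (at x)"
    "\<forall>v. continuous_on UNIV (\<lambda>x. \<Phi>' x v)" by blast
  then have \<Phi>': "(\<Phi> has_derivative \<Phi>' x) (at x)" "continuous_on UNIV (\<lambda>x. \<Phi>' x v)" for x v
    by simp_all
  define a where "a y = (\<Sum>b\<in>Basis. \<Phi>' y b *\<^sub>R b)" for y
  have a: "a y \<bullet> v = \<Phi>' y v" for y v
  proof -
    interpret linear "\<Phi>' y" using \<Phi>'(1) has_derivative_linear by blast
    have "\<Phi>' y v = \<Phi>' y (\<Sum>b\<in>Basis. (v \<bullet> b) *\<^sub>R b)" by (simp add: euclidean_representation)
    also have "\<dots> = a y \<bullet> v"
      unfolding a_def by (simp add: sum scale inner_sum_left inner_commute[of v] mult.commute)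
    finally show ?thesis by simp
  qed
  show ?thesis
  proof (intro exI[of _ a] conjI ballI)
    show "continuous_on UNIV a" unfolding a_def by (intro continuous_intros \<Phi>'(2))
    fix y assume y: "y \<in> F"
    have "(\<Phi> has_derivative (\<lambda>v. a y \<bullet> v)) (at y within F)"
      unfolding a using has_derivative_at_withinI[OF \<Phi>'(1)] by simp
    then show "(f has_derivative (\<lambda>v. a y \<bullet> v)) (at y within F)"
      by (rule has_derivative_transform_within[of _ _ _ _ 1]) (use y in \<open>auto simp: \<Phi>(1)\<close>)
  qed
qed

lemma Cinf_continuous: "f \<in> S \<Longrightarrow> continuous_on F f"
proof -
  assume "f \<in> S"
  from Cinf_gradient[OF this] obtain a
    where a: "\<forall>y\<in>F. (f has_derivative (\<lambda>v. a y \<bullet> v)) (at y within F)" by blast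
  have "continuous (at y within F) f" if "y \<in> F" for y
    using a that has_derivative_continuous[of f "\<lambda>v. a y \<bullet> v" y F] by simp
  then show ?thesis by (simp add: continuous_on_eq_continuous_within)
qed

lemma tangential_gradient_formula:
  assumes y: "y \<in> F" and a: "(\<phi> has_derivative (\<lambda>v. a \<bullet> v)) (at y within F)"
  shows "tangential_gradient \<Omega> \<phi> y = a - (a \<bullet> outer_normal \<Omega> y) *\<^sub>R outer_normal \<Omega> y"
    and "(\<phi> has_derivative (\<lambda>v. tangential_gradient \<Omega> \<phi> y \<bullet> v)) (at y within F)"
proof -
  obtain r e \<gamma> \<gamma>' where "local_graph \<Omega> y r e \<gamma> \<gamma>'" using local_graph_exists[OF y] .
  then interpret local_graph \<Omega> y r e \<gamma> \<gamma>' .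
  have "y \<in> ball y r" using r by simp
  from tangential_gradient_chart_formula[OF this y a]
  show "tangential_gradient \<Omega> \<phi> y = a - (a \<bullet> outer_normal \<Omega> y) *\<^sub>R outer_normal \<Omega> y"
    "(\<phi> has_derivative (\<lambda>v. tangential_gradient \<Omega> \<phi> y \<bullet> v)) (at y within F)" by blast+
qed

text \<open>Near each boundary point the normal is the normalised \<open>n\<close>, which is
  continuous on the whole space.\<close>

lemma continuous_outer_normal: "continuous_on F (outer_normal \<Omega>)"
  unfolding continuous_on_eq_continuous_within
proof
  fix y assume y: "y \<in> F"
  obtain r e \<gamma> \<gamma>' where "local_graph \<Omega> y r e \<gamma> \<gamma>'" using local_graph_exists[OF y] .
  then interpret local_graph \<Omega> y r e \<gamma> \<gamma>' .
  have "continuous_on UNIV (\<lambda>z. n z /\<^sub>R norm (n z))"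
    by (intro continuous_intros continuous_n) (simp add: n_nonzero)
  then have "continuous (at y within F) (\<lambda>z. n z /\<^sub>R norm (n z))"
    by (simp add: continuous_on_eq_continuous_at continuous_at_imp_continuous_at_within)
  then show "continuous (at y within F) (outer_normal \<Omega>)"
  proof (rule continuous_transform_within[OF _ r y])
    fix z assume "z \<in> F" "dist z y < r"
    then show "n z /\<^sub>R norm (n z) = outer_normal \<Omega> z"
      using outer_normal_eq[of z] by (simp add: dist_commute)
  qed
qed

lemma tangential_gradient_Cinf:
  assumes f: "f \<in> S"
  shows "continuous_on F (tangential_gradient \<Omega> f)"
    and "y \<in> F \<Longrightarrow> (f has_derivative (\<lambda>v. tangential_gradient \<Omega> f y \<bullet> v)) (at y within F)"
proof -
  from Cinf_gradient[OF f] obtain a where a: "continuous_on UNIV a"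
    and "\<forall>y\<in>F. (f has_derivative (\<lambda>v. a y \<bullet> v)) (at y within F)" by blast
  then have a2: "(f has_derivative (\<lambda>v. a y \<bullet> v)) (at y within F)" if "y \<in> F" for y
    using that by simp
  show "y \<in> F \<Longrightarrow> (f has_derivative (\<lambda>v. tangential_gradient \<Omega> f y \<bullet> v)) (at y within F)"
    by (rule tangential_gradient_formula(2)[OF _ a2])
  have "continuous_on F (\<lambda>y. a y - (a y \<bullet> outer_normal \<Omega> y) *\<^sub>R outer_normal \<Omega> y)"
    using continuous_on_subset[OF a] by (intro continuous_intros continuous_outer_normal) auto
  then show "continuous_on F (tangential_gradient \<Omega> f)"
    by (rule continuous_on_eq) (simp add: tangential_gradient_formula(1)[OF _ a2])
qed

lemma tangential_gradient_linear:
  assumes f: "f \<in> S" and g: "g \<in> S" and y: "y \<in> F"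
  shows "tangential_gradient \<Omega> (\<lambda>x. f x + c * g x) y = tangential_gradient \<Omega> f y + c *\<^sub>R tangential_gradient \<Omega> g y"
proof -
  from Cinf_gradient[OF f] obtain a where a: "\<forall>y\<in>F. (f has_derivative (\<lambda>v. a y \<bullet> v)) (at y within F)"
    by blast
  from Cinf_gradient[OF g] obtain b where b: "\<forall>y\<in>F. (g has_derivative (\<lambda>v. b y \<bullet> v)) (at y within F)"
    by blast
  have "((\<lambda>x. f x + c * g x) has_derivative (\<lambda>v. a y \<bullet> v + c * (b y \<bullet> v))) (at y within F)"
    by (intro has_derivative_add has_derivative_mult_right a[rule_format] b[rule_format] y)
  then have "((\<lambda>x. f x + c * g x) has_derivative (\<lambda>v. (a y + c *\<^sub>R b y) \<bullet> v)) (at y within F)"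
    by (simp add: inner_add_left)
  from tangential_gradient_formula(1)[OF y this] show ?thesis
    by (simp add: tangential_gradient_formula(1)[OF y a[rule_format, OF y]]
        tangential_gradient_formula(1)[OF y b[rule_format, OF y]] inner_add_left algebra_simps)
qed

section \<open>Surface measure of the whole boundary\<close>

lemma space_M [simp]: "space M = F"
  by (simp add: surface_measure_def space_restrict_space)

lemma F_borel [measurable]: "F \<in> sets borel"
  using compact_F by (rule borel_compact)

lemma sets_M_eq: "sets M = sets (restrict_space borel F)"
  unfolding surface_measure_def by (intro sets_restrict_space_cong) simp

lemma sets_M: "A \<in> sets M \<longleftrightarrow> A \<in> sets borel \<and> A \<subseteq> F"
  unfolding sets_M_eq by (subst sets_restrict_space_iff) auto

lemma continuous_measurable_M:
  "continuous_on F f \<Longrightarrow> (f :: 'a \<Rightarrow> 'b::topological_space) \<in> borel_measurable M"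
  using borel_measurable_continuous_on_restrict[of F f] measurable_cong_sets[OF sets_M_eq refl] by blast

lemma borel_measurable_M: "f \<in> borel_measurable borel \<Longrightarrow> f \<in> borel_measurable M"
  using measurable_restrict_space1[of f borel borel F] measurable_cong_sets[OF sets_M_eq refl] by blast

lemma Cinf_measurable [measurable (raw)]: "f \<in> S \<Longrightarrow> f \<in> borel_measurable M"
  by (intro continuous_measurable_M Cinf_continuous)

lemma id_measurable [measurable]: "(\<lambda>x. x) \<in> borel_measurable M"
  by (rule borel_measurable_M) simp

text \<open>The factor \<open>2\<close>: the surface measure is controlled by a chart only on the half-size ball.\<close>

definition has_chart :: "'a \<Rightarrow> real \<Rightarrow> bool" where
  "has_chart x r \<longleftrightarrow> (\<exists>R e \<gamma> \<gamma>' L. local_graph \<Omega> x R e \<gamma> \<gamma>' \<and> graph_chart F x e (2 * r) L (local_graph.G e \<gamma>) \<and>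
       (\<forall>z. norm (proj_away e (z - x)) < 2 * r \<longrightarrow> \<bar>(z - x) \<bullet> e\<bar> < 2 * r \<longrightarrow>
          local_graph.G e \<gamma> z \<in> ball x R \<and> norm (local_graph.n e \<gamma>' z) \<le> L - 1))"

lemma chart_cover:
  "\<exists>P r. finite P \<and> P \<subseteq> F \<and> F \<subseteq> (\<Union>x\<in>P. ball x (r x)) \<and> (\<forall>x\<in>P. r x > 0 \<and> has_chart x (r x))"
proof -
  have "\<exists>r. r > 0 \<and> has_chart x r" if x: "x \<in> F" for x
  proof -
    obtain R e \<gamma> \<gamma>' where lg: "local_graph \<Omega> x R e \<gamma> \<gamma>'" using local_graph_exists[OF x] .
    from local_graph.chart_exists[OF lg] obtain \<rho> L where c: "graph_chart F x e \<rho> L (local_graph.G e \<gamma>)"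
      "\<forall>z. norm (proj_away e (z - x)) < \<rho> \<longrightarrow> \<bar>(z - x) \<bullet> e\<bar> < \<rho> \<longrightarrow>
          local_graph.G e \<gamma> z \<in> ball x R \<and> norm (local_graph.n e \<gamma>' z) \<le> L - 1" by (elim exE conjE)
    have "\<rho> / 2 > 0" using graph_chart.rho[OF c(1)] by simp
    moreover have "2 * (\<rho> / 2) = \<rho>" by simp
    then have "has_chart x (\<rho> / 2)" unfolding has_chart_def
      using lg c by (simp only:) (intro exI conjI)
    ultimately show ?thesis by blast
  qed
  then have "\<forall>x\<in>F. \<exists>r. r > 0 \<and> has_chart x r" by blast
  from bchoice[OF this] obtain r where r: "\<forall>x\<in>F. r x > 0 \<and> has_chart x (r x)" by (rule exE)
  have cov: "F \<subseteq> (\<Union>x\<in>F. ball x (r x))" using r by force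
  obtain P where P: "P \<subseteq> F" "finite P" "F \<subseteq> (\<Union>x\<in>P. ball x (r x))"
    by (rule compactE_image[OF compact_F open_ball cov])
  with r show ?thesis by (intro exI[of _ P] exI[of _ r]) auto
qed

lemma has_chart_graph_chart: "has_chart x r \<Longrightarrow> \<exists>e L G. graph_chart F x e (2 * r) L G"
  unfolding has_chart_def by (elim exE conjE) (intro exI)

lemma M_eq_chart: "M = restrict_space (hausdorff_measure (DIM('a) - 1)) F"
  by (simp add: surface_measure_def)

lemma emeasure_M_F: "emeasure M F < \<infinity>"
proof -
  from chart_cover obtain P r where P: "finite P" "P \<subseteq> F" "F \<subseteq> (\<Union>x\<in>P. ball x (r x))"
    and r: "\<forall>x\<in>P. r x > 0 \<and> has_chart x (r x)" by (elim exE conjE)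
  have fin: "emeasure M (F \<inter> cball x (r x)) < \<infinity>" if "x \<in> P" for x
  proof -
    from r that have "has_chart x (r x)" by blast
    from has_chart_graph_chart[OF this] obtain e L G where "graph_chart F x e (2 * r x) L G" by (elim exE)
    from graph_chart.emeasure_M_finite[OF this] show ?thesis by (simp add: M_eq_chart)
  qed
  have sub: "F \<subseteq> (\<Union>x\<in>P. F \<inter> cball x (r x))"
  proof
    fix y assume y: "y \<in> F"
    with P(3) obtain x where "x \<in> P" "y \<in> ball x (r x)" by blast
    then show "y \<in> (\<Union>x\<in>P. F \<inter> cball x (r x))" using y by (intro UN_I[of x]) auto
  qed
  have "emeasure M F \<le> emeasure M (\<Union>x\<in>P. F \<inter> cball x (r x))"
    using P(1) by (intro emeasure_mono sub sets.finite_UN) (auto simp: sets_M)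
  also have "\<dots> \<le> (\<Sum>x\<in>P. emeasure M (F \<inter> cball x (r x)))"
    using P by (intro emeasure_subadditive_finite) (auto simp: sets_M)
  also have "\<dots> < \<infinity>" using fin P(1) by simp
  finally show ?thesis .
qed

sublocale M: finite_measure M
  by standard (use emeasure_M_F in simp)

lemma ahlfors_global:
  assumes "emeasure M B \<noteq> 0"
  shows "\<exists>c>0. \<exists>t0>0. \<forall>x\<in>F. \<forall>t. 0 < t \<longrightarrow> t \<le> t0 \<longrightarrow> ennreal (c * t ^ (DIM('a) - 1)) \<le> emeasure M (F \<inter> ball x t)"
proof -
  from chart_cover obtain P r where P: "finite P" "P \<subseteq> F" "F \<subseteq> (\<Union>x\<in>P. ball x (r x))"
    and r: "\<forall>x\<in>P. r x > 0 \<and> has_chart x (r x)" by (elim exE conjE)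
  have "\<forall>p\<in>P. \<exists>c>0. \<forall>x\<in>F \<inter> ball p (r p). \<forall>t. 0 < t \<longrightarrow> t \<le> 2 * r p \<longrightarrow>
     ennreal (c * t ^ (DIM('a) - 1)) \<le> emeasure M (F \<inter> ball x t)"
  proof
    fix p assume "p \<in> P"
    with r have "has_chart p (r p)" by blast
    from has_chart_graph_chart[OF this] obtain e L G where "graph_chart F p e (2 * r p) L G" by (elim exE)
    from graph_chart.ahlfors_lower[OF this] assms
    show "\<exists>c>0. \<forall>x\<in>F \<inter> ball p (r p). \<forall>t. 0 < t \<longrightarrow> t \<le> 2 * r p \<longrightarrow>
     ennreal (c * t ^ (DIM('a) - 1)) \<le> emeasure M (F \<inter> ball x t)" by (simp add: M_eq_chart)
  qed
  from bchoice[OF this] obtain c where c: "\<forall>p\<in>P. c p > 0 \<and> (\<forall>x\<in>F \<inter> ball p (r p). \<forall>t. 0 < t \<longrightarrow> t \<le> 2 * r p \<longrightarrow>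
     ennreal (c p * t ^ (DIM('a) - 1)) \<le> emeasure M (F \<inter> ball x t))" by blast
  \<comment> \<open>The inserted \<open>1\<close> keeps the minima defined if the cover
    \<open>P\<close> is empty.\<close>
  define c0 where "c0 = Min (insert 1 (c ` P))"
  define t0 where "t0 = Min (insert 1 ((\<lambda>p. 2 * r p) ` P))"
  have "c0 > 0" "t0 > 0" using P(1) c r by (auto simp: c0_def t0_def)
  moreover have "ennreal (c0 * t ^ (DIM('a) - 1)) \<le> emeasure M (F \<inter> ball x t)"
    if x: "x \<in> F" and t: "0 < t" "t \<le> t0" for x t
  proof -
    from x P(3) obtain p where p: "p \<in> P" "x \<in> ball p (r p)" by blast
    have "c0 \<le> c p" "t0 \<le> 2 * r p" using P(1) p by (auto simp: c0_def t0_def)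
    then have "ennreal (c0 * t ^ (DIM('a) - 1)) \<le> ennreal (c p * t ^ (DIM('a) - 1))" "t \<le> 2 * r p"
      using t by (auto intro!: ennreal_leI mult_right_mono)
    then show ?thesis using c p x t by (meson IntI order_trans)
  qed
  ultimately show ?thesis by blast
qed

end

section \<open>Fractional Sobolev norms on the boundary\<close>

context graph_chart
begin

lemma finite_measure_W: "finite_measure W"
proof
  have "emeasure W (space W) = emeasure lborel Z"
    by (subst emeasure_restrict_space) (auto simp: space_restrict_space)
  then show "emeasure W (space W) \<noteq> \<infinity>" using Z_finite by simp
qed

text \<open>The bound for single integrals is applied in \<open>y\<close> for each fixed
  \<open>x\<close> and then in \<open>x\<close>.\<close>

lemma double_integral_upper:
  "\<exists>C\<ge>0. \<forall>k. (\<lambda>(x, y). k x y) \<in> borel_measurable (M \<Otimes>\<^sub>M M) \<longrightarrow>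
     (\<integral>\<^sup>+x. (\<integral>\<^sup>+y. k x y * indicator (cball x0 (\<rho> / 2)) y \<partial>M) * indicator (cball x0 (\<rho> / 2)) x \<partial>M)
     \<le> ennreal C * (\<integral>\<^sup>+z. (\<integral>\<^sup>+w. k (G z) (G w) \<partial>W) \<partial>W)"
proof -
  from nn_integral_upper obtain C where C: "C \<ge> 0 \<and> (\<forall>f\<in>borel_measurable M.
     (\<integral>\<^sup>+x. f x * indicator (cball x0 (\<rho> / 2)) x \<partial>M) \<le> ennreal C * (\<integral>\<^sup>+z. f (G z) \<partial>W))" by (rule exE)
  have ind: "(indicator (cball x0 (\<rho> / 2)) :: 'a \<Rightarrow> ennreal) \<in> borel_measurable M"
    by (intro measurable_restrict_space1 borel_measurable_indicator) simp
  interpret W: finite_measure W by (rule finite_measure_W)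
  note [measurable] = G_measurable_M
  have "(\<integral>\<^sup>+x. (\<integral>\<^sup>+y. k x y * indicator (cball x0 (\<rho> / 2)) y \<partial>M) * indicator (cball x0 (\<rho> / 2)) x \<partial>M)
     \<le> ennreal (C * C) * (\<integral>\<^sup>+z. (\<integral>\<^sup>+w. k (G z) (G w) \<partial>W) \<partial>W)"
    if k [measurable]: "(\<lambda>(x, y). k x y) \<in> borel_measurable (M \<Otimes>\<^sub>M M)" for k
  proof -
    have 1: "(\<integral>\<^sup>+y. k x y * indicator (cball x0 (\<rho> / 2)) y \<partial>M) \<le> ennreal C * (\<integral>\<^sup>+w. k x (G w) \<partial>W)"
      if x: "x \<in> space M" for x
    proof -
      have "(\<lambda>y. k x y) \<in> borel_measurable M" using x by measurable
      then show ?thesis using C by blast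
    qed
    have m: "(\<lambda>x. \<integral>\<^sup>+w. k x (G w) \<partial>W) \<in> borel_measurable M" by measurable
    have "(\<integral>\<^sup>+x. (\<integral>\<^sup>+y. k x y * indicator (cball x0 (\<rho> / 2)) y \<partial>M) * indicator (cball x0 (\<rho> / 2)) x \<partial>M)
      \<le> (\<integral>\<^sup>+x. ennreal C * ((\<integral>\<^sup>+w. k x (G w) \<partial>W) * indicator (cball x0 (\<rho> / 2)) x) \<partial>M)"
    proof (rule nn_integral_mono)
      fix x assume "x \<in> space M"
      from mult_right_mono[OF 1[OF this], of "indicator (cball x0 (\<rho> / 2)) x"]
      show "(\<integral>\<^sup>+y. k x y * indicator (cball x0 (\<rho> / 2)) y \<partial>M) * indicator (cball x0 (\<rho> / 2)) x
        \<le> ennreal C * ((\<integral>\<^sup>+w. k x (G w) \<partial>W) * indicator (cball x0 (\<rho> / 2)) x)"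
        by (simp only: mult.assoc zero_le)
    qed
    also have "\<dots> = ennreal C * (\<integral>\<^sup>+x. (\<integral>\<^sup>+w. k x (G w) \<partial>W) * indicator (cball x0 (\<rho> / 2)) x \<partial>M)"
      by (rule nn_integral_cmult[OF borel_measurable_times_ennreal[OF m ind]])
    also have "\<dots> \<le> ennreal C * (ennreal C * (\<integral>\<^sup>+z. (\<integral>\<^sup>+w. k (G z) (G w) \<partial>W) \<partial>W))"
      using C m by (intro mult_left_mono) auto
    finally show ?thesis using C by (simp add: ennreal_mult mult.assoc)
  qed
  then show ?thesis using C by (intro exI[of _ "C * C"]) auto
qed

lemma nn_integral_lborel_shift:
  fixes f :: "'a \<Rightarrow> ennreal"
  assumes "f \<in> borel_measurable borel"
  shows "(\<integral>\<^sup>+w. f w \<partial>lborel) = (\<integral>\<^sup>+v. f (z + v) \<partial>lborel)"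
proof -
  have "(\<integral>\<^sup>+w. f w \<partial>lborel) = (\<integral>\<^sup>+w. f w \<partial>distr lborel borel ((+) z))" by (simp add: lborel_distr_plus)
  also have "\<dots> = (\<integral>\<^sup>+v. f (z + v) \<partial>lborel)" using assms by (subst nn_integral_distr) auto
  finally show ?thesis .
qed

text \<open>The kernel depends on the horizontal part only and is singular along a vertical line.
  The part of the box where \<open>norm (proj_away e v) \<le> t\<close> lies in a shifted slab of
  volume of order t^(d-1), so the critical exponent is that of dimension d-1.\<close>

lemma kernel_finite:
  assumes "a + real (DIM('a) - 1) > 0"
  shows "(\<integral>\<^sup>+v. ennreal (norm (proj_away e v) powr a) * indicator {v. norm (proj_away e v) \<le> 2 * \<rho> \<and> \<bar>v \<bullet> e\<bar> \<le> 2 * \<rho>} v \<partial>lborel) < \<infinity>"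
proof -
  let ?B = "{v. norm (proj_away e v) \<le> 2 * \<rho> \<and> \<bar>v \<bullet> e\<bar> \<le> 2 * \<rho>}"
  have Pm [measurable]: "(\<lambda>v. norm (proj_away e v)) \<in> borel_measurable borel"
    by (intro borel_measurable_continuous_onI continuous_intros)
  have B [measurable]: "?B \<in> sets borel" by measurable
  \<comment> \<open>The box has closed height \<open>4 * \<rho>\<close>, so the half-open slab has
    to be strictly higher.\<close>
  define H where "H = 5 * \<rho>"
  have H: "H > 0" using rho by (simp add: H_def)
  from emeasure_slab_bounds(2)[OF norm_e H] obtain K where K: "0 < K \<and> (\<forall>D. 0 \<le> D \<longrightarrow> D \<le> H \<longrightarrow>
      emeasure lborel (slab e D H) \<le> ennreal (K * D ^ (DIM('a) - 1)))" by (rule exE)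
  have "(\<integral>\<^sup>+v. ennreal (norm (proj_away e v) powr a) \<partial>restrict_space lborel ?B) < \<infinity>"
  proof (rule nn_integral_powr_finite[where R = "2 * \<rho>" and K = K and m = "DIM('a) - 1"])
    show "(\<lambda>v. norm (proj_away e v)) \<in> borel_measurable (restrict_space lborel ?B)"
      by (intro measurable_restrict_space1) measurable
    fix t :: real assume t: "0 < t" "t \<le> 2 * \<rho>"
    let ?a = "- (2 * \<rho>) *\<^sub>R e"
    have p: "proj_away e (v - ?a) = proj_away e v" for v
      by (simp add: proj_away_simps proj_away_self norm_e)
    have i: "(v - ?a) \<bullet> e = v \<bullet> e + 2 * \<rho>" for v
      by (simp add: inner_diff_left inner_add_left ee)
    have "{x \<in> space (restrict_space lborel ?B). norm (proj_away e x) \<le> t} \<subseteq> {v. v - ?a \<in> slab e t H}"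
      unfolding slab_def mem_Collect_eq p i using rho by (auto simp: space_restrict_space H_def abs_le_iff)
    moreover have "{x \<in> space (restrict_space lborel ?B). norm (proj_away e x) \<le> t} \<subseteq> ?B"
      by (auto simp: space_restrict_space)
    ultimately have "emeasure (restrict_space lborel ?B) {x \<in> space (restrict_space lborel ?B). norm (proj_away e x) \<le> t}
      \<le> emeasure lborel {v. v - ?a \<in> slab e t H}"
      by (subst emeasure_restrict_space) (auto intro!: emeasure_mono shifted_slab_measurable[simplified])
    also have "\<dots> \<le> ennreal (K * t ^ (DIM('a) - 1))"
      using K t rho unfolding emeasure_lborel_shift[OF slab_measurable] by (simp add: H_def)
    finally show "emeasure (restrict_space lborel ?B) {x \<in> space (restrict_space lborel ?B). norm (proj_away e x) \<le> t}
      \<le> ennreal (K * t ^ (DIM('a) - 1))" .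
  qed (use K rho assms in \<open>auto simp: space_restrict_space\<close>)
  then show ?thesis by (subst (asm) nn_integral_restrict_space) auto
qed

text \<open>Substitute \<open>v = w - z\<close> and integrate over \<open>z\<close> first: for fixed
  \<open>v\<close> and \<open>t\<close>, translation invariance makes the integral of
  \<open>H (z + t *\<^sub>R v)\<close> independent of both. What remains is the integral of the
  kernel over \<open>v\<close>.\<close>

lemma segment_energy:
  assumes a: "a + real (DIM('a) - 1) > 0"
  shows "\<exists>C\<ge>0. \<forall>H\<in>borel_measurable W.
    (\<integral>\<^sup>+z. (\<integral>\<^sup>+w. ennreal (norm (proj_away e (w - z)) powr a) *
        (\<integral>\<^sup>+t\<in>{0..1}. H (z + t *\<^sub>R (w - z)) \<partial>lborel) \<partial>W) \<partial>W) \<le> ennreal C * (\<integral>\<^sup>+z. H z \<partial>W)"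
proof -
  define B where "B = {v. norm (proj_away e v) \<le> 2 * \<rho> \<and> \<bar>v \<bullet> e\<bar> \<le> 2 * \<rho>}"
  define Q where "Q v = ennreal (norm (proj_away e v) powr a) * indicator B v" for v
  have Pm [measurable]: "(\<lambda>v. norm (proj_away e v)) \<in> borel_measurable borel"
    by (intro borel_measurable_continuous_onI continuous_intros)
  have B [measurable]: "B \<in> sets borel" unfolding B_def by measurable
  have Q [measurable]: "Q \<in> borel_measurable borel" unfolding Q_def by measurable
  define C where "C = enn2real (\<integral>\<^sup>+v. Q v \<partial>lborel)"
  have C: "(\<integral>\<^sup>+v. Q v \<partial>lborel) = ennreal C" 
    using kernel_finite[OF a] unfolding C_def Q_def B_def by simp
  have "(\<integral>\<^sup>+z. (\<integral>\<^sup>+w. ennreal (norm (proj_away e (w - z)) powr a) *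
        (\<integral>\<^sup>+t\<in>{0..1}. H (z + t *\<^sub>R (w - z)) \<partial>lborel) \<partial>W) \<partial>W) \<le> ennreal C * (\<integral>\<^sup>+z. H z \<partial>W)"
    if H: "H \<in> borel_measurable W" for H
  proof -
    \<comment> \<open>The extension by zero makes translations of the whole space available. Nothing
      is lost on the segments, which lie in the convex set \<open>Z\<close>.\<close>
    define H' where "H' z = H z * indicator Z z" for z
    have H' [measurable]: "H' \<in> borel_measurable borel"
      using H unfolding H'_def[abs_def] by (subst (asm) borel_measurable_restrict_space_iff_ennreal) auto
    define E where "E z v = (\<integral>\<^sup>+t. H' (z + t *\<^sub>R v) * indicator {0..1::real} t \<partial>lborel)" for z v
    have Em [measurable]: "(\<lambda>(z, v). E z v) \<in> borel_measurable (lborel \<Otimes>\<^sub>M lborel)"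
      unfolding E_def by measurable
    have intH: "(\<integral>\<^sup>+z. H z \<partial>W) = (\<integral>\<^sup>+z. H' z \<partial>lborel)"
      unfolding H'_def by (subst nn_integral_restrict_space) auto
    have point: "ennreal (norm (proj_away e (w - z)) powr a) * (\<integral>\<^sup>+t\<in>{0..1}. H (z + t *\<^sub>R (w - z)) \<partial>lborel)
        = Q (w - z) * E z (w - z)" if zw: "z \<in> Z" "w \<in> Z" for z w
    proof -
      have "w - z \<in> B"
      proof -
        have "w - z = (w - x0) - (z - x0)" by simp
        then have "proj_away e (w - z) = proj_away e (w - x0) - proj_away e (z - x0)"
          "(w - z) \<bullet> e = (w - x0) \<bullet> e - (z - x0) \<bullet> e"
          by (metis proj_away_simps(2), metis inner_diff_left)
        then show ?thesis using zw norm_triangle_ineq4[of "proj_away e (w - x0)" "proj_away e (z - x0)"]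
            abs_triangle_ineq4[of "(w - x0) \<bullet> e" "(z - x0) \<bullet> e"]
          by (simp add: B_def Z_def)
      qed
      moreover have "H (z + t *\<^sub>R (w - z)) * indicator {0..1} t = H' (z + t *\<^sub>R (w - z)) * indicator {0..1} t" for t
      proof (cases "t \<in> {0..1}")
        case True
        have "z + t *\<^sub>R (w - z) = (1 - t) *\<^sub>R z + t *\<^sub>R w" by (simp add: algebra_simps)
        also have "\<dots> \<in> Z" unfolding Z_def
          using True zw unfolding Z_def by (intro convexD[OF convex_cylinder]) auto
        finally show ?thesis by (simp add: H'_def)
      qed simp
      ultimately show ?thesis by (simp add: Q_def E_def)
    qed
    have "(\<integral>\<^sup>+z. (\<integral>\<^sup>+w. ennreal (norm (proj_away e (w - z)) powr a) *
        (\<integral>\<^sup>+t\<in>{0..1}. H (z + t *\<^sub>R (w - z)) \<partial>lborel) \<partial>W) \<partial>W)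
      = (\<integral>\<^sup>+z. (\<integral>\<^sup>+w. Q (w - z) * E z (w - z) \<partial>W) \<partial>W)"
      using point by (intro nn_integral_cong) (simp add: space_restrict_space)
    also have "\<dots> = (\<integral>\<^sup>+z. (\<integral>\<^sup>+w. Q (w - z) * E z (w - z) * indicator Z w \<partial>lborel) * indicator Z z \<partial>lborel)"
      by (simp add: nn_integral_restrict_space)
    also have "\<dots> \<le> (\<integral>\<^sup>+z. (\<integral>\<^sup>+w. Q (w - z) * E z (w - z) \<partial>lborel) \<partial>lborel)"
    proof (rule nn_integral_mono)
      fix z
      have "(\<integral>\<^sup>+w. Q (w - z) * E z (w - z) * indicator Z w \<partial>lborel) \<le> (\<integral>\<^sup>+w. Q (w - z) * E z (w - z) \<partial>lborel)"
        by (intro nn_integral_mono) (auto simp: indicator_def)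
      then show "(\<integral>\<^sup>+w. Q (w - z) * E z (w - z) * indicator Z w \<partial>lborel) * indicator Z z
         \<le> (\<integral>\<^sup>+w. Q (w - z) * E z (w - z) \<partial>lborel)"
        by (auto simp: indicator_def)
    qed
    also have "\<dots> = (\<integral>\<^sup>+z. (\<integral>\<^sup>+v. Q v * E z v \<partial>lborel) \<partial>lborel)"
    proof (rule nn_integral_cong)
      fix z
      have "(\<lambda>v. E z v) \<in> borel_measurable borel" unfolding E_def by measurable
      then have "(\<lambda>w. Q (w - z) * E z (w - z)) \<in> borel_measurable borel" by measurable
      from nn_integral_lborel_shift[OF this, of z]
      show "(\<integral>\<^sup>+w. Q (w - z) * E z (w - z) \<partial>lborel) = (\<integral>\<^sup>+v. Q v * E z v \<partial>lborel)" by simp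
    qed
    also have "\<dots> = (\<integral>\<^sup>+v. (\<integral>\<^sup>+z. Q v * E z v \<partial>lborel) \<partial>lborel)"
      by (rule lborel_pair.Fubini'[symmetric]) measurable
    also have "\<dots> = (\<integral>\<^sup>+v. Q v * (\<integral>\<^sup>+z. H' z \<partial>lborel) \<partial>lborel)"
    proof (rule nn_integral_cong)
      fix v
      have mE: "(\<lambda>z. E z v) \<in> borel_measurable lborel" unfolding E_def by measurable
      have ps: "pair_sigma_finite (lborel :: 'a measure) (lborel :: real measure)"
        by (intro pair_sigma_finite.intro sigma_finite_lborel)
      have "(\<integral>\<^sup>+z. E z v \<partial>lborel) = (\<integral>\<^sup>+t. (\<integral>\<^sup>+z. H' (z + t *\<^sub>R v) * indicator {0..1::real} t \<partial>lborel) \<partial>lborel)"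
        unfolding E_def by (rule pair_sigma_finite.Fubini'[OF ps, symmetric]) measurable
      also have "\<dots> = (\<integral>\<^sup>+t. (\<integral>\<^sup>+z. H' z \<partial>lborel) * indicator {0..1::real} t \<partial>lborel)"
      proof (rule nn_integral_cong)
        fix t :: real
        have "(\<integral>\<^sup>+z. H' (z + t *\<^sub>R v) \<partial>lborel) = (\<integral>\<^sup>+z. H' z \<partial>lborel)"
          using nn_integral_lborel_shift[OF H', of "t *\<^sub>R v"] by (simp add: add.commute)
        then show "(\<integral>\<^sup>+z. H' (z + t *\<^sub>R v) * indicator {0..1::real} t \<partial>lborel) = (\<integral>\<^sup>+z. H' z \<partial>lborel) * indicator {0..1::real} t"
          by (simp add: indicator_def)
      qed
      also have "\<dots> = (\<integral>\<^sup>+z. H' z \<partial>lborel)" by (simp add: nn_integral_cmult)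
      finally show "(\<integral>\<^sup>+z. Q v * E z v \<partial>lborel) = Q v * (\<integral>\<^sup>+z. H' z \<partial>lborel)"
        using mE by (simp add: nn_integral_cmult)
    qed
    also have "\<dots> = ennreal C * (\<integral>\<^sup>+z. H' z \<partial>lborel)" by (simp add: nn_integral_multc C)
    finally show ?thesis unfolding intH .
  qed
  then show ?thesis by (intro exI[of _ C]) (auto simp: C_def)
qed

end

section \<open>Gagliardo semi-norms: embedding of smooth functions and interpolation\<close>

definition kern :: "real \<Rightarrow> ('a::euclidean_space \<Rightarrow> real) \<Rightarrow> 'a \<Rightarrow> 'a \<Rightarrow> ennreal" where
  "kern s \<phi> x y = ennreal ((\<phi> x - \<phi> y)\<^sup>2 / norm (x - y) powr (real (DIM('a) - 1) + 2 * s))"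

context regular_domain
begin

abbreviation "tgrad \<equiv> tangential_gradient \<Omega>"

lemma kern_measurable:
  assumes [measurable]: "\<phi> \<in> borel_measurable M"
  shows "(\<lambda>(x, y). kern s \<phi> x y) \<in> borel_measurable (M \<Otimes>\<^sub>M M)"
  unfolding kern_def by measurable

lemma tgrad_sq_measurable: "\<phi> \<in> S \<Longrightarrow> (\<lambda>x. ennreal ((norm (tgrad \<phi> x))\<^sup>2)) \<in> borel_measurable M"
  by (intro measurable_compose[OF _ measurable_ennreal] continuous_measurable_M continuous_intros tangential_gradient_Cinf)

text \<open>Let \<open>P\<close> be the horizontal distance of \<open>z\<close> and
  \<open>w\<close>. Along the segment the derivative of \<phi> composed with \<open>G\<close> is at
  most \<open>L * P\<close> times the tangential gradient, so the squared increment carries a factor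
  \<open>P\<^sup>2\<close>. The denominator is at least \<open>P powr p\<close>, as \<open>G\<close>
  preserves horizontal parts; hence the exponent \<open>2 - p\<close>.\<close>

lemma kern_chart_bound:
  assumes lg: "local_graph \<Omega> x0 R e \<gamma> \<gamma>'"
    and gc: "graph_chart F x0 e \<rho> L (local_graph.G e \<gamma>)"
    and bd: "\<forall>z. norm (proj_away e (z - x0)) < \<rho> \<longrightarrow> \<bar>(z - x0) \<bullet> e\<bar> < \<rho> \<longrightarrow>
          local_graph.G e \<gamma> z \<in> ball x0 R \<and> norm (local_graph.n e \<gamma>' z) \<le> L - 1"
    and \<phi>: "\<phi> \<in> S" and s: "s \<ge> 0"
    and zw: "norm (proj_away e (z - x0)) < \<rho> \<and> \<bar>(z - x0) \<bullet> e\<bar> < \<rho>"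
            "norm (proj_away e (w - x0)) < \<rho> \<and> \<bar>(w - x0) \<bullet> e\<bar> < \<rho>"
  shows "kern s \<phi> (local_graph.G e \<gamma> z) (local_graph.G e \<gamma> w)
     \<le> ennreal (norm (proj_away e (w - z)) powr (2 - real (DIM('a) - 1) - 2 * s)) *
         (\<integral>\<^sup>+t\<in>{0..1}. ennreal ((L * norm (tgrad \<phi> (local_graph.G e \<gamma> (z + t *\<^sub>R (w - z)))))\<^sup>2) \<partial>lborel)"
proof -
  interpret lg: local_graph \<Omega> x0 R e \<gamma> \<gamma>' by (rule lg)
  interpret c: graph_chart F x0 e \<rho> L lg.G "{z. norm (proj_away e (z - x0)) < \<rho> \<and> \<bar>(z - x0) \<bullet> e\<bar> < \<rho>}"
    by (rule gc)
  define Z where "Z = {z. norm (proj_away e (z - x0)) < \<rho> \<and> \<bar>(z - x0) \<bullet> e\<bar> < \<rho>}"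
  have zZ: "z \<in> Z" "w \<in> Z" using zw by (simp_all add: Z_def)
  define v where "v = w - z"
  define P where "P = norm (proj_away e v)"
  define p where "p = real (DIM('a) - 1) + 2 * s"
  define y where "y t = z + t *\<^sub>R v" for t
  have yZ: "y t \<in> Z" if "t \<in> {0..1}" for t
  proof -
    have "y t = (1 - t) *\<^sub>R z + t *\<^sub>R w" by (simp add: y_def v_def algebra_simps)
    also have "\<dots> \<in> Z" unfolding Z_def
      using that zZ unfolding Z_def by (intro convexD[OF convex_cylinder]) auto
    finally show ?thesis .
  qed
  have GF: "lg.G x \<in> F" if "x \<in> Z" for x using c.G_in that by (simp add: Z_def)
  have bdZ: "lg.G x \<in> ball x0 R" "norm (lg.n x) \<le> L - 1" if "x \<in> Z" for x
    using bd that by (simp_all add: Z_def)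
  define g where "g t = tgrad \<phi> (lg.G (y t))" for t
  define f' where "f' t = g t \<bullet> (v + (lg.n (y t) \<bullet> v) *\<^sub>R e)" for t
  have cont_y: "continuous_on {0..1} y" unfolding y_def by (intro continuous_intros)
  have "continuous_on {0..1} g" unfolding g_def
  proof (rule continuous_on_compose2[OF tangential_gradient_Cinf(1)[OF \<phi>]])
    show "continuous_on {0..1} (\<lambda>t. lg.G (y t))"
      by (rule continuous_on_compose2[OF lg.continuous_G cont_y]) simp
  qed (use yZ GF in auto)
  moreover have "continuous_on {0..1} (\<lambda>t. lg.n (y t))"
    by (rule continuous_on_compose2[OF lg.continuous_n cont_y]) simp
  ultimately have cf': "continuous_on {0..1} f'" unfolding f'_def by (intro continuous_intros)
  have df: "((\<lambda>t. \<phi> (lg.G (y t))) has_real_derivative f' t) (at t)" if t: "t \<in> {0..1}" for t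
  proof -
    have 1: "((\<lambda>x. \<phi> (lg.G x)) has_derivative (\<lambda>u. g t \<bullet> (u + (lg.n (y t) \<bullet> u) *\<^sub>R e))) (at (y t))"
      unfolding g_def
      by (rule lg.derivative_along_chart[OF tangential_gradient_Cinf(2)[OF \<phi> GF[OF yZ[OF t]]] bdZ(1)[OF yZ[OF t]]])
    have 2: "(y has_derivative (\<lambda>h. h *\<^sub>R v)) (at t)"
      unfolding y_def[abs_def] by (auto intro!: derivative_eq_intros)
    from has_derivative_compose[OF 2 1]
    have "((\<lambda>t. \<phi> (lg.G (y t))) has_derivative (\<lambda>h. g t \<bullet> (h *\<^sub>R v + (lg.n (y t) \<bullet> (h *\<^sub>R v)) *\<^sub>R e))) (at t)" .
    moreover have "g t \<bullet> (h *\<^sub>R v + (lg.n (y t) \<bullet> (h *\<^sub>R v)) *\<^sub>R e) = f' t * h" for h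
      by (simp add: f'_def inner_add_right algebra_simps)
    ultimately show ?thesis by (simp add: has_field_derivative_def)
  qed
  have f'_le: "(f' t)\<^sup>2 \<le> P\<^sup>2 * (L * norm (g t))\<^sup>2" if t: "t \<in> {0..1}" for t
  proof -
    \<comment> \<open>The vertical component of \<open>v\<close> cancels because
      \<open>lg.n (y t) \<bullet> e = -1\<close>: moving along \<open>e\<close> does not move the
      image under \<open>G\<close>. Only \<open>P\<close> remains in the bound.\<close>
    have vP: "v = proj_away e v + (v \<bullet> e) *\<^sub>R e" by (simp add: proj_away_def)
    define b where "b = lg.n (y t) \<bullet> proj_away e v"
    have nv: "lg.n (y t) \<bullet> v = b - v \<bullet> e"
      by (subst vP) (simp add: inner_add_right lg.n_e b_def)
    have "v + (lg.n (y t) \<bullet> v) *\<^sub>R e = proj_away e v + b *\<^sub>R e"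
      unfolding nv by (simp add: proj_away_def algebra_simps)
    then have "v + (lg.n (y t) \<bullet> v) *\<^sub>R e = proj_away e v + (lg.n (y t) \<bullet> proj_away e v) *\<^sub>R e"
      by (simp only: b_def)
    then have "norm (v + (lg.n (y t) \<bullet> v) *\<^sub>R e) \<le> P + \<bar>lg.n (y t) \<bullet> proj_away e v\<bar>"
      using norm_triangle_ineq[of "proj_away e v" "(lg.n (y t) \<bullet> proj_away e v) *\<^sub>R e"] lg.norm_e by (simp add: P_def)
    also have "\<bar>lg.n (y t) \<bullet> proj_away e v\<bar> \<le> norm (lg.n (y t)) * P"
      unfolding P_def by (rule Cauchy_Schwarz_ineq2)
    also have "norm (lg.n (y t)) * P \<le> (L - 1) * P"
      using bdZ(2)[OF yZ[OF t]] by (rule mult_right_mono) (simp add: P_def)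
    finally have le: "norm (v + (lg.n (y t) \<bullet> v) *\<^sub>R e) \<le> L * P" by (simp add: algebra_simps)
    have "\<bar>f' t\<bar> \<le> norm (g t) * norm (v + (lg.n (y t) \<bullet> v) *\<^sub>R e)"
      unfolding f'_def by (rule Cauchy_Schwarz_ineq2)
    also have "\<dots> \<le> norm (g t) * (L * P)" using le by (intro mult_left_mono) auto
    finally have "\<bar>f' t\<bar>\<^sup>2 \<le> (norm (g t) * (L * P))\<^sup>2" by (intro power_mono) auto
    then show ?thesis by (simp add: power_mult_distrib mult_ac)
  qed
  define E where "E = (\<integral>\<^sup>+t\<in>{0..1}. ennreal ((L * norm (g t))\<^sup>2) \<partial>lborel)"
  define X where "X = (\<phi> (lg.G z) - \<phi> (lg.G w))\<^sup>2"
  have gm: "(\<lambda>t. ennreal ((L * norm (g t))\<^sup>2) * indicator {0..1} t) \<in> borel_measurable lborel"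
  proof -
    have "(\<lambda>t. indicator {0..1} t *\<^sub>R (L * norm (g t))\<^sup>2) \<in> borel_measurable borel"
      using \<open>continuous_on {0..1} g\<close> by (intro borel_measurable_continuous_on_indicator continuous_intros) auto
    then have m: "(\<lambda>t. ennreal (indicator {0..1} t *\<^sub>R (L * norm (g t))\<^sup>2)) \<in> borel_measurable borel"
      by (rule measurable_compose[OF _ measurable_ennreal])
    have "(\<lambda>t. ennreal (indicator {0..1} t *\<^sub>R (L * norm (g t))\<^sup>2))
        = (\<lambda>t. ennreal ((L * norm (g t))\<^sup>2) * indicator {0..1} t)"
      by (simp add: indicator_def fun_eq_iff)
    with m show ?thesis by (simp only: measurable_lborel2)
  qed
  have "ennreal ((\<phi> (lg.G (y 1)) - \<phi> (lg.G (y 0)))\<^sup>2) \<le> (\<integral>\<^sup>+t\<in>{0..1}. ennreal ((f' t)\<^sup>2) \<partial>lborel)"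
    using df cf' by (rule sq_increment_le)
  also have "\<dots> \<le> (\<integral>\<^sup>+t. ennreal (P\<^sup>2) * (ennreal ((L * norm (g t))\<^sup>2) * indicator {0..1} t) \<partial>lborel)"
  proof (rule nn_integral_mono)
    fix t :: real
    show "ennreal ((f' t)\<^sup>2) * indicator {0..1} t \<le> ennreal (P\<^sup>2) * (ennreal ((L * norm (g t))\<^sup>2) * indicator {0..1} t)"
      using f'_le[of t] by (auto simp: indicator_def ennreal_mult[symmetric] intro!: ennreal_leI)
  qed
  also have "\<dots> = ennreal (P\<^sup>2) * E" unfolding E_def by (rule nn_integral_cmult[OF gm])
  finally have XE: "ennreal X \<le> ennreal (P\<^sup>2) * E"
    by (simp add: X_def y_def v_def power2_commute)
  have Lip: "norm (lg.G z - lg.G w) \<le> L * P"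
    using c.G_lipschitz[of z w] zZ norm_minus_cancel[of "proj_away e (w - z)"]
    by (simp add: Z_def P_def v_def proj_away_simps norm_minus_commute)
  have low: "P \<le> norm (lg.G z - lg.G w)"
    using c.proj_le_G[of w z] by (simp add: P_def v_def norm_minus_commute)
  have "ennreal (X / norm (lg.G z - lg.G w) powr p) \<le> ennreal (P powr (2 - p)) * E"
  proof (cases "P = 0")
    case True
    then have "lg.G z = lg.G w" using Lip by auto
    then show ?thesis by (simp add: X_def)
  next
    case False
    then have P0: "P > 0" by (simp add: P_def)
    have "P powr p \<le> norm (lg.G z - lg.G w) powr p" using s P0 low by (intro powr_mono2) (auto simp: p_def)
    then have "X / norm (lg.G z - lg.G w) powr p \<le> X / P powr p"
    proof (intro divide_left_mono mult_pos_pos)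
      have "norm (lg.G z - lg.G w) > 0" using P0 low by linarith
      then show "0 < norm (lg.G z - lg.G w) powr p" by simp
    qed (use P0 in \<open>auto simp: X_def\<close>)
    also have "\<dots> = P powr (- p) * X" by (simp add: powr_minus field_simps)
    finally have "ennreal (X / norm (lg.G z - lg.G w) powr p) \<le> ennreal (P powr (- p)) * ennreal X"
      by (simp add: X_def ennreal_mult[symmetric] ennreal_leI)
    also have "\<dots> \<le> ennreal (P powr (- p)) * (ennreal (P\<^sup>2) * E)"
      using XE by (rule mult_left_mono) simp
    also have "\<dots> = ennreal (P powr (- p) * P\<^sup>2) * E"
      by (simp add: ennreal_mult mult.assoc)
    also have "P powr (- p) * P\<^sup>2 = P powr (2 - p)"
    proof -
      have "P\<^sup>2 = P powr 2" using P0 by (simp add: powr_numeral)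
      then show ?thesis by (simp add: powr_add[symmetric])
    qed
    finally show ?thesis .
  qed
  moreover have "2 - real (DIM('a) - 1) - 2 * s = 2 - p" by (simp add: p_def)
  ultimately show ?thesis
    by (simp only: kern_def X_def p_def[symmetric] P_def E_def g_def y_def v_def)
qed

text \<open>The surface integral is pulled up to the cylinder, estimated there by the energy along
  segments, and the energy is pushed back to the surface. The kernel is integrable because
  \<open>a + real (DIM('a) - 1) = 2 - 2 * s\<close>, which is positive for
  \<open>s < 1\<close>.\<close>

lemma local_embedding:
  assumes ch: "has_chart x0 r" and B: "emeasure M B \<noteq> 0" and s: "0 < s" "s < 1"
  shows "\<exists>C\<ge>0. \<forall>\<phi>\<in>S.
    (\<integral>\<^sup>+x. (\<integral>\<^sup>+y. kern s \<phi> x y * indicator (cball x0 r) y \<partial>M) * indicator (cball x0 r) x \<partial>M)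
     \<le> ennreal C * (\<integral>\<^sup>+x. ennreal ((norm (tgrad \<phi> x))\<^sup>2) \<partial>M)"
proof -
  from ch obtain R e \<gamma> \<gamma>' L where lg: "local_graph \<Omega> x0 R e \<gamma> \<gamma>'"
    and gc: "graph_chart F x0 e (2 * r) L (local_graph.G e \<gamma>)"
    and bd: "\<forall>z. norm (proj_away e (z - x0)) < 2 * r \<longrightarrow> \<bar>(z - x0) \<bullet> e\<bar> < 2 * r \<longrightarrow>
          local_graph.G e \<gamma> z \<in> ball x0 R \<and> norm (local_graph.n e \<gamma>' z) \<le> L - 1"
    unfolding has_chart_def by (elim exE conjE)
  define G where "G = local_graph.G e \<gamma>"
  define Z where "Z = {z. norm (proj_away e (z - x0)) < 2 * r \<and> \<bar>(z - x0) \<bullet> e\<bar> < 2 * r}"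
  define W where "W = restrict_space lborel Z"
  define a where "a = 2 - real (DIM('a) - 1) - 2 * s"
  have a: "a + real (DIM('a) - 1) > 0" using s by (simp add: a_def)
  have r2: "2 * r / 2 = r" by simp
  note up = graph_chart.double_integral_upper[OF gc, folded M_eq_chart G_def Z_def, folded W_def, unfolded r2]
  note seg = graph_chart.segment_energy[OF gc a, folded M_eq_chart G_def Z_def, folded W_def]
  note low = graph_chart.nn_integral_lower[OF gc B[unfolded M_eq_chart], folded M_eq_chart G_def Z_def, folded W_def]
  note Gm = graph_chart.G_measurable_M[OF gc, folded M_eq_chart G_def Z_def, folded W_def]
  from up obtain C1 where C1: "C1 \<ge> 0 \<and> (\<forall>k. (\<lambda>(x, y). k x y) \<in> borel_measurable (M \<Otimes>\<^sub>M M) \<longrightarrow>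
     (\<integral>\<^sup>+x. (\<integral>\<^sup>+y. k x y * indicator (cball x0 r) y \<partial>M) * indicator (cball x0 r) x \<partial>M)
     \<le> ennreal C1 * (\<integral>\<^sup>+z. (\<integral>\<^sup>+w. k (G z) (G w) \<partial>W) \<partial>W))" by (rule exE)
  from seg obtain C2 where C2: "C2 \<ge> 0 \<and> (\<forall>H\<in>borel_measurable W.
    (\<integral>\<^sup>+z. (\<integral>\<^sup>+w. ennreal (norm (proj_away e (w - z)) powr a) *
        (\<integral>\<^sup>+t\<in>{0..1}. H (z + t *\<^sub>R (w - z)) \<partial>lborel) \<partial>W) \<partial>W) \<le> ennreal C2 * (\<integral>\<^sup>+z. H z \<partial>W))" by (rule exE)
  from low obtain C3 where C3: "C3 \<ge> 0 \<and> (\<forall>f\<in>borel_measurable M. (\<integral>\<^sup>+z. f (G z) \<partial>W) \<le> ennreal C3 * (\<integral>\<^sup>+x. f x \<partial>M))"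
    by (rule exE)
  have "(\<integral>\<^sup>+x. (\<integral>\<^sup>+y. kern s \<phi> x y * indicator (cball x0 r) y \<partial>M) * indicator (cball x0 r) x \<partial>M)
     \<le> ennreal (C1 * (C2 * (C3 * L\<^sup>2))) * (\<integral>\<^sup>+x. ennreal ((norm (tgrad \<phi> x))\<^sup>2) \<partial>M)"
    if \<phi>: "\<phi> \<in> S" for \<phi>
  proof -
    define h where "h x = ennreal ((L * norm (tgrad \<phi> x))\<^sup>2)" for x
    have h_eq: "h x = ennreal (L\<^sup>2) * ennreal ((norm (tgrad \<phi> x))\<^sup>2)" for x
      by (simp add: h_def power_mult_distrib ennreal_mult)
    have hm: "h \<in> borel_measurable M" unfolding h_eq using tgrad_sq_measurable[OF \<phi>] by simp
    have "(\<integral>\<^sup>+x. (\<integral>\<^sup>+y. kern s \<phi> x y * indicator (cball x0 r) y \<partial>M) * indicator (cball x0 r) x \<partial>M)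
      \<le> ennreal C1 * (\<integral>\<^sup>+z. (\<integral>\<^sup>+w. kern s \<phi> (G z) (G w) \<partial>W) \<partial>W)"
      using C1 kern_measurable[OF Cinf_measurable[OF \<phi>]] by blast
    also have "(\<integral>\<^sup>+z. (\<integral>\<^sup>+w. kern s \<phi> (G z) (G w) \<partial>W) \<partial>W)
      \<le> (\<integral>\<^sup>+z. (\<integral>\<^sup>+w. ennreal (norm (proj_away e (w - z)) powr a) *
        (\<integral>\<^sup>+t\<in>{0..1}. h (G (z + t *\<^sub>R (w - z))) \<partial>lborel) \<partial>W) \<partial>W)"
    proof (intro nn_integral_mono)
      fix z w assume "z \<in> space W" "w \<in> space W"
      then have "norm (proj_away e (z - x0)) < 2 * r \<and> \<bar>(z - x0) \<bullet> e\<bar> < 2 * r"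
        "norm (proj_away e (w - x0)) < 2 * r \<and> \<bar>(w - x0) \<bullet> e\<bar> < 2 * r"
        by (simp_all add: W_def Z_def space_restrict_space)
      from kern_chart_bound[OF lg gc bd \<phi> less_imp_le[OF s(1)] this]
      show "kern s \<phi> (G z) (G w) \<le> ennreal (norm (proj_away e (w - z)) powr a) *
        (\<integral>\<^sup>+t\<in>{0..1}. h (G (z + t *\<^sub>R (w - z))) \<partial>lborel)"
        unfolding G_def a_def h_def .
    qed
    also have "\<dots> \<le> ennreal C2 * (\<integral>\<^sup>+z. h (G z) \<partial>W)"
    proof -
      have "(\<lambda>z. h (G z)) \<in> borel_measurable W" using Gm hm by (rule measurable_compose)
      from bspec[OF conjunct2[OF C2] this] show ?thesis .
    qed
    also have "(\<integral>\<^sup>+z. h (G z) \<partial>W) \<le> ennreal C3 * (\<integral>\<^sup>+x. h x \<partial>M)" using C3 hm by blast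
    also have "(\<integral>\<^sup>+x. h x \<partial>M) = ennreal (L\<^sup>2) * (\<integral>\<^sup>+x. ennreal ((norm (tgrad \<phi> x))\<^sup>2) \<partial>M)"
      unfolding h_eq by (rule nn_integral_cmult[OF tgrad_sq_measurable[OF \<phi>]])
    finally have "(\<integral>\<^sup>+x. (\<integral>\<^sup>+y. kern s \<phi> x y * indicator (cball x0 r) y \<partial>M) * indicator (cball x0 r) x \<partial>M)
      \<le> ennreal C1 * (ennreal C2 * (ennreal C3 * (ennreal (L\<^sup>2) * (\<integral>\<^sup>+x. ennreal ((norm (tgrad \<phi> x))\<^sup>2) \<partial>M))))"
      by (simp add: mult_left_mono)
    then show ?thesis using C1 C2 C3 by (simp add: ennreal_mult mult.assoc)
  qed
  moreover have "C1 * (C2 * (C3 * L\<^sup>2)) \<ge> 0" using C1 C2 C3 by simp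
  ultimately show ?thesis by blast
qed

lemma null_integral: "emeasure M F = 0 \<Longrightarrow> (\<integral>\<^sup>+x. f x \<partial>M) = 0"
proof -
  assume "emeasure M F = 0"
  then have "F \<in> null_sets M" by (intro null_setsI) (auto simp: sets_M)
  then have "AE x in M. f x = 0" by (rule AE_I') auto
  then have "(\<integral>\<^sup>+x. f x \<partial>M) = (\<integral>\<^sup>+x. 0 \<partial>M)" by (rule nn_integral_cong_AE)
  then show ?thesis by simp
qed

lemma Hs_semi_sq_eq:
  assumes "0 < s" "s < 1" "\<phi> \<in> borel_measurable M"
  shows "Hs_semi_sq s \<Omega> \<phi> = (\<integral>\<^sup>+z. kern s \<phi> (fst z) (snd z) \<partial>(M \<Otimes>\<^sub>M M))"
proof -
  have "(\<lambda>z. kern s \<phi> (fst z) (snd z)) \<in> borel_measurable (M \<Otimes>\<^sub>M M)"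
    using kern_measurable[OF assms(3)] by (simp add: case_prod_beta')
  from M.nn_integral_fst[OF this] show ?thesis
    using assms by (simp add: Hs_semi_sq_def kern_def)
qed

abbreviation far :: "real \<Rightarrow> ('a \<times> 'a) set" where
  "far \<delta> \<equiv> {z. \<delta> \<le> norm (fst z - snd z)}"

text \<open>Away from the diagonal the kernel is bounded,
  \<open>(a - b)\<^sup>2 \<le> 2 * a\<^sup>2 + 2 * b\<^sup>2\<close>, and the total measure is
  finite.\<close>

lemma kern_far:
  assumes \<delta>: "\<delta> > 0" and s: "s \<ge> 0"
  shows "\<exists>C\<ge>0. \<forall>\<phi>\<in>borel_measurable M.
    (\<integral>\<^sup>+z. kern s \<phi> (fst z) (snd z) * indicator (far \<delta>) z \<partial>(M \<Otimes>\<^sub>M M))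
     \<le> ennreal C * (\<integral>\<^sup>+x. ennreal ((\<phi> x)\<^sup>2) \<partial>M)"
proof -
  define c where "c = 2 / \<delta> powr (real (DIM('a) - 1) + 2 * s)"
  have c: "c \<ge> 0" by (simp add: c_def)
  define \<mu> where "\<mu> = measure M F"
  have \<mu>: "emeasure M F = ennreal \<mu>" by (simp add: \<mu>_def M.emeasure_eq_measure)
  have "(\<integral>\<^sup>+z. kern s \<phi> (fst z) (snd z) * indicator (far \<delta>) z \<partial>(M \<Otimes>\<^sub>M M))
     \<le> ennreal (2 * c * \<mu>) * (\<integral>\<^sup>+x. ennreal ((\<phi> x)\<^sup>2) \<partial>M)" if \<phi> [measurable]: "\<phi> \<in> borel_measurable M" for \<phi>
  proof -
    have "(\<integral>\<^sup>+z. kern s \<phi> (fst z) (snd z) * indicator (far \<delta>) z \<partial>(M \<Otimes>\<^sub>M M))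
      \<le> (\<integral>\<^sup>+z. ennreal (c * (\<phi> (fst z))\<^sup>2) + ennreal (c * (\<phi> (snd z))\<^sup>2) \<partial>(M \<Otimes>\<^sub>M M))"
    proof (rule nn_integral_mono)
      fix z :: "'a \<times> 'a"
      let ?n = "norm (fst z - snd z)" and ?p = "real (DIM('a) - 1) + 2 * s"
      have "(\<phi> (fst z) - \<phi> (snd z))\<^sup>2 / ?n powr ?p \<le> c * (\<phi> (fst z))\<^sup>2 + c * (\<phi> (snd z))\<^sup>2" if "?n \<ge> \<delta>"
      proof -
        have "\<delta> powr ?p \<le> ?n powr ?p" using that \<delta> s by (intro powr_mono2) auto
        then have "(\<phi> (fst z) - \<phi> (snd z))\<^sup>2 / ?n powr ?p \<le> (\<phi> (fst z) - \<phi> (snd z))\<^sup>2 / \<delta> powr ?p"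
        proof (intro divide_left_mono mult_pos_pos)
          have "?n > 0" using \<delta> that by linarith
          then show "0 < ?n powr ?p" by simp
        qed (use \<delta> in auto)
        also have "\<dots> \<le> (2 * (\<phi> (fst z))\<^sup>2 + 2 * (\<phi> (snd z))\<^sup>2) / \<delta> powr ?p"
          using sum_squares_bound[of "\<phi> (fst z)" "- \<phi> (snd z)"]
          by (intro divide_right_mono) (auto simp: power2_diff)
        also have "\<dots> = c * (\<phi> (fst z))\<^sup>2 + c * (\<phi> (snd z))\<^sup>2" by (simp add: c_def add_divide_distrib)
        finally show ?thesis .
      qed
      then show "kern s \<phi> (fst z) (snd z) * indicator (far \<delta>) z
         \<le> ennreal (c * (\<phi> (fst z))\<^sup>2) + ennreal (c * (\<phi> (snd z))\<^sup>2)"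
        using c by (auto simp: kern_def indicator_def ennreal_plus[symmetric] intro!: ennreal_leI simp del: ennreal_plus)
    qed
    also have "\<dots> = (\<integral>\<^sup>+z. ennreal (c * (\<phi> (fst z))\<^sup>2) \<partial>(M \<Otimes>\<^sub>M M)) + (\<integral>\<^sup>+z. ennreal (c * (\<phi> (snd z))\<^sup>2) \<partial>(M \<Otimes>\<^sub>M M))"
      by (rule nn_integral_add) measurable
    also have "(\<integral>\<^sup>+z. ennreal (c * (\<phi> (fst z))\<^sup>2) \<partial>(M \<Otimes>\<^sub>M M)) = ennreal \<mu> * (\<integral>\<^sup>+x. ennreal (c * (\<phi> x)\<^sup>2) \<partial>M)"
      by (subst M.nn_integral_fst[symmetric]) (simp_all add: nn_integral_multc nn_integral_cmult \<mu> mult.commute)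
    also have "(\<integral>\<^sup>+z. ennreal (c * (\<phi> (snd z))\<^sup>2) \<partial>(M \<Otimes>\<^sub>M M)) = ennreal \<mu> * (\<integral>\<^sup>+x. ennreal (c * (\<phi> x)\<^sup>2) \<partial>M)"
      by (subst M.nn_integral_fst[symmetric]) (simp_all add: nn_integral_multc nn_integral_cmult \<mu> mult.commute)
    also have "(\<integral>\<^sup>+x. ennreal (c * (\<phi> x)\<^sup>2) \<partial>M) = ennreal c * (\<integral>\<^sup>+x. ennreal ((\<phi> x)\<^sup>2) \<partial>M)"
      using c by (simp add: ennreal_mult nn_integral_cmult)
    finally have le: "(\<integral>\<^sup>+z. kern s \<phi> (fst z) (snd z) * indicator (far \<delta>) z \<partial>(M \<Otimes>\<^sub>M M))
      \<le> ennreal \<mu> * (ennreal c * (\<integral>\<^sup>+x. ennreal ((\<phi> x)\<^sup>2) \<partial>M)) + ennreal \<mu> * (ennreal c * (\<integral>\<^sup>+x. ennreal ((\<phi> x)\<^sup>2) \<partial>M))" .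
    have "\<mu> * c \<ge> 0" using c by (simp add: \<mu>_def)
    then have "ennreal (\<mu> * c + \<mu> * c) = ennreal (\<mu> * c) + ennreal (\<mu> * c)" by (intro ennreal_plus)
    moreover have "2 * c * \<mu> = \<mu> * c + \<mu> * c" by simp
    ultimately have "ennreal (2 * c * \<mu>) = ennreal \<mu> * ennreal c + ennreal \<mu> * ennreal c"
      using c by (simp only: ennreal_mult measure_nonneg \<mu>_def)
    then show ?thesis using le by (simp only: distrib_right mult.assoc)
  qed
  moreover have "2 * c * \<mu> \<ge> 0" using c by (simp add: \<mu>_def)
  ultimately show ?thesis by blast
qed

text \<open>Let \<delta> be a Lebesgue number of the chart cover. Two points closer than \<delta>
  lie in a common chart ball, where \<open>local_embedding\<close> applies; the other pairs are
  covered by \<open>kern_far\<close>.\<close>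

lemma embedding:
  assumes s: "0 < s" "s < 1"
  shows "\<exists>C\<ge>0. \<forall>\<phi>\<in>S. Hs_semi_sq s \<Omega> \<phi>
     \<le> ennreal C * ((\<integral>\<^sup>+x. ennreal ((\<phi> x)\<^sup>2) \<partial>M) + (\<integral>\<^sup>+x. ennreal ((norm (tgrad \<phi> x))\<^sup>2) \<partial>M))"
proof (cases "emeasure M F = 0")
  case True
  then have "Hs_semi_sq s \<Omega> \<phi> = 0" for \<phi> using s null_integral by (simp add: Hs_semi_sq_def)
  then show ?thesis by (intro exI[of _ 0]) auto
next
  case False
  from chart_cover obtain P r where P: "finite P" "P \<subseteq> F" "F \<subseteq> (\<Union>x\<in>P. ball x (r x))"
    and r: "\<forall>x\<in>P. r x > 0 \<and> has_chart x (r x)" by (elim exE conjE)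
  obtain \<delta> where \<delta>: "\<delta> > 0" "\<And>x. x \<in> F \<Longrightarrow> \<exists>U\<in>(\<lambda>p. ball p (r p)) ` P. ball x \<delta> \<subseteq> U"
    by (rule Heine_Borel_lemma[OF compact_F P(3)]) auto
  from kern_far[OF \<delta>(1) less_imp_le[OF s(1)]] obtain C0 where C0: "C0 \<ge> 0 \<and> (\<forall>\<phi>\<in>borel_measurable M.
    (\<integral>\<^sup>+z. kern s \<phi> (fst z) (snd z) * indicator (far \<delta>) z \<partial>(M \<Otimes>\<^sub>M M))
     \<le> ennreal C0 * (\<integral>\<^sup>+x. ennreal ((\<phi> x)\<^sup>2) \<partial>M))" by (rule exE)
  have "\<forall>p\<in>P. \<exists>C\<ge>0. \<forall>\<phi>\<in>S.
    (\<integral>\<^sup>+x. (\<integral>\<^sup>+y. kern s \<phi> x y * indicator (cball p (r p)) y \<partial>M) * indicator (cball p (r p)) x \<partial>M)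
     \<le> ennreal C * (\<integral>\<^sup>+x. ennreal ((norm (tgrad \<phi> x))\<^sup>2) \<partial>M)"
    using local_embedding[OF _ False s] r by blast
  from bchoice[OF this] obtain C where C: "\<forall>p\<in>P. C p \<ge> 0 \<and> (\<forall>\<phi>\<in>S.
    (\<integral>\<^sup>+x. (\<integral>\<^sup>+y. kern s \<phi> x y * indicator (cball p (r p)) y \<partial>M) * indicator (cball p (r p)) x \<partial>M)
     \<le> ennreal (C p) * (\<integral>\<^sup>+x. ennreal ((norm (tgrad \<phi> x))\<^sup>2) \<partial>M))" by (rule exE)
  define C1 where "C1 = (\<Sum>p\<in>P. C p)"
  have C1: "C1 \<ge> 0" unfolding C1_def using C by (intro sum_nonneg) auto
  have "Hs_semi_sq s \<Omega> \<phi> \<le> ennreal (C0 + C1) * ((\<integral>\<^sup>+x. ennreal ((\<phi> x)\<^sup>2) \<partial>M) + (\<integral>\<^sup>+x. ennreal ((norm (tgrad \<phi> x))\<^sup>2) \<partial>M))"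
    (is "_ \<le> _ * (?N + ?D)") if \<phi>: "\<phi> \<in> S" for \<phi>
  proof -
    note \<phi>m [measurable] = Cinf_measurable[OF \<phi>]
    define K where "K z = kern s \<phi> (fst z) (snd z)" for z
    have K [measurable]: "K \<in> borel_measurable (M \<Otimes>\<^sub>M M)"
      using kern_measurable[OF \<phi>m] unfolding K_def[abs_def] by (simp add: case_prod_beta')
    define I where "I p z = (indicator (cball p (r p)) (snd z) * indicator (cball p (r p)) (fst z) :: ennreal)" for p :: 'a and z :: "'a \<times> 'a"
    have I [measurable]: "I p \<in> borel_measurable (M \<Otimes>\<^sub>M M)" for p
    proof -
      have [measurable]: "(indicator (cball p (r p)) :: 'a \<Rightarrow> ennreal) \<in> borel_measurable M"
        by (intro borel_measurable_M borel_measurable_indicator) simp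
      show ?thesis unfolding I_def[abs_def] by measurable
    qed
    have "Hs_semi_sq s \<Omega> \<phi> = (\<integral>\<^sup>+z. K z \<partial>(M \<Otimes>\<^sub>M M))"
      unfolding K_def by (rule Hs_semi_sq_eq[OF s \<phi>m])
    also have "\<dots> \<le> (\<integral>\<^sup>+z. K z * indicator (far \<delta>) z + (\<Sum>p\<in>P. K z * I p z) \<partial>(M \<Otimes>\<^sub>M M))"
    proof (rule nn_integral_mono)
      fix z assume "z \<in> space (M \<Otimes>\<^sub>M M)"
      then have z: "fst z \<in> F" "snd z \<in> F" by (auto simp: space_pair_measure)
      show "K z \<le> K z * indicator (far \<delta>) z + (\<Sum>p\<in>P. K z * I p z)"
      proof (cases "norm (fst z - snd z) \<ge> \<delta>")
        case False
        from \<delta>(2)[OF z(1)] obtain p where p: "p \<in> P" "ball (fst z) \<delta> \<subseteq> ball p (r p)" by blast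
        have "fst z \<in> ball (fst z) \<delta>" "snd z \<in> ball (fst z) \<delta>" using False \<delta>(1) by (auto simp: dist_norm)
        then have "fst z \<in> cball p (r p)" "snd z \<in> cball p (r p)" using p(2) by (auto simp: subset_eq less_imp_le)
        then have "K z = K z * I p z" by (simp add: I_def)
        also have "\<dots> \<le> (\<Sum>p\<in>P. K z * I p z)" using P(1) p(1) by (intro member_le_sum) auto
        finally show ?thesis by (simp add: add_increasing)
      qed simp
    qed
    also have "\<dots> = (\<integral>\<^sup>+z. K z * indicator (far \<delta>) z \<partial>(M \<Otimes>\<^sub>M M)) + (\<integral>\<^sup>+z. (\<Sum>p\<in>P. K z * I p z) \<partial>(M \<Otimes>\<^sub>M M))"
      by (rule nn_integral_add) measurable
    also have "(\<integral>\<^sup>+z. (\<Sum>p\<in>P. K z * I p z) \<partial>(M \<Otimes>\<^sub>M M)) = (\<Sum>p\<in>P. \<integral>\<^sup>+z. K z * I p z \<partial>(M \<Otimes>\<^sub>M M))"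
      by (rule nn_integral_sum) measurable
    also have "\<dots> \<le> (\<Sum>p\<in>P. ennreal (C p) * ?D)"
    proof (rule sum_mono)
      fix p assume p: "p \<in> P"
      have "(\<integral>\<^sup>+z. K z * I p z \<partial>(M \<Otimes>\<^sub>M M)) = (\<integral>\<^sup>+x. (\<integral>\<^sup>+y. K (x, y) * I p (x, y) \<partial>M) \<partial>M)"
        by (rule M.nn_integral_fst[symmetric]) measurable
      also have "\<dots> = (\<integral>\<^sup>+x. (\<integral>\<^sup>+y. kern s \<phi> x y * indicator (cball p (r p)) y \<partial>M) * indicator (cball p (r p)) x \<partial>M)"
        unfolding K_def I_def fst_conv snd_conv
        by (intro nn_integral_cong) (auto simp: indicator_def)
      also have "\<dots> \<le> ennreal (C p) * ?D" using C p \<phi> by blast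
      finally show "(\<integral>\<^sup>+z. K z * I p z \<partial>(M \<Otimes>\<^sub>M M)) \<le> ennreal (C p) * ?D" .
    qed
    also have "\<dots> = ennreal C1 * ?D"
      unfolding C1_def using C by (simp add: sum_distrib_right[symmetric] sum_ennreal)
    also have "(\<integral>\<^sup>+z. K z * indicator (far \<delta>) z \<partial>(M \<Otimes>\<^sub>M M)) \<le> ennreal C0 * ?N"
      unfolding K_def using C0 \<phi>m by blast
    finally have "Hs_semi_sq s \<Omega> \<phi> \<le> ennreal C0 * ?N + ennreal C1 * ?D" by (simp add: add_right_mono)
    also have "\<dots> \<le> ennreal (C0 + C1) * ?N + ennreal (C0 + C1) * ?D"
      using C0 C1 by (intro add_mono mult_right_mono ennreal_leI) auto
    finally show ?thesis by (simp add: distrib_left)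
  qed
  then show ?thesis using C0 C1 by (intro exI[of _ "C0 + C1"]) auto
qed

text \<open>The kernels of orders \<open>s1\<close> and \<open>s\<close> have quotient
  \<open>norm (x - y) powr (2 * (s - s1))\<close>, which is at most \<eta> for points closer than
  \<delta>; this determines \<delta>. The remaining pairs are controlled by the L^2 norm.\<close>

lemma interpolation:
  assumes s: "0 < s1" "s1 < s" "s < 1" and \<eta>: "\<eta> > 0"
  shows "\<exists>C\<ge>0. \<forall>\<phi>\<in>borel_measurable M. Hs_semi_sq s1 \<Omega> \<phi>
     \<le> ennreal \<eta> * Hs_semi_sq s \<Omega> \<phi> + ennreal C * (\<integral>\<^sup>+x. ennreal ((\<phi> x)\<^sup>2) \<partial>M)"
proof -
  define \<delta> where "\<delta> = \<eta> powr (1 / (2 * (s - s1)))"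
  have \<delta>: "\<delta> > 0" "\<delta> powr (2 * (s - s1)) = \<eta>" using \<eta> s by (auto simp: \<delta>_def powr_powr)
  from kern_far[OF \<delta>(1) less_imp_le[OF s(1)]] obtain C0 where C0: "C0 \<ge> 0 \<and> (\<forall>\<phi>\<in>borel_measurable M.
    (\<integral>\<^sup>+z. kern s1 \<phi> (fst z) (snd z) * indicator (far \<delta>) z \<partial>(M \<Otimes>\<^sub>M M))
     \<le> ennreal C0 * (\<integral>\<^sup>+x. ennreal ((\<phi> x)\<^sup>2) \<partial>M))" by (rule exE)
  have "Hs_semi_sq s1 \<Omega> \<phi> \<le> ennreal \<eta> * Hs_semi_sq s \<Omega> \<phi> + ennreal C0 * (\<integral>\<^sup>+x. ennreal ((\<phi> x)\<^sup>2) \<partial>M)"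
    if \<phi> [measurable]: "\<phi> \<in> borel_measurable M" for \<phi>
  proof -
    have K [measurable]: "(\<lambda>z. kern s \<phi> (fst z) (snd z)) \<in> borel_measurable (M \<Otimes>\<^sub>M M)" for s
      using kern_measurable[OF \<phi>] by (simp add: case_prod_beta')
    have "Hs_semi_sq s1 \<Omega> \<phi> = (\<integral>\<^sup>+z. kern s1 \<phi> (fst z) (snd z) \<partial>(M \<Otimes>\<^sub>M M))"
      using s by (intro Hs_semi_sq_eq \<phi>) auto
    also have "\<dots> \<le> (\<integral>\<^sup>+z. ennreal \<eta> * kern s \<phi> (fst z) (snd z)
        + kern s1 \<phi> (fst z) (snd z) * indicator (far \<delta>) z \<partial>(M \<Otimes>\<^sub>M M))"
    proof (rule nn_integral_mono)
      fix z :: "'a \<times> 'a"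
      let ?n = "norm (fst z - snd z)" and ?m = "real (DIM('a) - 1)"
      show "kern s1 \<phi> (fst z) (snd z) \<le> ennreal \<eta> * kern s \<phi> (fst z) (snd z)
        + kern s1 \<phi> (fst z) (snd z) * indicator (far \<delta>) z"
      proof (cases "?n \<ge> \<delta> \<or> ?n = 0")
        case False
        then have n: "0 < ?n" "?n < \<delta>" by auto
        have "?n powr (2 * (s - s1)) \<le> \<eta>" unfolding \<delta>(2)[symmetric] using n s by (intro powr_mono2) auto
        moreover have "1 / ?n powr (?m + 2 * s1) = ?n powr (2 * (s - s1)) / ?n powr (?m + 2 * s)"
          using n by (simp add: powr_diff[symmetric] powr_minus_divide[symmetric] algebra_simps)
        ultimately have "1 / ?n powr (?m + 2 * s1) \<le> \<eta> / ?n powr (?m + 2 * s)"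
          by (simp add: divide_right_mono)
        from mult_left_mono[OF this, of "(\<phi> (fst z) - \<phi> (snd z))\<^sup>2"]
        have "(\<phi> (fst z) - \<phi> (snd z))\<^sup>2 / ?n powr (?m + 2 * s1) \<le> \<eta> * ((\<phi> (fst z) - \<phi> (snd z))\<^sup>2 / ?n powr (?m + 2 * s))"
          by (simp add: mult.commute)
        then have "kern s1 \<phi> (fst z) (snd z) \<le> ennreal \<eta> * kern s \<phi> (fst z) (snd z)"
          using \<eta> unfolding kern_def by (subst ennreal_mult[symmetric]) (auto intro!: ennreal_leI)
        then show ?thesis by (rule order_trans) simp
      qed (auto simp: kern_def)
    qed
    also have "\<dots> = (\<integral>\<^sup>+z. ennreal \<eta> * kern s \<phi> (fst z) (snd z) \<partial>(M \<Otimes>\<^sub>M M))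
        + (\<integral>\<^sup>+z. kern s1 \<phi> (fst z) (snd z) * indicator (far \<delta>) z \<partial>(M \<Otimes>\<^sub>M M))"
      by (rule nn_integral_add) measurable
    also have "(\<integral>\<^sup>+z. ennreal \<eta> * kern s \<phi> (fst z) (snd z) \<partial>(M \<Otimes>\<^sub>M M)) = ennreal \<eta> * Hs_semi_sq s \<Omega> \<phi>"
      using s by (subst Hs_semi_sq_eq[OF _ _ \<phi>]) (auto intro!: nn_integral_cmult K)
    finally show ?thesis using C0 \<phi> by (meson add_left_mono order_trans)
  qed
  then show ?thesis using C0 by blast
qed

end

section \<open>Control of the L^2 norm by H^s and finitely many averages\<close>

context regular_domain
begin

lemma Cinf_bounded: "f \<in> S \<Longrightarrow> \<exists>b. \<forall>x\<in>F. \<bar>f x\<bar> \<le> b"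
proof -
  assume "f \<in> S"
  then have "bounded (f ` F)"
    by (intro compact_imp_bounded compact_continuous_image Cinf_continuous compact_F)
  then obtain b where "\<forall>y\<in>f ` F. norm y \<le> b" by (auto simp: bounded_iff)
  then show ?thesis by auto
qed

lemma bounded_integrable:
  fixes f :: "'a \<Rightarrow> real"
  assumes "f \<in> borel_measurable M" "\<forall>x\<in>F. \<bar>f x\<bar> \<le> b"
  shows "integrable M f"
  by (rule M.integrable_const_bound[of _ b]) (use assms in \<open>auto intro!: AE_I2\<close>)

lemma Cinf_sq_integrable: "f \<in> S \<Longrightarrow> g \<in> S \<Longrightarrow> integrable M (\<lambda>x. f x * g x)"
proof -
  assume f: "f \<in> S" and g: "g \<in> S"
  obtain a b where ab: "\<forall>x\<in>F. \<bar>f x\<bar> \<le> a" "\<forall>x\<in>F. \<bar>g x\<bar> \<le> b" using Cinf_bounded f g by meson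
  show ?thesis
  proof (rule bounded_integrable[of _ "a * b"])
    show "(\<lambda>x. f x * g x) \<in> borel_measurable M" using f g by measurable
    show "\<forall>x\<in>F. \<bar>f x * g x\<bar> \<le> a * b" using ab by (auto simp: abs_mult intro!: mult_mono)
  qed
qed

text \<open>The square of the L^2 norm as a real number; it agrees with the extended integral on
  smooth functions, where it is finite.\<close>

definition L2 :: "('a \<Rightarrow> real) \<Rightarrow> real" where
  "L2 f = (\<integral>x. (f x)\<^sup>2 \<partial>M)"

lemma L2_nonneg: "L2 f \<ge> 0" by (simp add: L2_def)

lemma nn_L2: "f \<in> S \<Longrightarrow> (\<integral>\<^sup>+x. ennreal ((f x)\<^sup>2) \<partial>M) = ennreal (L2 f)"
  unfolding L2_def using Cinf_sq_integrable[of f f]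
  by (subst nn_integral_eq_integral) (auto simp: power2_eq_square)

text \<open>With \<open>a\<close> the mean of \<phi> over \<open>B\<close>, the integral of
  \<open>(c - \<phi>)\<^sup>2\<close> over \<open>B\<close> is
  \<open>(c - a)\<^sup>2 * measure M B\<close> plus the integral of
  \<open>(a - \<phi>)\<^sup>2\<close>.\<close>

lemma mean_deviation:
  assumes \<phi>: "\<phi> \<in> S" and B: "B \<in> sets M" "measure M B > 0"
  defines "a \<equiv> (\<integral>x. \<phi> x * indicator B x \<partial>M) / measure M B"
  shows "ennreal ((c - a)\<^sup>2 * measure M B) \<le> (\<integral>\<^sup>+y. ennreal ((c - \<phi> y)\<^sup>2) * indicator B y \<partial>M)"
proof -
  define b where "b = measure M B"
  note [measurable] = Cinf_measurable[OF \<phi>] B(1)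
  obtain K where K: "\<forall>x\<in>F. \<bar>\<phi> x\<bar> \<le> K" using Cinf_bounded[OF \<phi>] by blast
  have i1: "integrable M (\<lambda>x. \<phi> x * indicator B x)"
  proof (rule bounded_integrable[of _ K])
    show "\<forall>x\<in>F. \<bar>\<phi> x * indicator B x\<bar> \<le> K" using K by (auto simp: indicator_def)
  qed measurable
  have i2: "integrable M (\<lambda>x. (\<phi> x)\<^sup>2 * indicator B x)"
  proof (rule bounded_integrable[of _ "K\<^sup>2"])
    have "(\<phi> x)\<^sup>2 \<le> K\<^sup>2" if "x \<in> F" for x using K that by (metis abs_ge_zero power2_abs power_mono)
    then show "\<forall>x\<in>F. \<bar>(\<phi> x)\<^sup>2 * indicator B x\<bar> \<le> K\<^sup>2" by (auto simp: indicator_def)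
  qed measurable
  have i3: "integrable M (\<lambda>x. indicator B x :: real)"
    by (rule bounded_integrable[of _ 1]) (auto simp: indicator_def)
  have ab: "(\<integral>x. \<phi> x * indicator B x \<partial>M) = a * b" using B(2) by (simp add: a_def b_def)
  have bI: "(\<integral>x. indicator B x \<partial>M) = b" using B(1) sets.sets_into_space[OF B(1)] by (simp add: b_def Int_absorb2)
  have BF: "measure M (B \<inter> F) = b" using sets.sets_into_space[OF B(1)] by (simp add: b_def Int_absorb2)
  have e1: "(c - \<phi> x)\<^sup>2 * indicator B x = c\<^sup>2 * indicator B x - 2 * c * (\<phi> x * indicator B x) + (\<phi> x)\<^sup>2 * indicator B x" for x
    by (simp add: power2_diff algebra_simps)
  have e2: "(a - \<phi> x)\<^sup>2 * indicator B x = a\<^sup>2 * indicator B x - 2 * a * (\<phi> x * indicator B x) + (\<phi> x)\<^sup>2 * indicator B x" for x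
    by (simp add: power2_diff algebra_simps)
  have I1: "integrable M (\<lambda>x. (c - \<phi> x)\<^sup>2 * indicator B x)" unfolding e1 using i1 i2 i3 by simp
  have v1: "(\<integral>x. (c - \<phi> x)\<^sup>2 * indicator B x \<partial>M) = c\<^sup>2 * b - 2 * c * (a * b) + (\<integral>x. (\<phi> x)\<^sup>2 * indicator B x \<partial>M)"
    unfolding e1 using i1 i2 i3 by (simp add: ab bI BF)
  have v2: "(\<integral>x. (a - \<phi> x)\<^sup>2 * indicator B x \<partial>M) = a\<^sup>2 * b - 2 * a * (a * b) + (\<integral>x. (\<phi> x)\<^sup>2 * indicator B x \<partial>M)"
    unfolding e2 using i1 i2 i3 by (simp add: ab bI BF)
  have "(\<integral>x. (a - \<phi> x)\<^sup>2 * indicator B x \<partial>M) \<ge> 0" by (rule Bochner_Integration.integral_nonneg) simp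
  then have "(c - a)\<^sup>2 * b \<le> (\<integral>x. (c - \<phi> x)\<^sup>2 * indicator B x \<partial>M)"
    unfolding v1 v2 by (simp add: power2_eq_square algebra_simps)
  then have "ennreal ((c - a)\<^sup>2 * b) \<le> ennreal (\<integral>x. (c - \<phi> x)\<^sup>2 * indicator B x \<partial>M)" by (rule ennreal_leI)
  also have "\<dots> = (\<integral>\<^sup>+x. ennreal ((c - \<phi> x)\<^sup>2 * indicator B x) \<partial>M)"
    by (rule nn_integral_eq_integral[symmetric]) (use I1 in auto)
  also have "\<dots> = (\<integral>\<^sup>+y. ennreal ((c - \<phi> y)\<^sup>2) * indicator B y \<partial>M)"
    by (intro nn_integral_cong) (auto simp: indicator_def)
  finally show ?thesis by (simp add: b_def)
qed

text \<open>A quantitative form of compactness: up to finitely many averages, the L^2 norm is an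
  arbitrarily small multiple of the semi-norm. Cover the boundary by balls of radius \<delta>. The
  squared deviation of \<open>\<phi> x\<close> from the mean over the ball containing
  \<open>x\<close> is at most \<open>(2 * \<delta>) powr p / b\<close> times the inner Gagliardo
  integral. The measure bound \<open>b\<close> is of order \<delta>^(d-1), so the factor is of order
  \<delta>^(2s).\<close>

lemma friedrichs:
  assumes s: "0 < s" "s < 1" and \<eta>: "\<eta> > 0"
  shows "\<exists>\<B> K. finite \<B> \<and> K \<ge> 0 \<and> \<B> \<subseteq> sets M \<and> (\<forall>\<phi>\<in>S. ennreal (L2 \<phi>)
     \<le> ennreal \<eta> * Hs_semi_sq s \<Omega> \<phi> + ennreal (K * (\<Sum>B\<in>\<B>. (\<integral>x. \<phi> x * indicator B x \<partial>M)\<^sup>2)))"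
proof (cases "emeasure M F = 0")
  case True
  then have "ennreal (L2 \<phi>) = 0" if "\<phi> \<in> S" for \<phi> using nn_L2[OF that] null_integral by simp
  then show ?thesis by (intro exI[of _ "{}"] exI[of _ 0]) auto
next
  case False
  let ?m = "DIM('a) - 1"
  from ahlfors_global[OF False] obtain c t0 where c: "c > 0" "t0 > 0"
    "\<forall>x\<in>F. \<forall>t. 0 < t \<longrightarrow> t \<le> t0 \<longrightarrow> ennreal (c * t ^ ?m) \<le> emeasure M (F \<inter> ball x t)" by blast
  define p where "p = real ?m + 2 * s"
  \<comment> \<open>\<open>2 * (2 * \<delta>) powr p / b\<close> equals
    \<open>2 * 2 powr p * \<delta> powr (2 * s) / c\<close>, so it is at most \<eta> as soon as
    \<open>\<delta> powr (2 * s) \<le> q\<close>.\<close>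
  define q where "q = \<eta> * c / (2 * 2 powr p)"
  have q: "q > 0" using \<eta> c by (simp add: q_def)
  define \<delta> where "\<delta> = min t0 (q powr (1 / (2 * s)))"
  have \<delta>: "\<delta> > 0" "\<delta> \<le> t0" using c q by (auto simp: \<delta>_def)
  have "\<delta> powr (2 * s) \<le> (q powr (1 / (2 * s))) powr (2 * s)"
    using s \<delta>(1) by (intro powr_mono2) (auto simp: \<delta>_def)
  then have \<delta>q: "\<delta> powr (2 * s) \<le> q" using s q by (simp add: powr_powr)
  define b where "b = c * \<delta> ^ ?m"
  have b: "b > 0" using c \<delta> by (simp add: b_def)
  have key: "2 * (2 * \<delta>) powr p / b \<le> \<eta>"
  proof -
    have "(2 * \<delta>) powr p = 2 powr p * \<delta> powr p" using \<delta> by (simp add: powr_mult)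
    also have "\<delta> powr p = \<delta> powr real ?m * \<delta> powr (2 * s)" unfolding p_def by (rule powr_add)
    also have "\<delta> powr real ?m = \<delta> ^ ?m" by (rule powr_realpow[OF \<delta>(1)])
    finally have "2 * (2 * \<delta>) powr p / b = 2 * 2 powr p * \<delta> powr (2 * s) / c"
      using \<delta> by (simp add: b_def)
    also have "\<dots> \<le> 2 * 2 powr p * q / c" using \<delta>q c by (intro divide_right_mono mult_left_mono) auto
    also have "\<dots> = \<eta>" using c by (simp add: q_def)
    finally show ?thesis .
  qed
  have cov: "F \<subseteq> (\<Union>x\<in>F. ball x \<delta>)" using \<delta> by auto
  obtain P where P: "P \<subseteq> F" "finite P" "F \<subseteq> (\<Union>x\<in>P. ball x \<delta>)"
    by (rule compactE_image[OF compact_F open_ball cov])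
  define \<B> where "\<B> = (\<lambda>x. F \<inter> ball x \<delta>) ` P"
  have \<B>: "finite \<B>" "\<B> \<subseteq> sets M" using P(2) by (auto simp: \<B>_def sets_M)
  have mB: "b \<le> measure M B" if BB: "B \<in> \<B>" for B
  proof -
    obtain x where x: "x \<in> P" "B = F \<inter> ball x \<delta>" using BB by (auto simp: \<B>_def)
    have "ennreal b \<le> emeasure M B" unfolding b_def x(2) using c(3) x(1) P(1) \<delta> by blast
    then show ?thesis by (simp add: M.emeasure_eq_measure)
  qed
  define K where "K = 2 * measure M F / b\<^sup>2"
  have "ennreal (L2 \<phi>) \<le> ennreal \<eta> * Hs_semi_sq s \<Omega> \<phi> + ennreal (K * (\<Sum>B\<in>\<B>. (\<integral>x. \<phi> x * indicator B x \<partial>M)\<^sup>2))"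
    if \<phi>: "\<phi> \<in> S" for \<phi>
  proof -
    define T where "T = (\<Sum>B\<in>\<B>. (\<integral>x. \<phi> x * indicator B x \<partial>M)\<^sup>2)"
    have T: "T \<ge> 0" unfolding T_def by (intro sum_nonneg) simp
    define k where "k x = (\<integral>\<^sup>+y. kern s \<phi> x y \<partial>M)" for x
    have kxm: "(\<lambda>y. kern s \<phi> x y) \<in> borel_measurable M" for x
      using Cinf_measurable[OF \<phi>] unfolding kern_def by measurable
    have km: "k \<in> borel_measurable M"
      unfolding k_def[abs_def] using kern_measurable[OF Cinf_measurable[OF \<phi>]] by (rule M.borel_measurable_nn_integral)
    have point: "ennreal ((\<phi> x)\<^sup>2) \<le> ennreal \<eta> * k x + ennreal (2 * T / b\<^sup>2)" if x: "x \<in> F" for x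
    proof -
      obtain z where z: "z \<in> P" "x \<in> ball z \<delta>" using P(3) x by blast
      define B where "B = F \<inter> ball z \<delta>"
      have B: "B \<in> \<B>" "B \<in> sets M" "x \<in> B" using z x \<B>(2) by (auto simp: B_def \<B>_def)
      define I where "I = (\<integral>x. \<phi> x * indicator B x \<partial>M)"
      define a where "a = I / measure M B"
      have mpos: "measure M B > 0" using mB[OF B(1)] b by linarith
      have a2: "a\<^sup>2 \<le> T / b\<^sup>2"
      proof -
        have "a\<^sup>2 = I\<^sup>2 / (measure M B)\<^sup>2" by (simp add: a_def power_divide)
        also have "\<dots> \<le> I\<^sup>2 / b\<^sup>2" using mB[OF B(1)] b mpos
          by (intro divide_left_mono power_mono mult_pos_pos) auto
        also have "I\<^sup>2 \<le> T" unfolding T_def I_def using \<B>(1) B(1) by (intro member_le_sum) auto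
        then have "I\<^sup>2 / b\<^sup>2 \<le> T / b\<^sup>2" by (rule divide_right_mono) simp
        finally show ?thesis .
      qed
      have dev: "ennreal ((\<phi> x - a)\<^sup>2 * measure M B) \<le> ennreal ((2 * \<delta>) powr p) * k x"
      proof -
        have "ennreal ((\<phi> x - a)\<^sup>2 * measure M B) \<le> (\<integral>\<^sup>+y. ennreal ((\<phi> x - \<phi> y)\<^sup>2) * indicator B y \<partial>M)"
          unfolding a_def I_def by (rule mean_deviation[OF \<phi> B(2) mpos])
        also have "\<dots> \<le> (\<integral>\<^sup>+y. ennreal ((2 * \<delta>) powr p) * kern s \<phi> x y \<partial>M)"
        proof (rule nn_integral_mono)
          fix y
          show "ennreal ((\<phi> x - \<phi> y)\<^sup>2) * indicator B y \<le> ennreal ((2 * \<delta>) powr p) * kern s \<phi> x y"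
          proof (cases "y \<in> B \<and> x \<noteq> y")
            case True
            then have n: "0 < norm (x - y)" by simp
            have "dist x y < 2 * \<delta>" using True B(3) dist_triangle_half_r[of z x "2 * \<delta>" y] by (simp add: B_def)
            then have "norm (x - y) powr p \<le> (2 * \<delta>) powr p"
              using n s by (intro powr_mono2) (auto simp: p_def dist_norm)
            then have "(\<phi> x - \<phi> y)\<^sup>2 * norm (x - y) powr p \<le> (\<phi> x - \<phi> y)\<^sup>2 * (2 * \<delta>) powr p"
              by (rule mult_left_mono) simp
            then have "(\<phi> x - \<phi> y)\<^sup>2 \<le> (2 * \<delta>) powr p * ((\<phi> x - \<phi> y)\<^sup>2 / norm (x - y) powr p)"
              using n by (simp add: pos_le_divide_eq mult.commute)
            then show ?thesis using True unfolding kern_def p_def[symmetric]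
              by (simp add: ennreal_mult[symmetric] ennreal_leI)
          qed (auto simp: indicator_def)
        qed
        also have "\<dots> = ennreal ((2 * \<delta>) powr p) * k x" unfolding k_def by (rule nn_integral_cmult[OF kxm])
        finally show ?thesis .
      qed
      have "2 * (\<phi> x - a)\<^sup>2 \<le> (2 / b) * ((\<phi> x - a)\<^sup>2 * measure M B)"
        using mult_left_mono[OF mB[OF B(1)], of "(\<phi> x - a)\<^sup>2"] b by (simp add: field_simps)
      then have "ennreal (2 * (\<phi> x - a)\<^sup>2) \<le> ennreal (2 / b) * ennreal ((\<phi> x - a)\<^sup>2 * measure M B)"
        using b by (subst ennreal_mult[symmetric]) (auto intro!: ennreal_leI)
      also have "\<dots> \<le> ennreal (2 / b) * (ennreal ((2 * \<delta>) powr p) * k x)" using dev by (rule mult_left_mono) simp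
      also have "\<dots> = ennreal (2 * (2 * \<delta>) powr p / b) * k x"
        using b by (simp add: mult.assoc[symmetric] ennreal_mult[symmetric])
      also have "\<dots> \<le> ennreal \<eta> * k x" using key by (intro mult_right_mono ennreal_leI) auto
      finally have dev2: "ennreal (2 * (\<phi> x - a)\<^sup>2) \<le> ennreal \<eta> * k x" .
      have "(\<phi> x)\<^sup>2 \<le> 2 * (\<phi> x - a)\<^sup>2 + 2 * a\<^sup>2"
        using zero_le_power2[of "\<phi> x - 2 * a"] by (simp add: power2_eq_square algebra_simps)
      also have "\<dots> \<le> 2 * (\<phi> x - a)\<^sup>2 + 2 * T / b\<^sup>2" using a2 by simp
      finally have "ennreal ((\<phi> x)\<^sup>2) \<le> ennreal (2 * (\<phi> x - a)\<^sup>2 + 2 * T / b\<^sup>2)" by (rule ennreal_leI)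
      also have "\<dots> = ennreal (2 * (\<phi> x - a)\<^sup>2) + ennreal (2 * T / b\<^sup>2)" using T by (intro ennreal_plus) auto
      also have "\<dots> \<le> ennreal \<eta> * k x + ennreal (2 * T / b\<^sup>2)" using dev2 by (rule add_right_mono)
      finally show ?thesis .
    qed
    have "ennreal (L2 \<phi>) = (\<integral>\<^sup>+x. ennreal ((\<phi> x)\<^sup>2) \<partial>M)" by (simp add: nn_L2[OF \<phi>])
    also have "\<dots> \<le> (\<integral>\<^sup>+x. ennreal \<eta> * k x + ennreal (2 * T / b\<^sup>2) \<partial>M)"
      using point by (intro nn_integral_mono) auto
    also have "\<dots> = ennreal \<eta> * (\<integral>\<^sup>+x. k x \<partial>M) + ennreal (2 * T / b\<^sup>2) * emeasure M F"
      using km by (subst nn_integral_add) (auto simp: nn_integral_cmult)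
    also have "(\<integral>\<^sup>+x. k x \<partial>M) = Hs_semi_sq s \<Omega> \<phi>" using s by (simp add: k_def Hs_semi_sq_def kern_def)
    also have "ennreal (2 * T / b\<^sup>2) * emeasure M F = ennreal (K * T)"
      using T by (simp add: M.emeasure_eq_measure ennreal_mult[symmetric] K_def mult_ac)
    finally show ?thesis by (simp add: T_def)
  qed
  moreover have "K \<ge> 0" by (simp add: K_def)
  ultimately show ?thesis using \<B> by (intro exI[of _ \<B>] exI[of _ K]) auto
qed

end

section \<open>The spaces \<open>H\<^sup>s\<close>, \<open>0 < s \<le> 1\<close>\<close>

lemma norm_add_sq_le: "(norm (a + b))\<^sup>2 \<le> 2 * (norm a)\<^sup>2 + 2 * (norm b :: real)\<^sup>2"
proof -
  have "(norm (a + b))\<^sup>2 \<le> (norm a + norm b)\<^sup>2" by (intro power_mono norm_triangle_ineq) simp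
  also have "\<dots> \<le> 2 * (norm a)\<^sup>2 + 2 * (norm b)\<^sup>2"
    using sum_squares_bound[of "norm a" "norm b"] by (simp add: power2_sum)
  finally show ?thesis .
qed

text \<open>The squared norm, with values in \<open>ennreal\<close> and for vector-valued functions,
  as it is applied to functions and gradients alike.\<close>

definition nL2 :: "'b measure \<Rightarrow> ('b \<Rightarrow> 'c::real_normed_vector) \<Rightarrow> ennreal" where
  "nL2 N f = (\<integral>\<^sup>+x. ennreal ((norm (f x))\<^sup>2) \<partial>N)"

lemma nL2_real: "nL2 N f = (\<integral>\<^sup>+x. ennreal ((f x)\<^sup>2) \<partial>N)" for f :: "'b \<Rightarrow> real"
  by (simp add: nL2_def)

lemma nL2_minus: "nL2 N (\<lambda>x. f x - g x) = nL2 N (\<lambda>x. g x - f x)"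
  by (simp add: nL2_def norm_minus_commute)

lemma nL2_add:
  fixes f g :: "'b \<Rightarrow> 'c::{real_normed_vector, second_countable_topology}"
  assumes [measurable]: "f \<in> borel_measurable N" "g \<in> borel_measurable N"
  shows "nL2 N (\<lambda>x. f x + g x) \<le> 2 * nL2 N f + 2 * nL2 N g"
proof -
  have "nL2 N (\<lambda>x. f x + g x) \<le> (\<integral>\<^sup>+x. 2 * ennreal ((norm (f x))\<^sup>2) + 2 * ennreal ((norm (g x))\<^sup>2) \<partial>N)"
    unfolding nL2_def
  proof (rule nn_integral_mono)
    fix x
    have "ennreal ((norm (f x + g x))\<^sup>2) \<le> ennreal (2 * (norm (f x))\<^sup>2 + 2 * (norm (g x))\<^sup>2)"
      by (intro ennreal_leI norm_add_sq_le)
    also have "\<dots> = 2 * ennreal ((norm (f x))\<^sup>2) + 2 * ennreal ((norm (g x))\<^sup>2)"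
      by (simp add: ennreal_mult)
    finally show "ennreal ((norm (f x + g x))\<^sup>2) \<le> 2 * ennreal ((norm (f x))\<^sup>2) + 2 * ennreal ((norm (g x))\<^sup>2)" .
  qed
  also have "\<dots> = 2 * nL2 N f + 2 * nL2 N g"
    unfolding nL2_def by (subst nn_integral_add) (auto simp: nn_integral_cmult)
  finally show ?thesis .
qed

lemma nL2_diff:
  fixes f g :: "'b \<Rightarrow> 'c::{real_normed_vector, second_countable_topology}"
  assumes "f \<in> borel_measurable N" "g \<in> borel_measurable N"
  shows "nL2 N (\<lambda>x. f x - g x) \<le> 2 * nL2 N f + 2 * nL2 N g"
  using nL2_add[of f N "\<lambda>x. - g x"] assms by (simp add: nL2_def)

lemma tendsto_0_ennrealI:
  fixes f :: "nat \<Rightarrow> ennreal"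
  assumes "\<And>\<epsilon>. \<epsilon> > 0 \<Longrightarrow> \<exists>n0. \<forall>n\<ge>n0. f n \<le> ennreal \<epsilon>"
  shows "f \<longlonglongrightarrow> 0"
proof (rule order_tendstoI)
  fix a :: ennreal assume "a > 0"
  then obtain b where b: "0 < b" "b < a" using dense by blast
  define \<epsilon> where "\<epsilon> = enn2real b"
  have "ennreal \<epsilon> = b" unfolding \<epsilon>_def
    by (rule ennreal_enn2real) (rule less_le_trans[OF b(2) top_greatest])
  then have \<epsilon>: "\<epsilon> > 0" "ennreal \<epsilon> < a" using b by auto
  from assms[OF \<epsilon>(1)] obtain n0 where "\<forall>n\<ge>n0. f n \<le> ennreal \<epsilon>" by blast
  then have "\<forall>n\<ge>n0. f n < a" using \<epsilon>(2) le_less_trans by blast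
  then show "\<forall>\<^sub>F n in sequentially. f n < a" by (auto simp: eventually_sequentially)
qed simp

text \<open>On a finite measure space an L^2-Cauchy sequence is L^1-Cauchy and so has an almost
  everywhere convergent subsequence. Fatou's lemma along it shows that the full sequence converges
  in L^2.\<close>

lemma (in finite_measure) nL2_complete:
  fixes u :: "nat \<Rightarrow> 'a \<Rightarrow> 'c::euclidean_space"
  assumes u [measurable]: "\<And>n. u n \<in> borel_measurable M" and fin: "\<And>n. nL2 M (u n) < \<infinity>"
    and cauchy: "\<And>\<epsilon>. \<epsilon> > 0 \<Longrightarrow> \<exists>n0. \<forall>m\<ge>n0. \<forall>n\<ge>n0. nL2 M (\<lambda>x. u m x - u n x) \<le> ennreal \<epsilon>"
  shows "\<exists>v r. v \<in> borel_measurable M \<and> strict_mono r \<and> (AE x in M. (\<lambda>i. u (r i) x) \<longlonglongrightarrow> v x) \<and>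
    (\<lambda>n. nL2 M (\<lambda>x. u n x - v x)) \<longlonglongrightarrow> 0"
proof -
  define \<mu> where "\<mu> = measure M (space M)"
  have \<mu>: "emeasure M (space M) = ennreal \<mu>" "\<mu> \<ge> 0" by (simp_all add: \<mu>_def emeasure_eq_measure)
  \<comment> \<open>Pointwise \<open>norm (f x) \<le> t + (norm (f x))\<^sup>2 / t\<close>. A small
    \<open>t\<close> makes the first term small; then the L^2 term is small far out in the
    sequence.\<close>
  have L1: "(\<integral>\<^sup>+x. ennreal (norm (f x)) \<partial>M) \<le> ennreal (t * \<mu>) + ennreal (1 / t) * nL2 M f"
    if t: "t > 0" and f [measurable]: "f \<in> borel_measurable M" for t and f :: "'a \<Rightarrow> 'c"
  proof -
    have "(\<integral>\<^sup>+x. ennreal (norm (f x)) \<partial>M) \<le> (\<integral>\<^sup>+x. ennreal t + ennreal (1 / t) * ennreal ((norm (f x))\<^sup>2) \<partial>M)"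
    proof (rule nn_integral_mono)
      fix x
      have "norm (f x) \<le> t + 1 / t * (norm (f x))\<^sup>2"
      proof (cases "norm (f x) \<le> t")
        case False
        then have "norm (f x) * t \<le> norm (f x) * norm (f x)" by (intro mult_left_mono) auto
        then have "norm (f x) \<le> 1 / t * (norm (f x))\<^sup>2" using t by (simp add: field_simps power2_eq_square)
        then show ?thesis using t by linarith
      qed (use t in \<open>simp add: add_increasing2\<close>)
      then show "ennreal (norm (f x)) \<le> ennreal t + ennreal (1 / t) * ennreal ((norm (f x))\<^sup>2)"
        using t by (simp add: ennreal_mult[symmetric] ennreal_plus[symmetric] ennreal_leI del: ennreal_plus)
    qed
    also have "\<dots> = ennreal t * emeasure M (space M) + ennreal (1 / t) * nL2 M f"
      unfolding nL2_def by (subst nn_integral_add) (auto simp: nn_integral_cmult)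
    finally show ?thesis using t \<mu> by (simp add: ennreal_mult)
  qed
  have int: "integrable M (u n)" for n
  proof (rule integrableI_bounded)
    have "ennreal (1 * \<mu>) + ennreal (1 / 1) * nL2 M (u n) < \<infinity>" using fin[of n] by simp
    with L1[of 1 "u n"] show "(\<integral>\<^sup>+x. ennreal (norm (u n x)) \<partial>M) < \<infinity>"
      using u by (simp add: le_less_trans)
  qed (rule u)
  have L1c: "\<exists>N. \<forall>i\<ge>N. \<forall>j\<ge>N. (LINT x|M. norm (u i x - u j x)) < e" if e: "e > 0" for e :: real
  proof -
    \<comment> \<open>Ensures \<open>t * \<mu> \<le> e / 4\<close>; the summand \<open>1\<close>
      covers measure zero.\<close>
    define t where "t = e / (4 * (\<mu> + 1))"
    have t: "t > 0" using e \<mu> by (simp add: t_def)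
    have t\<mu>: "t * \<mu> \<le> e / 4"
      using e \<mu> mult_left_mono[of \<mu> "\<mu> + 1" "e / 4"] by (simp add: t_def divide_simps)
    from cauchy[of "t * e / 4"] obtain n0 where n0: "\<forall>m\<ge>n0. \<forall>n\<ge>n0. nL2 M (\<lambda>x. u m x - u n x) \<le> ennreal (t * e / 4)"
      using t e by auto
    have "(LINT x|M. norm (u i x - u j x)) < e" if ij: "i \<ge> n0" "j \<ge> n0" for i j
    proof -
      have "ennreal (LINT x|M. norm (u i x - u j x)) = (\<integral>\<^sup>+x. ennreal (norm (u i x - u j x)) \<partial>M)"
        using int by (intro nn_integral_eq_integral[symmetric]) auto
      also have "\<dots> \<le> ennreal (t * \<mu>) + ennreal (1 / t) * nL2 M (\<lambda>x. u i x - u j x)"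
        using t by (intro L1) auto
      also have "\<dots> \<le> ennreal (t * \<mu>) + ennreal (1 / t) * ennreal (t * e / 4)"
        using n0 ij by (intro add_left_mono mult_left_mono) auto
      also have "\<dots> = ennreal (t * \<mu> + e / 4)"
        using t e \<mu> by (simp add: ennreal_mult[symmetric] ennreal_plus[symmetric] del: ennreal_plus)
      finally have "(LINT x|M. norm (u i x - u j x)) \<le> t * \<mu> + e / 4"
        using t e \<mu> by (subst (asm) ennreal_le_iff) auto
      then show ?thesis using t\<mu> e by linarith
    qed
    then show ?thesis by blast
  qed
  obtain r where r: "strict_mono r" "AE x in M. Cauchy (\<lambda>i. u (r i) x)"
    using cauchy_L1_AE_cauchy_subseq[OF int L1c] by blast
  define v where "v x = lim (\<lambda>i. u (r i) x)" for x
  have v [measurable]: "v \<in> borel_measurable M" unfolding v_def[abs_def] by measurable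
  have ae: "AE x in M. (\<lambda>i. u (r i) x) \<longlonglongrightarrow> v x"
    using r(2) by eventually_elim (simp add: v_def Cauchy_convergent_iff convergent_LIMSEQ_iff)
  have lim: "(\<lambda>n. nL2 M (\<lambda>x. u n x - v x)) \<longlonglongrightarrow> 0"
  proof (rule tendsto_0_ennrealI)
    fix \<epsilon> :: real assume "\<epsilon> > 0"
    from cauchy[OF this] obtain n0 where n0: "\<forall>m\<ge>n0. \<forall>n\<ge>n0. nL2 M (\<lambda>x. u m x - u n x) \<le> ennreal \<epsilon>" by blast
    have "nL2 M (\<lambda>x. u n x - v x) \<le> ennreal \<epsilon>" if n: "n \<ge> n0" for n
    proof -
      have "nL2 M (\<lambda>x. u n x - v x) = (\<integral>\<^sup>+x. liminf (\<lambda>i. ennreal ((norm (u n x - u (r i) x))\<^sup>2)) \<partial>M)"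
        unfolding nL2_def
      proof (rule nn_integral_cong_AE)
        show "AE x in M. ennreal ((norm (u n x - v x))\<^sup>2) = liminf (\<lambda>i. ennreal ((norm (u n x - u (r i) x))\<^sup>2))"
          using ae
        proof eventually_elim
          case (elim x)
          have "(\<lambda>i. ennreal ((norm (u n x - u (r i) x))\<^sup>2)) \<longlonglongrightarrow> ennreal ((norm (u n x - v x))\<^sup>2)"
            by (intro tendsto_intros tendsto_ennrealI elim)
          then show ?case by (rule lim_imp_Liminf[OF trivial_limit_sequentially, symmetric])
        qed
      qed
      also have "\<dots> \<le> liminf (\<lambda>i. nL2 M (\<lambda>x. u n x - u (r i) x))"
        unfolding nL2_def by (rule nn_integral_liminf) measurable
      also have "\<dots> \<le> ennreal \<epsilon>"
      proof (rule Liminf_le)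
        have "\<forall>\<^sub>F i in sequentially. i \<ge> n0" by (rule eventually_ge_at_top)
        then show "\<forall>\<^sub>F i in sequentially. nL2 M (\<lambda>x. u n x - u (r i) x) \<le> ennreal \<epsilon>"
          by eventually_elim (use n0 n seq_suble[OF r(1)] in \<open>meson order_trans\<close>)
      qed simp
      finally show ?thesis .
    qed
    then show "\<exists>n0. \<forall>n\<ge>n0. nL2 M (\<lambda>x. u n x - v x) \<le> ennreal \<epsilon>" by blast
  qed
  show ?thesis using v r(1) ae lim by blast
qed

text \<open>The last hypothesis excludes \<open>C = 0\<close> with an empty index set, where the
  right side would be \<open>b + 0 * \<infinity> = b\<close>. Empty index sets do arise, from
  functions without a gradient.\<close>

lemma le_mult_INF:
  fixes f :: "'i \<Rightarrow> ennreal"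
  assumes "C \<ge> 0" "\<And>i. i \<in> A \<Longrightarrow> X \<le> b + ennreal C * f i" and "A = {} \<Longrightarrow> C > 0"
  shows "X \<le> b + ennreal C * (INF i\<in>A. f i)"
proof (cases "(INF i\<in>A. f i) = \<infinity>")
  case True
  show ?thesis
  proof (cases "C = 0")
    case True
    then obtain i where "i \<in> A" using assms(3) by auto
    then show ?thesis using assms(2)[of i] True by simp
  next
    case False
    then show ?thesis using True assms(1) by (simp add: ennreal_mult_top)
  qed
next
  case False
  show ?thesis
  proof (rule ennreal_le_epsilon)
    fix e :: real assume e: "0 < e"
    define e' where "e' = e / (C + 1)"
    have e': "e' > 0" "C * e' \<le> e" using e assms(1) by (auto simp: e'_def field_simps)
    have "(INF i\<in>A. f i) < (INF i\<in>A. f i) + ennreal e'"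
      using False e' by (simp add: ennreal_add_left_cancel_less less_top top.not_eq_extremum)
    then obtain i where i: "i \<in> A" "f i < (INF i\<in>A. f i) + ennreal e'" by (auto simp: INF_less_iff)
    have "X \<le> b + ennreal C * f i" by (rule assms(2)[OF i(1)])
    also have "\<dots> \<le> b + ennreal C * ((INF i\<in>A. f i) + ennreal e')"
      by (intro add_left_mono mult_left_mono less_imp_le[OF i(2)]) simp
    also have "\<dots> = b + ennreal C * (INF i\<in>A. f i) + ennreal (C * e')"
      using assms(1) e' by (simp add: distrib_left ennreal_mult add.assoc)
    also have "\<dots> \<le> b + ennreal C * (INF i\<in>A. f i) + ennreal e" using e' by (intro add_left_mono ennreal_leI)
    finally show "X \<le> b + ennreal C * (INF i\<in>A. f i) + ennreal e" .
  qed
qed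

lemma tendsto_0_le_ennreal:
  fixes f g :: "nat \<Rightarrow> ennreal"
  assumes "\<And>n. f n \<le> g n" "g \<longlonglongrightarrow> 0"
  shows "f \<longlonglongrightarrow> 0"
  by (rule tendsto_sandwich[OF _ _ tendsto_const assms(2)]) (use assms(1) in auto)

lemma tendsto_0_2add:
  fixes f g :: "nat \<Rightarrow> ennreal"
  assumes "f \<longlonglongrightarrow> 0" "g \<longlonglongrightarrow> 0"
  shows "(\<lambda>n. 2 * f n + 2 * g n) \<longlonglongrightarrow> 0"
  using tendsto_add[OF ennreal_tendsto_cmult[OF _ assms(1), of 2] ennreal_tendsto_cmult[OF _ assms(2), of 2]] by simp

section \<open>Gradients as L^2 limits; comparison of H^1 with the fractional spaces\<close>

context regular_domain
begin

lemma tgrad_measurable: "\<phi> \<in> S \<Longrightarrow> tgrad \<phi> \<in> borel_measurable M"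
  by (intro continuous_measurable_M tangential_gradient_Cinf)

lemma has_H1_gradient_iff: "has_H1_gradient \<Omega> \<phi> g \<longleftrightarrow> g \<in> borel_measurable M \<and>
     (\<exists>\<psi>. (\<forall>n. \<psi> n \<in> S) \<and> (\<lambda>n. nL2 M (\<lambda>x. \<psi> n x - \<phi> x)) \<longlonglongrightarrow> 0 \<and>
        (\<lambda>n. nL2 M (\<lambda>x. tgrad (\<psi> n) x - g x)) \<longlonglongrightarrow> 0)"
  unfolding has_H1_gradient_def nL2_real unfolding nL2_def by (rule refl)

lemma Hs_semi_sq_1: "Hs_semi_sq 1 \<Omega> \<phi> = (INF g\<in>{g. has_H1_gradient \<Omega> \<phi> g}. nL2 M g)"
  by (simp add: Hs_semi_sq_def nL2_def)

lemma Hs_norm_sq_nL2: "Hs_norm_sq s \<Omega> \<phi> = nL2 M \<phi> + Hs_semi_sq s \<Omega> \<phi>"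
  by (simp add: Hs_norm_sq_def nL2_real)

lemma nL2_Cinf: "\<phi> \<in> S \<Longrightarrow> nL2 M \<phi> = ennreal (L2 \<phi>)"
  by (simp add: nL2_real nn_L2)

lemma has_H1_gradient_Cinf: "\<phi> \<in> S \<Longrightarrow> has_H1_gradient \<Omega> \<phi> (tgrad \<phi>)"
  unfolding has_H1_gradient_iff
  by (intro conjI tgrad_measurable exI[of _ "\<lambda>_. \<phi>"]) (auto simp: nL2_def)

lemma has_H1_gradient_diff:
  assumes f: "has_H1_gradient \<Omega> f a" and g: "has_H1_gradient \<Omega> g b"
    and fm [measurable]: "f \<in> borel_measurable M" and gm [measurable]: "g \<in> borel_measurable M"
  shows "has_H1_gradient \<Omega> (\<lambda>x. f x - g x) (\<lambda>x. a x - b x)"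
proof -
  from f obtain \<psi> where am [measurable]: "a \<in> borel_measurable M" and \<psi>: "\<And>n. \<psi> n \<in> S"
    "(\<lambda>n. nL2 M (\<lambda>x. \<psi> n x - f x)) \<longlonglongrightarrow> 0" "(\<lambda>n. nL2 M (\<lambda>x. tgrad (\<psi> n) x - a x)) \<longlonglongrightarrow> 0"
    unfolding has_H1_gradient_iff by blast
  from g obtain \<theta> where bm [measurable]: "b \<in> borel_measurable M" and \<theta>: "\<And>n. \<theta> n \<in> S"
    "(\<lambda>n. nL2 M (\<lambda>x. \<theta> n x - g x)) \<longlonglongrightarrow> 0" "(\<lambda>n. nL2 M (\<lambda>x. tgrad (\<theta> n) x - b x)) \<longlonglongrightarrow> 0"
    unfolding has_H1_gradient_iff by blast
  have [measurable]: "\<psi> n \<in> borel_measurable M" "\<theta> n \<in> borel_measurable M"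
    "tgrad (\<psi> n) \<in> borel_measurable M" "tgrad (\<theta> n) \<in> borel_measurable M" for n
    using \<psi>(1) \<theta>(1) by (auto intro: tgrad_measurable Cinf_measurable)
  have 1: "(\<lambda>n. nL2 M (\<lambda>x. (\<psi> n x - \<theta> n x) - (f x - g x))) \<longlonglongrightarrow> 0"
  proof (rule tendsto_0_le_ennreal[OF _ tendsto_0_2add[OF \<psi>(2) \<theta>(2)]])
    fix n
    have "(\<lambda>x. (\<psi> n x - \<theta> n x) - (f x - g x)) = (\<lambda>x. (\<psi> n x - f x) - (\<theta> n x - g x))" by auto
    then show "nL2 M (\<lambda>x. (\<psi> n x - \<theta> n x) - (f x - g x))
        \<le> 2 * nL2 M (\<lambda>x. \<psi> n x - f x) + 2 * nL2 M (\<lambda>x. \<theta> n x - g x)"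
      by (simp only:) (rule nL2_diff; measurable)
  qed
  have 2: "(\<lambda>n. nL2 M (\<lambda>x. tgrad (\<lambda>x. \<psi> n x - \<theta> n x) x - (a x - b x))) \<longlonglongrightarrow> 0"
  proof (rule tendsto_0_le_ennreal[OF _ tendsto_0_2add[OF \<psi>(3) \<theta>(3)]])
    fix n
    have "nL2 M (\<lambda>x. tgrad (\<lambda>x. \<psi> n x - \<theta> n x) x - (a x - b x))
        = nL2 M (\<lambda>x. (tgrad (\<psi> n) x - a x) - (tgrad (\<theta> n) x - b x))"
    proof (unfold nL2_def, intro nn_integral_cong)
      fix x assume "x \<in> space M"
      then have "tgrad (\<lambda>x. \<psi> n x - \<theta> n x) x = tgrad (\<psi> n) x - tgrad (\<theta> n) x"
        using tangential_gradient_linear[OF \<psi>(1) \<theta>(1), of x n "-1" n] by simp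
      then have "tgrad (\<lambda>x. \<psi> n x - \<theta> n x) x - (a x - b x) = (tgrad (\<psi> n) x - a x) - (tgrad (\<theta> n) x - b x)"
        by simp
      then show "ennreal ((norm (tgrad (\<lambda>x. \<psi> n x - \<theta> n x) x - (a x - b x)))\<^sup>2)
          = ennreal ((norm ((tgrad (\<psi> n) x - a x) - (tgrad (\<theta> n) x - b x)))\<^sup>2)"
        by (simp only:)
    qed
    also have "\<dots> \<le> 2 * nL2 M (\<lambda>x. tgrad (\<psi> n) x - a x) + 2 * nL2 M (\<lambda>x. tgrad (\<theta> n) x - b x)"
      by (rule nL2_diff; measurable)
    finally show "nL2 M (\<lambda>x. tgrad (\<lambda>x. \<psi> n x - \<theta> n x) x - (a x - b x))
        \<le> 2 * nL2 M (\<lambda>x. tgrad (\<psi> n) x - a x) + 2 * nL2 M (\<lambda>x. tgrad (\<theta> n) x - b x)" .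
  qed
  show ?thesis unfolding has_H1_gradient_iff
    using 1 2 Cinf_diff[OF \<psi>(1) \<theta>(1)]
    by (intro conjI exI[of _ "\<lambda>n x. \<psi> n x - \<theta> n x"] allI) auto
qed

text \<open>By closedness and linearity of the graph of the gradient, the infimum in the \<open>H\<^sup>1\<close> semi-norm
  is a quotient norm; uniqueness of the gradient is not needed.\<close>

lemma has_H1_gradient_closed:
  assumes fg: "\<And>n. has_H1_gradient \<Omega> (f n) (g n)" and fm: "\<And>n. f n \<in> borel_measurable M"
    and \<phi> [measurable]: "\<phi> \<in> borel_measurable M" and h [measurable]: "h \<in> borel_measurable M"
    and f0: "(\<lambda>n. nL2 M (\<lambda>x. f n x - \<phi> x)) \<longlonglongrightarrow> 0"
    and g0: "(\<lambda>n. nL2 M (\<lambda>x. g n x - h x)) \<longlonglongrightarrow> 0"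
  shows "has_H1_gradient \<Omega> \<phi> h"
proof -
  have "\<exists>\<theta>\<in>S. nL2 M (\<lambda>x. \<theta> x - f n x) \<le> ennreal (1 / Suc n) \<and> nL2 M (\<lambda>x. tgrad \<theta> x - g n x) \<le> ennreal (1 / Suc n)" for n
  proof -
    from fg[of n] obtain \<psi> where \<psi>: "\<And>k. \<psi> k \<in> S"
      "(\<lambda>k. nL2 M (\<lambda>x. \<psi> k x - f n x)) \<longlonglongrightarrow> 0" "(\<lambda>k. nL2 M (\<lambda>x. tgrad (\<psi> k) x - g n x)) \<longlonglongrightarrow> 0"
      unfolding has_H1_gradient_iff by blast
    have "(0::ennreal) < ennreal (1 / Suc n)" by simp
    then have "\<forall>\<^sub>F k in sequentially. nL2 M (\<lambda>x. \<psi> k x - f n x) < ennreal (1 / Suc n) \<and> nL2 M (\<lambda>x. tgrad (\<psi> k) x - g n x) < ennreal (1 / Suc n)"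
      by (intro eventually_conj order_tendstoD(2)[OF \<psi>(2)] order_tendstoD(2)[OF \<psi>(3)])
    then obtain k where "nL2 M (\<lambda>x. \<psi> k x - f n x) < ennreal (1 / Suc n)" "nL2 M (\<lambda>x. tgrad (\<psi> k) x - g n x) < ennreal (1 / Suc n)"
      using eventually_happens'[OF sequentially_bot] by blast
    then show ?thesis using \<psi>(1)[of k] by (intro bexI[of _ "\<psi> k"]) auto
  qed
  then have "\<forall>n. \<exists>\<theta>. \<theta> \<in> S \<and> nL2 M (\<lambda>x. \<theta> x - f n x) \<le> ennreal (1 / Suc n) \<and> nL2 M (\<lambda>x. tgrad \<theta> x - g n x) \<le> ennreal (1 / Suc n)"
    by blast
  from choice[OF this] obtain \<theta> where \<theta>: "\<forall>n. \<theta> n \<in> S \<and> nL2 M (\<lambda>x. \<theta> n x - f n x) \<le> ennreal (1 / Suc n) \<and>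
      nL2 M (\<lambda>x. tgrad (\<theta> n) x - g n x) \<le> ennreal (1 / Suc n)" by (rule exE)
  have inv: "(\<lambda>n. ennreal (1 / Suc n)) \<longlonglongrightarrow> 0"
    using tendsto_ennrealI[OF LIMSEQ_inverse_real_of_nat] by (simp add: inverse_eq_divide)
  have gm: "g n \<in> borel_measurable M" for n using fg unfolding has_H1_gradient_iff by blast
  have [measurable]: "\<theta> n \<in> borel_measurable M" "tgrad (\<theta> n) \<in> borel_measurable M" "f n \<in> borel_measurable M" "g n \<in> borel_measurable M" for n
    using \<theta> fm gm by (auto intro: tgrad_measurable Cinf_measurable)
  have "(\<lambda>n. nL2 M (\<lambda>x. \<theta> n x - \<phi> x)) \<longlonglongrightarrow> 0"
  proof (rule tendsto_0_le_ennreal[OF _ tendsto_0_2add[OF inv f0]])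
    fix n
    have "nL2 M (\<lambda>x. (\<theta> n x - f n x) + (f n x - \<phi> x)) \<le> 2 * nL2 M (\<lambda>x. \<theta> n x - f n x) + 2 * nL2 M (\<lambda>x. f n x - \<phi> x)"
      by (rule nL2_add; measurable)
    also have "\<dots> \<le> 2 * ennreal (1 / Suc n) + 2 * nL2 M (\<lambda>x. f n x - \<phi> x)"
      using \<theta> by (intro add_right_mono mult_left_mono) auto
    finally show "nL2 M (\<lambda>x. \<theta> n x - \<phi> x) \<le> 2 * ennreal (1 / Suc n) + 2 * nL2 M (\<lambda>x. f n x - \<phi> x)" by simp
  qed
  moreover have "(\<lambda>n. nL2 M (\<lambda>x. tgrad (\<theta> n) x - h x)) \<longlonglongrightarrow> 0"
  proof (rule tendsto_0_le_ennreal[OF _ tendsto_0_2add[OF inv g0]])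
    fix n
    have "nL2 M (\<lambda>x. (tgrad (\<theta> n) x - g n x) + (g n x - h x)) \<le> 2 * nL2 M (\<lambda>x. tgrad (\<theta> n) x - g n x) + 2 * nL2 M (\<lambda>x. g n x - h x)"
      by (rule nL2_add; measurable)
    also have "\<dots> \<le> 2 * ennreal (1 / Suc n) + 2 * nL2 M (\<lambda>x. g n x - h x)"
      using \<theta> by (intro add_right_mono mult_left_mono) auto
    finally show "nL2 M (\<lambda>x. tgrad (\<theta> n) x - h x) \<le> 2 * ennreal (1 / Suc n) + 2 * nL2 M (\<lambda>x. g n x - h x)" by simp
  qed
  ultimately show ?thesis unfolding has_H1_gradient_iff using h \<theta> by blast
qed

text \<open>The triangle inequality for squared semi-norms, with a factor 2. For
  \<open>s = 1\<close> a difference of gradients is a gradient of the difference and hence competes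
  in the infimum.\<close>

lemma Hs_semi_sq_diff:
  assumes s: "0 \<le> s" "s \<le> 1"
    and f [measurable]: "f \<in> borel_measurable M" and g [measurable]: "g \<in> borel_measurable M"
  shows "Hs_semi_sq s \<Omega> (\<lambda>x. f x - g x) \<le> 2 * Hs_semi_sq s \<Omega> f + 2 * Hs_semi_sq s \<Omega> g"
proof -
  consider "s = 0" | "0 < s" "s < 1" | "s = 1" using s by linarith
  then show ?thesis
  proof cases
    case 1
    then show ?thesis by (simp add: Hs_semi_sq_def)
  next
    case 2
    have K [measurable]: "(\<lambda>z. kern s \<phi> (fst z) (snd z)) \<in> borel_measurable (M \<Otimes>\<^sub>M M)" if "\<phi> \<in> borel_measurable M" for \<phi>
      using kern_measurable[OF that] by (simp add: case_prod_beta')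
    have "Hs_semi_sq s \<Omega> (\<lambda>x. f x - g x) = (\<integral>\<^sup>+z. kern s (\<lambda>x. f x - g x) (fst z) (snd z) \<partial>(M \<Otimes>\<^sub>M M))"
      using 2 by (intro Hs_semi_sq_eq) auto
    also have "\<dots> \<le> (\<integral>\<^sup>+z. 2 * kern s f (fst z) (snd z) + 2 * kern s g (fst z) (snd z) \<partial>(M \<Otimes>\<^sub>M M))"
    proof (rule nn_integral_mono)
      fix z :: "'a \<times> 'a"
      let ?d = "norm (fst z - snd z) powr (real (DIM('a) - 1) + 2 * s)"
      have "f (fst z) - g (fst z) - (f (snd z) - g (snd z)) = (f (fst z) - f (snd z)) + - (g (fst z) - g (snd z))"
        by simp
      then have "(f (fst z) - g (fst z) - (f (snd z) - g (snd z)))\<^sup>2 \<le> 2 * (f (fst z) - f (snd z))\<^sup>2 + 2 * (g (fst z) - g (snd z))\<^sup>2"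
        using norm_add_sq_le[of "f (fst z) - f (snd z)" "- (g (fst z) - g (snd z))"]
        by (simp only: real_norm_def power2_abs abs_minus_cancel)
      then have "(f (fst z) - g (fst z) - (f (snd z) - g (snd z)))\<^sup>2 / ?d
          \<le> (2 * (f (fst z) - f (snd z))\<^sup>2 + 2 * (g (fst z) - g (snd z))\<^sup>2) / ?d"
        by (rule divide_right_mono) simp
      also have "\<dots> = 2 * ((f (fst z) - f (snd z))\<^sup>2 / ?d) + 2 * ((g (fst z) - g (snd z))\<^sup>2 / ?d)"
        by (simp add: add_divide_distrib)
      finally have "ennreal ((f (fst z) - g (fst z) - (f (snd z) - g (snd z)))\<^sup>2 / ?d)
          \<le> ennreal (2 * ((f (fst z) - f (snd z))\<^sup>2 / ?d) + 2 * ((g (fst z) - g (snd z))\<^sup>2 / ?d))"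
        by (rule ennreal_leI)
      also have "\<dots> = 2 * ennreal ((f (fst z) - f (snd z))\<^sup>2 / ?d) + 2 * ennreal ((g (fst z) - g (snd z))\<^sup>2 / ?d)"
        by (subst ennreal_plus) (auto simp only: ennreal_mult ennreal_numeral zero_le_numeral divide_nonneg_nonneg zero_le_power2 powr_ge_zero mult_nonneg_nonneg)
      finally show "kern s (\<lambda>x. f x - g x) (fst z) (snd z) \<le> 2 * kern s f (fst z) (snd z) + 2 * kern s g (fst z) (snd z)"
        by (simp only: kern_def)
    qed
    also have "\<dots> = 2 * Hs_semi_sq s \<Omega> f + 2 * Hs_semi_sq s \<Omega> g"
      using 2 by (subst nn_integral_add) (auto simp: nn_integral_cmult Hs_semi_sq_eq)
    finally show ?thesis .
  next
    case 3
    have *: "Hs_semi_sq 1 \<Omega> (\<lambda>x. f x - g x) \<le> 2 * nL2 M a + 2 * nL2 M b"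
      if "has_H1_gradient \<Omega> f a" "has_H1_gradient \<Omega> g b" for a b
    proof -
      have "has_H1_gradient \<Omega> (\<lambda>x. f x - g x) (\<lambda>x. a x - b x)"
        using that f g by (rule has_H1_gradient_diff)
      then have "Hs_semi_sq 1 \<Omega> (\<lambda>x. f x - g x) \<le> nL2 M (\<lambda>x. a x - b x)"
        unfolding Hs_semi_sq_1 by (intro INF_lower) simp
      also have "\<dots> \<le> 2 * nL2 M a + 2 * nL2 M b"
        using that unfolding has_H1_gradient_iff by (intro nL2_diff) auto
      finally show ?thesis .
    qed
    \<comment> \<open>The two infima are taken one after the other, here over gradients of
      \<open>f\<close> with \<open>b\<close> fixed.\<close>
    have "Hs_semi_sq 1 \<Omega> (\<lambda>x. f x - g x) \<le> 2 * Hs_semi_sq 1 \<Omega> f + ennreal 2 * nL2 M b"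
      if b: "has_H1_gradient \<Omega> g b" for b
    proof -
      have "Hs_semi_sq 1 \<Omega> (\<lambda>x. f x - g x) \<le> 2 * nL2 M b + ennreal 2 * (INF a\<in>{a. has_H1_gradient \<Omega> f a}. nL2 M a)"
        by (rule le_mult_INF) (use *[OF _ b] in \<open>auto simp: add.commute\<close>)
      then show ?thesis unfolding Hs_semi_sq_1 by (simp add: add.commute)
    qed
    then have "Hs_semi_sq 1 \<Omega> (\<lambda>x. f x - g x) \<le> 2 * Hs_semi_sq 1 \<Omega> f + ennreal 2 * (INF b\<in>{b. has_H1_gradient \<Omega> g b}. nL2 M b)"
      by (intro le_mult_INF) auto
    then show ?thesis unfolding Hs_semi_sq_1 3 by simp
  qed
qed

lemma Hs_norm_sq_diff:
  assumes "0 \<le> s" "s \<le> 1" "f \<in> borel_measurable M" "g \<in> borel_measurable M"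
  shows "Hs_norm_sq s \<Omega> (\<lambda>x. f x - g x) \<le> 2 * Hs_norm_sq s \<Omega> f + 2 * Hs_norm_sq s \<Omega> g"
proof -
  have "Hs_norm_sq s \<Omega> (\<lambda>x. f x - g x) \<le> (2 * nL2 M f + 2 * nL2 M g) + (2 * Hs_semi_sq s \<Omega> f + 2 * Hs_semi_sq s \<Omega> g)"
    unfolding Hs_norm_sq_nL2 by (intro add_mono nL2_diff Hs_semi_sq_diff assms)
  then show ?thesis by (simp add: Hs_norm_sq_nL2 distrib_left add_ac)
qed

lemma Hs_norm_sq_Cinf_finite:
  assumes s: "0 \<le> s" "s \<le> 1" and \<phi>: "\<phi> \<in> S"
  shows "Hs_norm_sq s \<Omega> \<phi> < \<infinity>"
proof -
  have "bounded (tgrad \<phi> ` F)"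
    by (intro compact_imp_bounded compact_continuous_image tangential_gradient_Cinf \<phi> compact_F)
  then obtain b where b: "\<forall>y\<in>tgrad \<phi> ` F. norm y \<le> b" by (auto simp: bounded_iff)
  have "nL2 M (tgrad \<phi>) \<le> (\<integral>\<^sup>+x. ennreal (b\<^sup>2) \<partial>M)"
    unfolding nL2_def using b by (intro nn_integral_mono ennreal_leI power_mono) auto
  also have "\<dots> < \<infinity>" using emeasure_M_F by (simp add: ennreal_mult_less_top)
  finally have tf: "nL2 M (tgrad \<phi>) < \<infinity>" .
  consider "s = 0" | "0 < s" "s < 1" | "s = 1" using s by linarith
  then have "Hs_semi_sq s \<Omega> \<phi> < \<infinity>"
  proof cases
    case 2
    from embedding[OF 2] obtain C where "Hs_semi_sq s \<Omega> \<phi> \<le> ennreal C * (nL2 M \<phi> + nL2 M (tgrad \<phi>))"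
      using \<phi> unfolding nL2_def by auto
    also have "\<dots> < \<infinity>" using tf nL2_Cinf[OF \<phi>] by (simp add: ennreal_mult_less_top)
    finally show ?thesis .
  next
    case 3
    have "Hs_semi_sq 1 \<Omega> \<phi> \<le> nL2 M (tgrad \<phi>)"
      unfolding Hs_semi_sq_1 using has_H1_gradient_Cinf[OF \<phi>] by (intro INF_lower) simp
    then show ?thesis using tf 3 by (simp add: le_less_trans)
  qed (simp add: Hs_semi_sq_def)
  then show ?thesis using nL2_Cinf[OF \<phi>] by (simp add: Hs_norm_sq_nL2)
qed

text \<open>Extends \<open>embedding\<close> beyond smooth functions. The semi-norm truncated to
  pairs at distance at least \<delta> is controlled in L^2 by \<open>kern_far\<close>, with a
  constant depending on \<delta>, so smooth approximations pass to the limit for fixed \<delta>. The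
  resulting bound does not depend on \<delta>, and monotone convergence removes the truncation. If
  there is no gradient, the right side is infinite.\<close>

lemma H1_embedding:
  assumes s: "0 < s" "s < 1"
  shows "\<exists>C>0. \<forall>\<phi>\<in>borel_measurable M. Hs_semi_sq s \<Omega> \<phi> \<le> ennreal C * Hs_norm_sq 1 \<Omega> \<phi>"
proof -
  from embedding[OF s] obtain C0 where C0: "C0 \<ge> 0 \<and> (\<forall>\<phi>\<in>S. Hs_semi_sq s \<Omega> \<phi>
     \<le> ennreal C0 * ((\<integral>\<^sup>+x. ennreal ((\<phi> x)\<^sup>2) \<partial>M) + (\<integral>\<^sup>+x. ennreal ((norm (tgrad \<phi> x))\<^sup>2) \<partial>M)))" by (rule exE)
  have emb: "Hs_semi_sq s \<Omega> \<psi> \<le> ennreal C0 * (nL2 M \<psi> + nL2 M (tgrad \<psi>))" if "\<psi> \<in> S" for \<psi>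
    using C0 that unfolding nL2_def by auto
  \<comment> \<open>The factor 4 comes from splitting squares twice, once in the kernel and once in
    the L^2 norms; the \<open>1\<close> keeps \<open>C\<close> positive, which
    \<open>le_mult_INF\<close> requires for functions without a gradient.\<close>
  define C where "C = 4 * C0 + 1"
  have C: "C > 0" using C0 by (simp add: C_def)
  have main: "Hs_semi_sq s \<Omega> \<phi> \<le> ennreal C * (nL2 M \<phi> + nL2 M g)"
    if \<phi> [measurable]: "\<phi> \<in> borel_measurable M" and g: "has_H1_gradient \<Omega> \<phi> g" for \<phi> g
  proof -
    from g obtain \<psi> where gm [measurable]: "g \<in> borel_measurable M" and \<psi>: "\<And>n. \<psi> n \<in> S"
      "(\<lambda>n. nL2 M (\<lambda>x. \<psi> n x - \<phi> x)) \<longlonglongrightarrow> 0" "(\<lambda>n. nL2 M (\<lambda>x. tgrad (\<psi> n) x - g x)) \<longlonglongrightarrow> 0"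
      unfolding has_H1_gradient_iff by blast
    have [measurable]: "\<psi> n \<in> borel_measurable M" "tgrad (\<psi> n) \<in> borel_measurable M" for n
      using \<psi>(1) by (auto intro: tgrad_measurable Cinf_measurable)
    have K [measurable]: "(\<lambda>z. kern s f (fst z) (snd z)) \<in> borel_measurable (M \<Otimes>\<^sub>M M)" if "f \<in> borel_measurable M" for f
      using kern_measurable[OF that] by (simp add: case_prod_beta')
    define T where "T \<delta> f = (\<integral>\<^sup>+z. kern s f (fst z) (snd z) * indicator (far \<delta>) z \<partial>(M \<Otimes>\<^sub>M M))" for \<delta> f
    have trunc: "T \<delta> \<phi> \<le> ennreal C * (nL2 M \<phi> + nL2 M g)" if \<delta>: "\<delta> > 0" for \<delta>
    proof -
      from kern_far[OF \<delta> less_imp_le[OF s(1)]] obtain C1 where C1: "C1 \<ge> 0 \<and> (\<forall>f\<in>borel_measurable M. T \<delta> f \<le> ennreal C1 * nL2 M f)"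
        unfolding T_def nL2_real by (rule exE)
      define e where "e n = 2 * (ennreal C0 * (2 * nL2 M (\<lambda>x. \<psi> n x - \<phi> x) + 2 * nL2 M (\<lambda>x. tgrad (\<psi> n) x - g x))) + 2 * (ennreal C1 * nL2 M (\<lambda>x. \<psi> n x - \<phi> x))" for n
      have "(\<lambda>n. ennreal C0 * (2 * nL2 M (\<lambda>x. \<psi> n x - \<phi> x) + 2 * nL2 M (\<lambda>x. tgrad (\<psi> n) x - g x))) \<longlonglongrightarrow> 0"
        using ennreal_tendsto_cmult[OF _ tendsto_0_2add[OF \<psi>(2,3)], of "ennreal C0"] by simp
      moreover have "(\<lambda>n. ennreal C1 * nL2 M (\<lambda>x. \<psi> n x - \<phi> x)) \<longlonglongrightarrow> 0"
        using ennreal_tendsto_cmult[OF _ \<psi>(2), of "ennreal C1"] by simp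
      ultimately have e0: "e \<longlonglongrightarrow> 0" unfolding e_def by (rule tendsto_0_2add)
      have le: "T \<delta> \<phi> \<le> ennreal (4 * C0) * (nL2 M \<phi> + nL2 M g) + e n" for n
      proof -
        let ?d = "\<lambda>x. \<psi> n x - \<phi> x"
        have "T \<delta> \<phi> \<le> (\<integral>\<^sup>+z. 2 * (kern s (\<psi> n) (fst z) (snd z)) + 2 * (kern s ?d (fst z) (snd z) * indicator (far \<delta>) z) \<partial>(M \<Otimes>\<^sub>M M))"
          unfolding T_def
        proof (rule nn_integral_mono)
          fix z :: "'a \<times> 'a"
          let ?d' = "norm (fst z - snd z) powr (real (DIM('a) - 1) + 2 * s)"
          let ?a = "\<psi> n (fst z) - \<psi> n (snd z)" and ?b = "?d (fst z) - ?d (snd z)"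
          have "\<phi> (fst z) - \<phi> (snd z) = ?a + - ?b" by simp
          then have "(\<phi> (fst z) - \<phi> (snd z))\<^sup>2 \<le> 2 * ?a\<^sup>2 + 2 * ?b\<^sup>2"
            using norm_add_sq_le[of ?a "- ?b"] by (simp only: real_norm_def power2_abs abs_minus_cancel)
          then have "(\<phi> (fst z) - \<phi> (snd z))\<^sup>2 / ?d' \<le> (2 * ?a\<^sup>2 + 2 * ?b\<^sup>2) / ?d'"
            by (rule divide_right_mono) simp
          also have "\<dots> = 2 * (?a\<^sup>2 / ?d') + 2 * (?b\<^sup>2 / ?d')" by (simp add: add_divide_distrib)
          finally have "ennreal ((\<phi> (fst z) - \<phi> (snd z))\<^sup>2 / ?d') \<le> ennreal (2 * (?a\<^sup>2 / ?d') + 2 * (?b\<^sup>2 / ?d'))"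
            by (rule ennreal_leI)
          also have "\<dots> = 2 * ennreal (?a\<^sup>2 / ?d') + 2 * ennreal (?b\<^sup>2 / ?d')"
            by (subst ennreal_plus) (auto simp only: ennreal_mult ennreal_numeral zero_le_numeral divide_nonneg_nonneg zero_le_power2 powr_ge_zero mult_nonneg_nonneg)
          finally have "kern s \<phi> (fst z) (snd z) \<le> 2 * kern s (\<psi> n) (fst z) (snd z) + 2 * kern s ?d (fst z) (snd z)"
            by (simp only: kern_def)
          then show "kern s \<phi> (fst z) (snd z) * indicator (far \<delta>) z
            \<le> 2 * kern s (\<psi> n) (fst z) (snd z) + 2 * (kern s ?d (fst z) (snd z) * indicator (far \<delta>) z)"
            by (simp add: indicator_def)
        qed
        also have "\<dots> = 2 * Hs_semi_sq s \<Omega> (\<psi> n) + 2 * T \<delta> ?d"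
        proof -
          have [measurable]: "(\<lambda>z. kern s ?d (fst z) (snd z) * indicator (far \<delta>) z) \<in> borel_measurable (M \<Otimes>\<^sub>M M)"
            using K[of ?d] by measurable
          show ?thesis unfolding T_def
            using s by (subst nn_integral_add) (auto simp: nn_integral_cmult Hs_semi_sq_eq)
        qed
        also have "\<dots> \<le> 2 * (ennreal C0 * (nL2 M (\<psi> n) + nL2 M (tgrad (\<psi> n)))) + 2 * (ennreal C1 * nL2 M ?d)"
          using C1 by (intro add_mono mult_left_mono emb \<psi>(1)) auto
        also have "\<dots> \<le> 2 * (ennreal C0 * ((2 * nL2 M ?d + 2 * nL2 M \<phi>) + (2 * nL2 M (\<lambda>x. tgrad (\<psi> n) x - g x) + 2 * nL2 M g))) + 2 * (ennreal C1 * nL2 M ?d)"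
        proof -
          have "nL2 M (\<psi> n) \<le> 2 * nL2 M ?d + 2 * nL2 M \<phi>"
            using nL2_add[of ?d M \<phi>] by simp
          moreover have "nL2 M (tgrad (\<psi> n)) \<le> 2 * nL2 M (\<lambda>x. tgrad (\<psi> n) x - g x) + 2 * nL2 M g"
            using nL2_add[of "\<lambda>x. tgrad (\<psi> n) x - g x" M g] by simp
          ultimately show ?thesis by (intro add_right_mono mult_left_mono add_mono) auto
        qed
        also have "\<dots> = ennreal (4 * C0) * (nL2 M \<phi> + nL2 M g) + e n"
        proof -
          have "ennreal (4 * C0) = 4 * ennreal C0" using C0 by (simp add: ennreal_mult)
          then show ?thesis by (simp add: e_def distrib_left add_ac mult_ac)
        qed
        finally show ?thesis .
      qed
      have "(\<lambda>n. ennreal (4 * C0) * (nL2 M \<phi> + nL2 M g) + e n) \<longlonglongrightarrow> ennreal (4 * C0) * (nL2 M \<phi> + nL2 M g) + 0"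
        by (intro tendsto_add tendsto_const e0)
      then have "T \<delta> \<phi> \<le> ennreal (4 * C0) * (nL2 M \<phi> + nL2 M g) + 0"
        using le by (intro tendsto_lowerbound) auto
      also have "\<dots> \<le> ennreal C * (nL2 M \<phi> + nL2 M g)"
        using C0 by (simp add: C_def mult_right_mono ennreal_leI)
      finally show ?thesis .
    qed
    have "Hs_semi_sq s \<Omega> \<phi> = (\<integral>\<^sup>+z. kern s \<phi> (fst z) (snd z) \<partial>(M \<Otimes>\<^sub>M M))"
      using s by (intro Hs_semi_sq_eq \<phi>) auto
    also have "\<dots> = (\<integral>\<^sup>+z. (SUP n. kern s \<phi> (fst z) (snd z) * indicator (far (1 / Suc n)) z) \<partial>(M \<Otimes>\<^sub>M M))"
    proof (rule nn_integral_cong)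
      fix z :: "'a \<times> 'a"
      show "kern s \<phi> (fst z) (snd z) = (SUP n. kern s \<phi> (fst z) (snd z) * indicator (far (1 / Suc n)) z)"
      proof (cases "fst z = snd z")
        case False
        then obtain n where "inverse (real (Suc n)) < norm (fst z - snd z)" using reals_Archimedean[of "norm (fst z - snd z)"] by auto
        then have "kern s \<phi> (fst z) (snd z) = kern s \<phi> (fst z) (snd z) * indicator (far (1 / Suc n)) z"
          by (simp add: inverse_eq_divide)
        also have "\<dots> \<le> (SUP n. kern s \<phi> (fst z) (snd z) * indicator (far (1 / Suc n)) z)"
          by (rule SUP_upper) simp
        finally have "kern s \<phi> (fst z) (snd z) \<le> (SUP n. kern s \<phi> (fst z) (snd z) * indicator (far (1 / Suc n)) z)" .
        moreover have "(SUP n. kern s \<phi> (fst z) (snd z) * indicator (far (1 / Suc n)) z) \<le> kern s \<phi> (fst z) (snd z)"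
          by (intro SUP_least) (simp add: indicator_def)
        ultimately show ?thesis by (rule antisym)
      qed (simp add: kern_def)
    qed
    also have "\<dots> = (SUP n. T (1 / Suc n) \<phi>)" unfolding T_def
    proof (rule nn_integral_monotone_convergence_SUP)
      show "incseq (\<lambda>n z. kern s \<phi> (fst z) (snd z) * indicator (far (1 / Suc n)) z)"
      proof (intro incseq_SucI le_funI)
        fix n and z :: "'a \<times> 'a"
        have "1 / real (Suc (Suc n)) \<le> 1 / real (Suc n)" by (intro divide_left_mono) auto
        then have "far (1 / Suc n) \<subseteq> far (1 / Suc (Suc n))" by (auto simp del: of_nat_Suc)
        then have "indicator (far (1 / Suc n)) z \<le> (indicator (far (1 / Suc (Suc n))) z :: ennreal)"
          by (rule indicator_leI[OF subsetD])
        then show "kern s \<phi> (fst z) (snd z) * indicator (far (1 / Suc n)) z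
            \<le> kern s \<phi> (fst z) (snd z) * indicator (far (1 / Suc (Suc n))) z"
          by (rule mult_left_mono) simp
      qed
      show "(\<lambda>z. kern s \<phi> (fst z) (snd z) * indicator (far (1 / Suc n)) z) \<in> borel_measurable (M \<Otimes>\<^sub>M M)" for n
        using K[OF \<phi>] by measurable
    qed
    also have "\<dots> \<le> ennreal C * (nL2 M \<phi> + nL2 M g)" by (intro SUP_least trunc) simp
    finally show ?thesis .
  qed
  have "Hs_semi_sq s \<Omega> \<phi> \<le> ennreal C * Hs_norm_sq 1 \<Omega> \<phi>" if "\<phi> \<in> borel_measurable M" for \<phi>
  proof -
    have "Hs_semi_sq s \<Omega> \<phi> \<le> ennreal C * nL2 M \<phi> + ennreal C * (INF g\<in>{g. has_H1_gradient \<Omega> \<phi> g}. nL2 M g)"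
      using C main[OF that] by (intro le_mult_INF) (auto simp: distrib_left)
    then show ?thesis by (simp add: Hs_norm_sq_nL2 Hs_semi_sq_1 distrib_left)
  qed
  then show ?thesis using C by blast
qed

end

section \<open>Ehrling inequality, compact embedding into L^2 and completeness\<close>

context regular_domain
begin

lemma Hs_norm_sq_Cinf: "0 \<le> s \<Longrightarrow> s \<le> 1 \<Longrightarrow> \<phi> \<in> S \<Longrightarrow> Hs_norm_sq s \<Omega> \<phi> = ennreal ((Hs_norm s \<Omega> \<phi>)\<^sup>2)"
  using Hs_norm_sq_Cinf_finite[of s \<phi>] by (simp add: Hs_norm_def)

lemma Hs_norm_sq_split: "0 \<le> s \<Longrightarrow> s \<le> 1 \<Longrightarrow> \<phi> \<in> S \<Longrightarrow> (Hs_norm s \<Omega> \<phi>)\<^sup>2 = L2 \<phi> + (Hs_seminorm s \<Omega> \<phi>)\<^sup>2"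
proof -
  assume a: "0 \<le> s" "s \<le> 1" "\<phi> \<in> S"
  have "Hs_semi_sq s \<Omega> \<phi> < \<infinity>"
    using Hs_norm_sq_Cinf_finite[OF a] by (simp add: Hs_norm_sq_nL2)
  then show ?thesis using nL2_Cinf[OF a(3)]
    by (simp add: Hs_norm_def Hs_seminorm_def Hs_norm_sq_nL2 enn2real_plus L2_nonneg)
qed

lemma Hs_norm_diff:
  assumes "0 \<le> s" "s \<le> 1" "f \<in> S" "g \<in> S"
  shows "(Hs_norm s \<Omega> (\<lambda>x. f x - g x))\<^sup>2 \<le> 2 * (Hs_norm s \<Omega> f)\<^sup>2 + 2 * (Hs_norm s \<Omega> g)\<^sup>2"
proof -
  have "ennreal ((Hs_norm s \<Omega> (\<lambda>x. f x - g x))\<^sup>2) \<le> 2 * ennreal ((Hs_norm s \<Omega> f)\<^sup>2) + 2 * ennreal ((Hs_norm s \<Omega> g)\<^sup>2)"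
    using Hs_norm_sq_diff[OF assms(1,2) Cinf_measurable[OF assms(3)] Cinf_measurable[OF assms(4)]] assms
    by (simp add: Hs_norm_sq_Cinf Cinf_diff)
  also have "\<dots> = ennreal (2 * (Hs_norm s \<Omega> f)\<^sup>2 + 2 * (Hs_norm s \<Omega> g)\<^sup>2)" by (simp add: ennreal_mult)
  finally show ?thesis by (subst (asm) ennreal_le_iff) auto
qed

text \<open>For \<open>s2 < 1\<close> this is \<open>interpolation\<close>. That lemma compares
  double integrals, so for \<open>s2 = 1\<close> an intermediate order is inserted and reached by
  \<open>H1_embedding\<close>.\<close>

lemma ehrling:
  assumes s: "0 \<le> s1" "s1 < s2" "s2 \<le> 1" and \<eta>: "\<eta> > 0"
  shows "\<exists>C\<ge>0. \<forall>\<phi>\<in>S. (Hs_norm s1 \<Omega> \<phi>)\<^sup>2 \<le> \<eta> * (Hs_norm s2 \<Omega> \<phi>)\<^sup>2 + C * L2 \<phi>"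
proof (cases "s1 = 0")
  case True
  have "(Hs_norm s1 \<Omega> \<phi>)\<^sup>2 = L2 \<phi>" if "\<phi> \<in> S" for \<phi>
    using Hs_norm_sq_split[of 0 \<phi>] that by (simp add: True Hs_seminorm_def Hs_semi_sq_def)
  then show ?thesis using \<eta> by (intro exI[of _ 1]) auto
next
  case False
  then have s1: "s1 > 0" using s by simp
  have "\<exists>C\<ge>0. \<forall>\<phi>\<in>S. Hs_semi_sq s1 \<Omega> \<phi> \<le> ennreal \<eta> * Hs_norm_sq s2 \<Omega> \<phi> + ennreal C * nL2 M \<phi>"
  proof (cases "s2 < 1")
    case True
    from interpolation[OF s1 s(2) True \<eta>] obtain C where C: "C \<ge> 0 \<and> (\<forall>\<phi>\<in>borel_measurable M. Hs_semi_sq s1 \<Omega> \<phi>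
      \<le> ennreal \<eta> * Hs_semi_sq s2 \<Omega> \<phi> + ennreal C * nL2 M \<phi>)" unfolding nL2_real by (rule exE)
    have "Hs_semi_sq s1 \<Omega> \<phi> \<le> ennreal \<eta> * Hs_norm_sq s2 \<Omega> \<phi> + ennreal C * nL2 M \<phi>" if "\<phi> \<in> S" for \<phi>
    proof -
      have "Hs_semi_sq s1 \<Omega> \<phi> \<le> ennreal \<eta> * Hs_semi_sq s2 \<Omega> \<phi> + ennreal C * nL2 M \<phi>"
        using C Cinf_measurable[OF that] by blast
      also have "\<dots> \<le> ennreal \<eta> * Hs_norm_sq s2 \<Omega> \<phi> + ennreal C * nL2 M \<phi>"
        unfolding Hs_norm_sq_nL2 by (intro add_right_mono mult_left_mono) auto
      finally show ?thesis .
    qed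
    then show ?thesis using C by blast
  next
    case False
    then have s2: "s2 = 1" using s by simp
    define s' where "s' = (s1 + 1) / 2"
    have s': "s1 < s'" "0 < s'" "s' < 1" using s s1 s2 by (auto simp: s'_def)
    from H1_embedding[OF s'(2,3)] obtain D where D: "D > 0 \<and> (\<forall>\<phi>\<in>borel_measurable M. Hs_semi_sq s' \<Omega> \<phi> \<le> ennreal D * Hs_norm_sq 1 \<Omega> \<phi>)"
      by (rule exE)
    have "\<eta> / D > 0" using D \<eta> by simp
    from interpolation[OF s1 s'(1,3) this] obtain C where C: "C \<ge> 0 \<and> (\<forall>\<phi>\<in>borel_measurable M. Hs_semi_sq s1 \<Omega> \<phi>
      \<le> ennreal (\<eta> / D) * Hs_semi_sq s' \<Omega> \<phi> + ennreal C * nL2 M \<phi>)" unfolding nL2_real by (rule exE)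
    have "Hs_semi_sq s1 \<Omega> \<phi> \<le> ennreal \<eta> * Hs_norm_sq s2 \<Omega> \<phi> + ennreal C * nL2 M \<phi>" if "\<phi> \<in> S" for \<phi>
    proof -
      have "Hs_semi_sq s1 \<Omega> \<phi> \<le> ennreal (\<eta> / D) * Hs_semi_sq s' \<Omega> \<phi> + ennreal C * nL2 M \<phi>"
        using C Cinf_measurable[OF that] by blast
      also have "\<dots> \<le> ennreal (\<eta> / D) * (ennreal D * Hs_norm_sq 1 \<Omega> \<phi>) + ennreal C * nL2 M \<phi>"
        using D Cinf_measurable[OF that] by (intro add_right_mono mult_left_mono) auto
      also have "ennreal (\<eta> / D) * (ennreal D * Hs_norm_sq 1 \<Omega> \<phi>) = ennreal \<eta> * Hs_norm_sq s2 \<Omega> \<phi>"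
        using D \<eta> by (simp add: s2 mult.assoc[symmetric] ennreal_mult[symmetric])
      finally show ?thesis .
    qed
    then show ?thesis using C by blast
  qed
  then obtain C where C: "C \<ge> 0" "\<forall>\<phi>\<in>S. Hs_semi_sq s1 \<Omega> \<phi> \<le> ennreal \<eta> * Hs_norm_sq s2 \<Omega> \<phi> + ennreal C * nL2 M \<phi>" by blast
  \<comment> \<open>The additional \<open>1\<close> pays for the L^2 part of the norm of order
    \<open>s1\<close>.\<close>
  have "(Hs_norm s1 \<Omega> \<phi>)\<^sup>2 \<le> \<eta> * (Hs_norm s2 \<Omega> \<phi>)\<^sup>2 + (C + 1) * L2 \<phi>" if \<phi>: "\<phi> \<in> S" for \<phi>
  proof -
    have "ennreal ((Hs_norm s1 \<Omega> \<phi>)\<^sup>2) = nL2 M \<phi> + Hs_semi_sq s1 \<Omega> \<phi>"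
      using Hs_norm_sq_Cinf[of s1 \<phi>] s \<phi> by (simp add: Hs_norm_sq_nL2)
    also have "\<dots> \<le> nL2 M \<phi> + (ennreal \<eta> * Hs_norm_sq s2 \<Omega> \<phi> + ennreal C * nL2 M \<phi>)"
      using C \<phi> by (intro add_left_mono) auto
    also have "\<dots> = ennreal (L2 \<phi>) + (ennreal \<eta> * ennreal ((Hs_norm s2 \<Omega> \<phi>)\<^sup>2) + ennreal C * ennreal (L2 \<phi>))"
      using s \<phi> Hs_norm_sq_Cinf[of s2 \<phi>] by (simp add: nL2_Cinf)
    also have "\<dots> = ennreal (L2 \<phi> + (\<eta> * (Hs_norm s2 \<Omega> \<phi>)\<^sup>2 + C * L2 \<phi>))"
      using \<eta> C(1) L2_nonneg[of \<phi>] by (simp add: ennreal_mult)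
    finally have "(Hs_norm s1 \<Omega> \<phi>)\<^sup>2 \<le> L2 \<phi> + (\<eta> * (Hs_norm s2 \<Omega> \<phi>)\<^sup>2 + C * L2 \<phi>)"
      using \<eta> C(1) L2_nonneg[of \<phi>] by (subst (asm) ennreal_le_iff) auto
    then show ?thesis by (simp add: algebra_simps)
  qed
  then show ?thesis using C(1) by (intro exI[of _ "C + 1"]) auto
qed

text \<open>For \<open>s = 1\<close> the inequality of order \<open>1/2\<close> is used, together
  with \<open>H1_embedding\<close>.\<close>

lemma friedrichs_norm:
  assumes s: "0 < s" "s \<le> 1" and \<eta>: "\<eta> > 0"
  shows "\<exists>\<B> K. finite \<B> \<and> K \<ge> 0 \<and> \<B> \<subseteq> sets M \<and> (\<forall>\<phi>\<in>S. L2 \<phi>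
     \<le> \<eta> * (Hs_norm s \<Omega> \<phi>)\<^sup>2 + K * (\<Sum>B\<in>\<B>. (\<integral>x. \<phi> x * indicator B x \<partial>M)\<^sup>2))"
proof -
  obtain s' D where s': "0 < s'" "s' < 1" and D: "D > 0"
    "\<forall>\<phi>\<in>S. Hs_semi_sq s' \<Omega> \<phi> \<le> ennreal D * Hs_norm_sq s \<Omega> \<phi>"
  proof (cases "s < 1")
    case True
    have "\<forall>\<phi>\<in>S. Hs_semi_sq s \<Omega> \<phi> \<le> ennreal 1 * Hs_norm_sq s \<Omega> \<phi>" by (simp add: Hs_norm_sq_nL2)
    then show ?thesis using that[of s 1] s True by simp
  next
    case False
    obtain D where "D > 0" "\<forall>\<phi>\<in>borel_measurable M. Hs_semi_sq (1/2) \<Omega> \<phi> \<le> ennreal D * Hs_norm_sq 1 \<Omega> \<phi>"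
      using H1_embedding[of "1/2"] by auto
    then show ?thesis using that[of "1/2" D] s False Cinf_measurable by simp
  qed
  have "\<eta> / D > 0" using \<eta> D by simp
  from friedrichs[OF s' this] obtain \<B> K where B: "finite \<B>" "K \<ge> 0" "\<B> \<subseteq> sets M"
    "\<forall>\<phi>\<in>S. ennreal (L2 \<phi>) \<le> ennreal (\<eta> / D) * Hs_semi_sq s' \<Omega> \<phi> + ennreal (K * (\<Sum>B\<in>\<B>. (\<integral>x. \<phi> x * indicator B x \<partial>M)\<^sup>2))"
    by (elim exE conjE)
  have "L2 \<phi> \<le> \<eta> * (Hs_norm s \<Omega> \<phi>)\<^sup>2 + K * (\<Sum>B\<in>\<B>. (\<integral>x. \<phi> x * indicator B x \<partial>M)\<^sup>2)" if \<phi>: "\<phi> \<in> S" for \<phi>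
  proof -
    let ?T = "K * (\<Sum>B\<in>\<B>. (\<integral>x. \<phi> x * indicator B x \<partial>M)\<^sup>2)"
    have T: "?T \<ge> 0" using B(2) by (intro mult_nonneg_nonneg sum_nonneg) auto
    have "ennreal (L2 \<phi>) \<le> ennreal (\<eta> / D) * Hs_semi_sq s' \<Omega> \<phi> + ennreal ?T" using B(4) \<phi> by blast
    also have "\<dots> \<le> ennreal (\<eta> / D) * (ennreal D * Hs_norm_sq s \<Omega> \<phi>) + ennreal ?T"
      using D \<phi> by (intro add_right_mono mult_left_mono) auto
    also have "\<dots> = ennreal (\<eta> * (Hs_norm s \<Omega> \<phi>)\<^sup>2) + ennreal ?T"
      using D \<eta> s \<phi> by (simp add: Hs_norm_sq_Cinf mult.assoc[symmetric] ennreal_mult[symmetric])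
    also have "\<dots> = ennreal (\<eta> * (Hs_norm s \<Omega> \<phi>)\<^sup>2 + ?T)" using \<eta> T by (intro ennreal_plus[symmetric]) auto
    finally show ?thesis using \<eta> T by (subst (asm) ennreal_le_iff) auto
  qed
  then show ?thesis using B by blast
qed

lemma integrable_Cinf_indicator: "\<phi> \<in> S \<Longrightarrow> B \<in> sets M \<Longrightarrow> integrable M (\<lambda>x. \<phi> x * indicator B x)"
proof -
  assume \<phi>: "\<phi> \<in> S" and B [measurable]: "B \<in> sets M"
  obtain K where "\<forall>x\<in>F. \<bar>\<phi> x\<bar> \<le> K" using Cinf_bounded[OF \<phi>] by blast
  then have "\<forall>x\<in>F. \<bar>\<phi> x * indicator B x\<bar> \<le> K" by (auto simp: indicator_def)
  moreover have "(\<lambda>x. \<phi> x * indicator B x) \<in> borel_measurable M" using Cinf_measurable[OF \<phi>] by measurable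
  ultimately show ?thesis by (rule bounded_integrable[rotated])
qed

lemma integral_Cinf_bound:
  assumes \<phi>: "\<phi> \<in> S" and B: "B \<in> sets M"
  shows "\<bar>\<integral>x. \<phi> x * indicator B x \<partial>M\<bar> \<le> measure M F + L2 \<phi>"
proof -
  have i: "integrable M (\<lambda>x. (\<phi> x)\<^sup>2)" using Cinf_sq_integrable[OF \<phi> \<phi>] by (simp add: power2_eq_square)
  have "\<bar>\<integral>x. \<phi> x * indicator B x \<partial>M\<bar> \<le> (\<integral>x. \<bar>\<phi> x * indicator B x\<bar> \<partial>M)" by (rule integral_abs_bound)
  also have "\<dots> \<le> (\<integral>x. 1 + (\<phi> x)\<^sup>2 \<partial>M)"
  proof (rule integral_mono)
    fix x
    have "\<bar>\<phi> x\<bar> \<le> 1 + (\<phi> x)\<^sup>2"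
      using zero_le_power2[of "\<bar>\<phi> x\<bar> - 1"] by (simp add: power2_diff)
    then show "\<bar>\<phi> x * indicator B x\<bar> \<le> 1 + (\<phi> x)\<^sup>2" by (auto simp: indicator_def)
  qed (use integrable_Cinf_indicator[OF \<phi> B] i in auto)
  also have "\<dots> = measure M F + L2 \<phi>" using i by (simp add: L2_def)
  finally show ?thesis .
qed

text \<open>\<open>friedrichs_norm\<close> with \<open>1 / Suc k\<close> in place of \<eta>, for all
  \<open>k\<close>, involves countably many averages, each bounded along the sequence. A diagonal
  subsequence makes all of them converge. The L^2 distance of two members is then at most
  \<open>4 * R / Suc k\<close> plus a finite sum of squared differences of averages, which tends to
  zero.\<close>

lemma compactness:
  assumes s: "0 < s" "s \<le> 1" and \<phi>: "\<And>n. \<phi> n \<in> S" and R: "\<And>n. (Hs_norm s \<Omega> (\<phi> n))\<^sup>2 \<le> R"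
  shows "\<exists>r. strict_mono (r :: nat \<Rightarrow> nat) \<and>
    (\<forall>\<epsilon>>0. \<exists>n0. \<forall>m\<ge>n0. \<forall>n\<ge>n0. L2 (\<lambda>x. \<phi> (r m) x - \<phi> (r n) x) < \<epsilon>)"
proof -
  define l where "l B f = (\<integral>x. f x * indicator B x \<partial>M)" for B and f :: "'a \<Rightarrow> real"
  have "\<forall>k. \<exists>p. finite (fst p) \<and> snd p \<ge> 0 \<and> fst p \<subseteq> sets M \<and> (\<forall>f\<in>S. L2 f
     \<le> 1 / Suc k * (Hs_norm s \<Omega> f)\<^sup>2 + snd p * (\<Sum>B\<in>fst p. (l B f)\<^sup>2))"
  proof
    fix k :: nat
    have "1 / real (Suc k) > 0" by simp
    from friedrichs_norm[OF s this] obtain \<B> K where "finite \<B>" "K \<ge> 0" "\<B> \<subseteq> sets M"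
      "\<forall>f\<in>S. L2 f \<le> 1 / real (Suc k) * (Hs_norm s \<Omega> f)\<^sup>2 + K * (\<Sum>B\<in>\<B>. (l B f)\<^sup>2)"
      unfolding l_def by (elim exE conjE)
    then show "\<exists>p. finite (fst p) \<and> snd p \<ge> 0 \<and> fst p \<subseteq> sets M \<and> (\<forall>f\<in>S. L2 f
     \<le> 1 / Suc k * (Hs_norm s \<Omega> f)\<^sup>2 + snd p * (\<Sum>B\<in>fst p. (l B f)\<^sup>2))"
      by (intro exI[of _ "(\<B>, K)"]) simp
  qed
  from choice[OF this] obtain p where p: "\<forall>k. finite (fst (p k)) \<and> snd (p k) \<ge> 0 \<and> fst (p k) \<subseteq> sets M \<and> (\<forall>f\<in>S. L2 f
     \<le> 1 / Suc k * (Hs_norm s \<Omega> f)\<^sup>2 + snd (p k) * (\<Sum>B\<in>fst (p k). (l B f)\<^sup>2))" by (rule exE)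
  \<comment> \<open>The empty set is added so that \<open>from_nat_into\<close> enumerates a
    nonempty set.\<close>
  define C where "C = insert {} (\<Union>k. fst (p k))"
  have cC: "countable C" unfolding C_def using p by (auto intro: countable_finite)
  have Cm: "C \<subseteq> sets M" using p by (auto simp: C_def)
  define B where "B = from_nat_into C"
  have rB: "range B = C" unfolding B_def using cC by (intro range_from_nat_into) (auto simp: C_def)
  have L2R: "L2 (\<phi> n) \<le> R" for n
  proof -
    have "L2 (\<phi> n) \<le> (Hs_norm s \<Omega> (\<phi> n))\<^sup>2" using Hs_norm_sq_split[of s "\<phi> n"] s \<phi> by simp
    then show ?thesis using R[of n] by linarith
  qed
  interpret sub: subseqs "\<lambda>n t. convergent (\<lambda>i. l (B n) (\<phi> (t i)))"
  proof
    fix n and t :: "nat \<Rightarrow> nat" assume "strict_mono t"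
    have "bounded (range (\<lambda>i. l (B n) (\<phi> (t i))))"
    proof (rule boundedI)
      fix y assume "y \<in> range (\<lambda>i. l (B n) (\<phi> (t i)))"
      then obtain i where y: "y = l (B n) (\<phi> (t i))" by blast
      have "B n \<in> sets M" using rB Cm by blast
      from integral_Cinf_bound[OF \<phi>[of "t i"] this] show "norm y \<le> measure M F + R"
        using L2R[of "t i"] by (simp add: y l_def)
    qed
    then obtain y r' where "strict_mono r'" "((\<lambda>i. l (B n) (\<phi> (t i))) \<circ> r') \<longlonglongrightarrow> y"
      using bounded_imp_convergent_subsequence by blast
    then show "\<exists>r'. strict_mono r' \<and> convergent (\<lambda>i. l (B n) (\<phi> ((t \<circ> r') i)))"
      by (auto simp: convergent_def o_def)
  qed
  define r where "r = sub.diagseq"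
  have r: "strict_mono r" unfolding r_def by (rule sub.subseq_diagseq)
  have conv: "convergent (\<lambda>i. l b (\<phi> (r i)))" if b: "b \<in> C" for b
  proof -
    obtain n where n: "b = B n" using b rB by blast
    have "convergent (\<lambda>i. l (B n) (\<phi> ((r \<circ> (+) (Suc n)) i)))" unfolding r_def
    proof (rule sub.diagseq_holds)
      fix t u :: "nat \<Rightarrow> nat" and m assume "strict_mono u" "convergent (\<lambda>i. l (B m) (\<phi> (t i)))"
      then show "convergent (\<lambda>i. l (B m) (\<phi> ((t \<circ> u) i)))"
        using convergent_subseq_convergent[of "\<lambda>i. l (B m) (\<phi> (t i))" u] by (simp add: o_def)
    qed
    then have "convergent (\<lambda>i. l (B n) (\<phi> (r (i + Suc n))))" by (simp add: o_def add.commute)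
    then show ?thesis unfolding n by (subst (asm) convergent_ignore_initial_segment)
  qed
  then have "\<forall>b\<in>C. \<exists>y. (\<lambda>i. l b (\<phi> (r i))) \<longlonglongrightarrow> y" by (simp add: convergent_def)
  from bchoice[OF this] obtain y where y: "\<forall>b\<in>C. (\<lambda>i. l b (\<phi> (r i))) \<longlonglongrightarrow> y b" by (rule exE)
  have "\<exists>n0. \<forall>m\<ge>n0. \<forall>n\<ge>n0. L2 (\<lambda>x. \<phi> (r m) x - \<phi> (r n) x) < \<epsilon>" if \<epsilon>: "\<epsilon> > 0" for \<epsilon>
  proof -
    have R0: "R \<ge> 0" using R[of 0] by (meson order_trans zero_le_power2)
    \<comment> \<open>Differences of members have squared norm at most \<open>4 * R\<close>, so this
      \<open>k\<close> brings their share below \<open>\<epsilon> / 2\<close>; the averages account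
      for the other half.\<close>
    obtain k where k: "8 * (R + 1) / \<epsilon> < real k" using reals_Archimedean2 by blast
    have k': "4 * R / Suc k < \<epsilon> / 2"
    proof -
      have "8 * (R + 1) < real k * \<epsilon>" using k \<epsilon> by (simp add: divide_less_eq)
      also have "\<dots> \<le> real (Suc k) * \<epsilon>" using \<epsilon> by (intro mult_right_mono) auto
      finally have "8 * R < real (Suc k) * \<epsilon>" by simp
      then show ?thesis by (simp add: divide_less_eq mult.commute del: of_nat_Suc)
    qed
    define \<B> where "\<B> = fst (p k)"
    define K where "K = snd (p k)"
    have \<B>: "finite \<B>" "\<B> \<subseteq> C" "\<B> \<subseteq> sets M" "K \<ge> 0" using p by (auto simp: \<B>_def K_def C_def)
    have fr: "L2 f \<le> 1 / Suc k * (Hs_norm s \<Omega> f)\<^sup>2 + K * (\<Sum>B\<in>\<B>. (l B f)\<^sup>2)" if "f \<in> S" for f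
      using p that unfolding \<B>_def K_def by blast
    define E where "E n = K * (\<Sum>b\<in>\<B>. (l b (\<phi> (r n)) - y b)\<^sup>2)" for n
    have "E \<longlonglongrightarrow> K * (\<Sum>b\<in>\<B>. (y b - y b)\<^sup>2)"
      unfolding E_def using y \<B>(2) by (intro tendsto_intros) auto
    then have "E \<longlonglongrightarrow> 0" by simp
    then have "\<forall>\<^sub>F n in sequentially. E n < \<epsilon> / 8" using \<epsilon> by (intro order_tendstoD(2)) auto
    then obtain n0 where n0: "\<forall>n\<ge>n0. E n < \<epsilon> / 8" by (auto simp: eventually_sequentially)
    have "L2 (\<lambda>x. \<phi> (r m) x - \<phi> (r n) x) < \<epsilon>" if mn: "m \<ge> n0" "n \<ge> n0" for m n
    proof -
      let ?d = "\<lambda>x. \<phi> (r m) x - \<phi> (r n) x"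
      have dS: "?d \<in> S" by (rule Cinf_diff[OF \<phi> \<phi>])
      have "(Hs_norm s \<Omega> ?d)\<^sup>2 \<le> 2 * (Hs_norm s \<Omega> (\<phi> (r m)))\<^sup>2 + 2 * (Hs_norm s \<Omega> (\<phi> (r n)))\<^sup>2"
        using s by (intro Hs_norm_diff \<phi>) auto
      then have "(Hs_norm s \<Omega> ?d)\<^sup>2 \<le> 4 * R" using R[of "r m"] R[of "r n"] by linarith
      then have 1: "1 / Suc k * (Hs_norm s \<Omega> ?d)\<^sup>2 \<le> 1 / Suc k * (4 * R)" by (intro mult_left_mono) auto
      have "(\<Sum>b\<in>\<B>. (l b ?d)\<^sup>2) \<le> (\<Sum>b\<in>\<B>. 2 * (l b (\<phi> (r m)) - y b)\<^sup>2 + 2 * (l b (\<phi> (r n)) - y b)\<^sup>2)"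
      proof (rule sum_mono)
        fix b assume "b \<in> \<B>"
        then have bm: "b \<in> sets M" using \<B> by blast
        have "l b ?d = l b (\<phi> (r m)) - l b (\<phi> (r n))"
          unfolding l_def left_diff_distrib using integrable_Cinf_indicator[OF \<phi> bm] by simp
        then have "l b ?d = (l b (\<phi> (r m)) - y b) + - (l b (\<phi> (r n)) - y b)" by simp
        then show "(l b ?d)\<^sup>2 \<le> 2 * (l b (\<phi> (r m)) - y b)\<^sup>2 + 2 * (l b (\<phi> (r n)) - y b)\<^sup>2"
          using norm_add_sq_le[of "l b (\<phi> (r m)) - y b" "- (l b (\<phi> (r n)) - y b)"]
          by (simp only: real_norm_def power2_abs abs_minus_cancel)
      qed
      from mult_left_mono[OF this \<B>(4)] have 2: "K * (\<Sum>b\<in>\<B>. (l b ?d)\<^sup>2) \<le> 2 * E m + 2 * E n"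
        by (simp add: E_def sum.distrib sum_distrib_left[symmetric] distrib_left mult.left_commute)
      have "E m < \<epsilon> / 8" "E n < \<epsilon> / 8" using n0 mn by auto
      then show ?thesis using fr[OF dS] 1 2 k' by simp
    qed
    then show ?thesis by blast
  qed
  then show ?thesis using r by blast
qed

text \<open>The L^2 limit exists by \<open>nL2_complete\<close>. For \<open>s < 1\<close>, Fatou's
  lemma in each of the two integrals bounds the semi-norm of the error. For \<open>s = 1\<close>,
  gradients of the members are built that form an L^2-Cauchy sequence, and closedness of the
  gradient identifies their limit; there a subsequence is taken.\<close>

lemma Cinf_complete:
  fixes \<psi> :: "nat \<Rightarrow> 'a \<Rightarrow> real"
  assumes s: "0 < s" "s \<le> 1" and \<psi>: "\<And>n. \<psi> n \<in> S"
    and cauchy: "\<And>\<epsilon>. \<epsilon> > 0 \<Longrightarrow> \<exists>n0. \<forall>m\<ge>n0. \<forall>n\<ge>n0. Hs_norm_sq s \<Omega> (\<lambda>x. \<psi> m x - \<psi> n x) \<le> ennreal \<epsilon>"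
  shows "\<exists>\<phi>\<in>Hs s \<Omega>. \<exists>r. strict_mono r \<and> (\<lambda>n. Hs_norm_sq s \<Omega> (\<lambda>x. \<psi> (r n) x - \<phi> x)) \<longlonglongrightarrow> 0"
proof -
  have \<psi>m [measurable]: "\<psi> n \<in> borel_measurable M" for n by (rule Cinf_measurable[OF \<psi>])
  have fin: "nL2 M (\<psi> n) < \<infinity>" for n by (simp add: nL2_Cinf[OF \<psi>])
  have cauchy2: "\<exists>n0. \<forall>m\<ge>n0. \<forall>n\<ge>n0. nL2 M (\<lambda>x. \<psi> m x - \<psi> n x) \<le> ennreal \<epsilon>" if "\<epsilon> > 0" for \<epsilon>
  proof -
    from cauchy[OF that] obtain n0 where "\<forall>m\<ge>n0. \<forall>n\<ge>n0. Hs_norm_sq s \<Omega> (\<lambda>x. \<psi> m x - \<psi> n x) \<le> ennreal \<epsilon>" by blast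
    moreover have "nL2 M f \<le> Hs_norm_sq s \<Omega> f" for f by (simp add: Hs_norm_sq_nL2)
    ultimately have "\<forall>m\<ge>n0. \<forall>n\<ge>n0. nL2 M (\<lambda>x. \<psi> m x - \<psi> n x) \<le> ennreal \<epsilon>"
      using order_trans by blast
    then show ?thesis by blast
  qed
  have "\<exists>v r. v \<in> borel_measurable M \<and> strict_mono r \<and> (AE x in M. (\<lambda>i. \<psi> (r i) x) \<longlonglongrightarrow> v x) \<and>
      (\<lambda>n. nL2 M (\<lambda>x. \<psi> n x - v x)) \<longlonglongrightarrow> 0"
    by (rule M.nL2_complete[OF \<psi>m fin]) (rule cauchy2)
  then obtain v q where v: "v \<in> borel_measurable M" "strict_mono q"
    "AE x in M. (\<lambda>i. \<psi> (q i) x) \<longlonglongrightarrow> v x" "(\<lambda>n. nL2 M (\<lambda>x. \<psi> n x - v x)) \<longlonglongrightarrow> 0" by (elim exE conjE)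
  \<comment> \<open>Members of \<open>Hs\<close> vanish off the boundary, where the limit
    \<open>v\<close> is arbitrary.\<close>
  define \<phi> where "\<phi> x = (if x \<in> F then v x else 0)" for x
  have \<phi>v: "\<phi> x = v x" if "x \<in> space M" for x using that by (simp add: \<phi>_def)
  have \<phi>m [measurable]: "\<phi> \<in> borel_measurable M" using v(1) measurable_cong[of M \<phi> v] \<phi>v by blast
  have \<phi>ae: "AE x in M. (\<lambda>i. \<psi> (q i) x) \<longlonglongrightarrow> \<phi> x"
    using v(3) AE_space by eventually_elim (simp add: \<phi>v)
  have "nL2 M (\<lambda>x. \<psi> n x - v x) = nL2 M (\<lambda>x. \<psi> n x - \<phi> x)" for n
    unfolding nL2_def by (intro nn_integral_cong) (simp add: \<phi>v)
  then have \<phi>lim: "(\<lambda>n. nL2 M (\<lambda>x. \<psi> n x - \<phi> x)) \<longlonglongrightarrow> 0" using v(4) by simp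
  have "\<exists>r. strict_mono r \<and> (\<lambda>n. Hs_semi_sq s \<Omega> (\<lambda>x. \<psi> (r n) x - \<phi> x)) \<longlonglongrightarrow> 0"
  proof (cases "s < 1")
    case True
    have "\<exists>n0. \<forall>n\<ge>n0. Hs_semi_sq s \<Omega> (\<lambda>x. \<psi> n x - \<phi> x) \<le> ennreal \<epsilon>" if \<epsilon>: "\<epsilon> > 0" for \<epsilon>
    proof -
      from cauchy[OF that] obtain n0 where n0: "\<forall>m\<ge>n0. \<forall>n\<ge>n0. Hs_norm_sq s \<Omega> (\<lambda>x. \<psi> m x - \<psi> n x) \<le> ennreal \<epsilon>" by blast
      have "Hs_semi_sq s \<Omega> (\<lambda>x. \<psi> n x - \<phi> x) \<le> ennreal \<epsilon>" if n: "n \<ge> n0" for n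
      proof -
        define k where "k i x y = kern s (\<lambda>x. \<psi> n x - \<psi> (q i) x) x y" for i x y
        have km: "(\<lambda>(x, y). k i x y) \<in> borel_measurable (M \<Otimes>\<^sub>M M)" for i
          unfolding k_def by (rule kern_measurable) measurable
        have kmy: "(\<lambda>y. k i x y) \<in> borel_measurable M" for i x
          unfolding k_def kern_def by measurable
        have semi: "Hs_semi_sq s \<Omega> f = (\<integral>\<^sup>+x. (\<integral>\<^sup>+y. kern s f x y \<partial>M) \<partial>M)" for f
          using s True by (simp add: Hs_semi_sq_def kern_def)
        have "Hs_semi_sq s \<Omega> (\<lambda>x. \<psi> n x - \<phi> x) \<le> (\<integral>\<^sup>+x. liminf (\<lambda>i. \<integral>\<^sup>+y. k i x y \<partial>M) \<partial>M)"
          unfolding semi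
        proof (rule nn_integral_mono_AE)
          show "AE x in M. (\<integral>\<^sup>+y. kern s (\<lambda>x. \<psi> n x - \<phi> x) x y \<partial>M) \<le> liminf (\<lambda>i. \<integral>\<^sup>+y. k i x y \<partial>M)"
            using \<phi>ae
          proof eventually_elim
            case (elim x)
            have "(\<integral>\<^sup>+y. kern s (\<lambda>x. \<psi> n x - \<phi> x) x y \<partial>M) = (\<integral>\<^sup>+y. liminf (\<lambda>i. k i x y) \<partial>M)"
            proof (rule nn_integral_cong_AE)
              show "AE y in M. kern s (\<lambda>x. \<psi> n x - \<phi> x) x y = liminf (\<lambda>i. k i x y)"
                using \<phi>ae
              proof eventually_elim
                case y: (elim y)
                have "(\<lambda>i. (\<psi> n x - \<psi> (q i) x - (\<psi> n y - \<psi> (q i) y))\<^sup>2 * inverse (norm (x - y) powr (real (DIM('a) - 1) + 2 * s)))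
                    \<longlonglongrightarrow> (\<psi> n x - \<phi> x - (\<psi> n y - \<phi> y))\<^sup>2 * inverse (norm (x - y) powr (real (DIM('a) - 1) + 2 * s))"
                  by (intro tendsto_mult tendsto_power tendsto_diff tendsto_const elim y)
                then have "(\<lambda>i. k i x y) \<longlonglongrightarrow> kern s (\<lambda>x. \<psi> n x - \<phi> x) x y"
                  unfolding k_def kern_def divide_inverse by (rule tendsto_ennrealI)
                then show ?case by (rule lim_imp_Liminf[OF trivial_limit_sequentially, symmetric])
              qed
            qed
            also have "\<dots> \<le> liminf (\<lambda>i. \<integral>\<^sup>+y. k i x y \<partial>M)" by (rule nn_integral_liminf[OF kmy])
            finally show ?case .
          qed
        qed
        also have "\<dots> \<le> liminf (\<lambda>i. \<integral>\<^sup>+x. (\<integral>\<^sup>+y. k i x y \<partial>M) \<partial>M)"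
          by (rule nn_integral_liminf) (rule M.borel_measurable_nn_integral[OF km])
        also have "\<dots> \<le> ennreal \<epsilon>"
        proof (rule Liminf_le)
          have "\<forall>\<^sub>F i in sequentially. i \<ge> n0" by (rule eventually_ge_at_top)
          then show "\<forall>\<^sub>F i in sequentially. (\<integral>\<^sup>+x. (\<integral>\<^sup>+y. k i x y \<partial>M) \<partial>M) \<le> ennreal \<epsilon>"
          proof eventually_elim
            case (elim i)
            then have "q i \<ge> n0" using seq_suble[OF v(2), of i] by linarith
            then have "Hs_norm_sq s \<Omega> (\<lambda>x. \<psi> n x - \<psi> (q i) x) \<le> ennreal \<epsilon>" using n0 n by blast
            moreover have "Hs_semi_sq s \<Omega> f \<le> Hs_norm_sq s \<Omega> f" for f by (simp add: Hs_norm_sq_nL2)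
            ultimately show ?case unfolding k_def semi[symmetric] using order_trans by blast
          qed
        qed simp
        finally show ?thesis .
      qed
      then show ?thesis by blast
    qed
    then have "(\<lambda>n. Hs_semi_sq s \<Omega> (\<lambda>x. \<psi> n x - \<phi> x)) \<longlonglongrightarrow> 0" by (rule tendsto_0_ennrealI)
    then show ?thesis by (intro exI[of _ "\<lambda>n. n"]) (simp add: strict_mono_def)
  next
    case False
    then have s1: "s = 1" using s by simp
    \<comment> \<open>\<open>nL2_add\<close> doubles squared norms at each telescoping step. With
      ratio \<open>1/8\<close> the doubled errors still sum up:
      \<open>2 * e m + 2 * (4 * e (Suc m)) = 3 * e m\<close>, which is at most
      \<open>4 * e m\<close>.\<close>
    define e where "e k = (1/8::real) ^ k" for k
    have e: "e k > 0" for k by (simp add: e_def)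
    have "\<forall>k. \<exists>n0. \<forall>m\<ge>n0. \<forall>n\<ge>n0. Hs_norm_sq s \<Omega> (\<lambda>x. \<psi> m x - \<psi> n x) \<le> ennreal (e k / 2)"
      using cauchy e by (meson half_gt_zero)
    from choice[OF this] obtain N where N: "\<forall>k. \<forall>m\<ge>N k. \<forall>n\<ge>N k. Hs_norm_sq s \<Omega> (\<lambda>x. \<psi> m x - \<psi> n x) \<le> ennreal (e k / 2)"
      by (rule exE)
    \<comment> \<open>The sum exceeds every \<open>N i\<close> with \<open>i \<le> k\<close>, and
      the summand \<open>k\<close> makes the sequence strictly increasing.\<close>
    define r where "r k = k + (\<Sum>i\<le>k. N i)" for k
    have r: "strict_mono r" by (rule strict_monoI_Suc) (simp add: r_def)
    have rN: "r k \<ge> N k" "r (Suc k) \<ge> N k" for k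
    proof -
      have "N k \<le> (\<Sum>i\<le>k. N i)" by (intro member_le_sum) auto
      then show "r k \<ge> N k" "r (Suc k) \<ge> N k" by (simp_all add: r_def)
    qed
    have "\<exists>G. has_H1_gradient \<Omega> (\<lambda>x. \<psi> (r k) x - \<psi> (r (Suc k)) x) G \<and> nL2 M G \<le> ennreal (e k)" for k
    proof -
      have "Hs_norm_sq 1 \<Omega> (\<lambda>x. \<psi> (r k) x - \<psi> (r (Suc k)) x) \<le> ennreal (e k / 2)"
        using N rN[of k] unfolding s1 by blast
      moreover have "Hs_semi_sq 1 \<Omega> f \<le> Hs_norm_sq 1 \<Omega> f" for f by (simp add: Hs_norm_sq_nL2)
      ultimately have "Hs_semi_sq 1 \<Omega> (\<lambda>x. \<psi> (r k) x - \<psi> (r (Suc k)) x) \<le> ennreal (e k / 2)"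
        using order_trans by blast
      also have "\<dots> < ennreal (e k)" using e[of k] by (simp add: ennreal_less_iff)
      finally show ?thesis unfolding Hs_semi_sq_1 INF_less_iff by (auto intro: less_imp_le)
    qed
    then have "\<forall>k. \<exists>G. has_H1_gradient \<Omega> (\<lambda>x. \<psi> (r k) x - \<psi> (r (Suc k)) x) G \<and> nL2 M G \<le> ennreal (e k)" by (rule allI)
    from choice[OF this] obtain G where G: "\<forall>k. has_H1_gradient \<Omega> (\<lambda>x. \<psi> (r k) x - \<psi> (r (Suc k)) x) (G k) \<and> nL2 M (G k) \<le> ennreal (e k)"
      by (rule exE)
    have "Hs_semi_sq 1 \<Omega> (\<psi> (r 0)) < \<infinity>"
      using Hs_norm_sq_Cinf_finite[of 1, OF _ _ \<psi>] by (simp add: Hs_norm_sq_nL2)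
    then obtain g0 where g0: "has_H1_gradient \<Omega> (\<psi> (r 0)) g0" "nL2 M g0 < \<infinity>"
      unfolding Hs_semi_sq_1 INF_less_iff by auto
    \<comment> \<open>Gradients of consecutive differences that nearly attain the infimum are
      subtracted from a gradient of the first member. Each \<open>g n\<close> is a gradient of
      \<open>\<psi> (r n)\<close>, with small increments by construction.\<close>
    define g where "g n x = g0 x - (\<Sum>k<n. G k x)" for n x
    have gH: "has_H1_gradient \<Omega> (\<psi> (r n)) (g n)" for n
    proof (induction n)
      case 0
      then show ?case using g0(1) by (simp add: g_def[abs_def])
    next
      case (Suc n)
      have "has_H1_gradient \<Omega> (\<lambda>x. \<psi> (r n) x - (\<psi> (r n) x - \<psi> (r (Suc n)) x)) (\<lambda>x. g n x - G n x)"
        using G by (intro has_H1_gradient_diff Suc) auto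
      moreover have "(\<lambda>x. g n x - G n x) = g (Suc n)" by (simp add: g_def fun_eq_iff)
      ultimately show ?case by simp
    qed
    have gm [measurable]: "g n \<in> borel_measurable M" "G n \<in> borel_measurable M" for n
      using gH G unfolding has_H1_gradient_iff by blast+
    have gdiff: "nL2 M (\<lambda>x. g m x - g (m + j) x) \<le> ennreal (4 * e m)" for m j
    proof (induction j arbitrary: m)
      case 0
      then show ?case by (simp add: nL2_def)
    next
      case (Suc j)
      have "g m x - g (m + Suc j) x = G m x + (g (Suc m) x - g (Suc m + j) x)" for x
        by (simp add: g_def)
      then have "nL2 M (\<lambda>x. g m x - g (m + Suc j) x) = nL2 M (\<lambda>x. G m x + (g (Suc m) x - g (Suc m + j) x))"
        by (simp only:)
      also have "\<dots> \<le> 2 * nL2 M (G m) + 2 * nL2 M (\<lambda>x. g (Suc m) x - g (Suc m + j) x)"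
        by (rule nL2_add) measurable
      also have "\<dots> \<le> 2 * ennreal (e m) + 2 * ennreal (4 * e (Suc m))"
        using G Suc.IH[of "Suc m"] by (intro add_mono mult_left_mono) auto
      also have "\<dots> = ennreal (2 * e m + 2 * (4 * e (Suc m)))"
        using e[of m] e[of "Suc m"] by (simp add: ennreal_mult less_imp_le)
      also have "\<dots> \<le> ennreal (4 * e m)" using e[of m] by (intro ennreal_leI) (simp add: e_def)
      finally show ?case .
    qed
    have gfin: "nL2 M (g n) < \<infinity>" for n
    proof -
      have "nL2 M (\<lambda>x. g 0 x - (g 0 x - g n x)) \<le> 2 * nL2 M (g 0) + 2 * nL2 M (\<lambda>x. g 0 x - g n x)"
        by (rule nL2_diff) measurable
      also have "\<dots> \<le> 2 * nL2 M g0 + 2 * ennreal (4 * e 0)"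
      proof (intro add_mono mult_left_mono)
        have "g 0 = g0" by (simp add: g_def fun_eq_iff)
        then show "nL2 M (g 0) \<le> nL2 M g0" by simp
        show "nL2 M (\<lambda>x. g 0 x - g n x) \<le> ennreal (4 * e 0)" using gdiff[of 0 n] by (simp only: add_0)
      qed auto
      also have "\<dots> < \<infinity>" using g0(2) by (simp add: ennreal_mult_less_top)
      finally show ?thesis by simp
    qed
    have gcauchy: "\<exists>n0. \<forall>m\<ge>n0. \<forall>n\<ge>n0. nL2 M (\<lambda>x. g m x - g n x) \<le> ennreal \<epsilon>" if \<epsilon>: "\<epsilon> > 0" for \<epsilon>
    proof -
      have "(\<lambda>k. 4 * e k) \<longlonglongrightarrow> 4 * 0" unfolding e_def by (intro tendsto_intros LIMSEQ_power_zero) auto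
      then have "\<forall>\<^sub>F k in sequentially. 4 * e k < \<epsilon>" using \<epsilon> by (intro order_tendstoD(2)) auto
      then obtain n0 where n0: "\<forall>n\<ge>n0. 4 * e n < \<epsilon>" by (auto simp: eventually_sequentially)
      have le: "nL2 M (\<lambda>x. g m x - g n x) \<le> ennreal \<epsilon>" if "n0 \<le> m" "m \<le> n" for m n
      proof -
        have "nL2 M (\<lambda>x. g m x - g n x) \<le> ennreal (4 * e m)"
          using gdiff[of m "n - m"] that by simp
        also have "\<dots> \<le> ennreal \<epsilon>" using n0 that by (intro ennreal_leI less_imp_le) simp
        finally show ?thesis .
      qed
      have "nL2 M (\<lambda>x. g m x - g n x) \<le> ennreal \<epsilon>" if "n0 \<le> m" "n0 \<le> n" for m n
        using le[of m n] le[of n m] nL2_minus[of M "g m" "g n"] that by (cases "m \<le> n") auto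
      then show ?thesis by blast
    qed
    have "\<exists>v r. v \<in> borel_measurable M \<and> strict_mono r \<and> (AE x in M. (\<lambda>i. g (r i) x) \<longlonglongrightarrow> v x) \<and>
        (\<lambda>n. nL2 M (\<lambda>x. g n x - v x)) \<longlonglongrightarrow> 0"
      by (rule M.nL2_complete[OF gm(1) gfin]) (rule gcauchy)
    then obtain h where h: "h \<in> borel_measurable M"
      "(\<lambda>n. nL2 M (\<lambda>x. g n x - h x)) \<longlonglongrightarrow> 0" by (elim exE conjE)
    have \<phi>r: "(\<lambda>n. nL2 M (\<lambda>x. \<psi> (r n) x - \<phi> x)) \<longlonglongrightarrow> 0"
      using LIMSEQ_subseq_LIMSEQ[OF \<phi>lim r] by (simp add: o_def)
    have \<phi>H: "has_H1_gradient \<Omega> \<phi> h"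
      by (rule has_H1_gradient_closed[OF gH \<psi>m \<phi>m h(1) \<phi>r h(2)])
    have "(\<lambda>n. Hs_semi_sq s \<Omega> (\<lambda>x. \<psi> (r n) x - \<phi> x)) \<longlonglongrightarrow> 0"
    proof (rule tendsto_0_le_ennreal[OF _ h(2)])
      fix n
      have "has_H1_gradient \<Omega> (\<lambda>x. \<psi> (r n) x - \<phi> x) (\<lambda>x. g n x - h x)"
        by (rule has_H1_gradient_diff[OF gH \<phi>H \<psi>m \<phi>m])
      then show "Hs_semi_sq s \<Omega> (\<lambda>x. \<psi> (r n) x - \<phi> x) \<le> nL2 M (\<lambda>x. g n x - h x)"
        unfolding s1 Hs_semi_sq_1 by (intro INF_lower) simp
    qed
    then show ?thesis using r by blast
  qed
  then obtain r where r: "strict_mono r" "(\<lambda>n. Hs_semi_sq s \<Omega> (\<lambda>x. \<psi> (r n) x - \<phi> x)) \<longlonglongrightarrow> 0" by blast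
  have "(\<lambda>n. nL2 M (\<lambda>x. \<psi> (r n) x - \<phi> x)) \<longlonglongrightarrow> 0"
    using LIMSEQ_subseq_LIMSEQ[OF \<phi>lim r(1)] by (simp add: o_def)
  from tendsto_add[OF this r(2)] have lim: "(\<lambda>n. Hs_norm_sq s \<Omega> (\<lambda>x. \<psi> (r n) x - \<phi> x)) \<longlonglongrightarrow> 0"
    by (simp add: Hs_norm_sq_nL2)
  then have "\<forall>\<^sub>F n in sequentially. Hs_norm_sq s \<Omega> (\<lambda>x. \<psi> (r n) x - \<phi> x) < 1" by (intro order_tendstoD(2)) auto
  then obtain n where n: "Hs_norm_sq s \<Omega> (\<lambda>x. \<psi> (r n) x - \<phi> x) < 1"
    using eventually_happens'[OF sequentially_bot] by blast
  have "Hs_norm_sq s \<Omega> (\<lambda>x. \<psi> (r n) x - (\<psi> (r n) x - \<phi> x))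
      \<le> 2 * Hs_norm_sq s \<Omega> (\<psi> (r n)) + 2 * Hs_norm_sq s \<Omega> (\<lambda>x. \<psi> (r n) x - \<phi> x)"
    using s by (intro Hs_norm_sq_diff) auto
  also have "\<dots> < \<infinity>"
    using n Hs_norm_sq_Cinf_finite[of s, OF _ _ \<psi>] s
    by (auto simp: ennreal_mult_less_top intro: less_trans)
  finally have "\<phi> \<in> Hs s \<Omega>" by (simp add: Hs_def \<phi>_def[abs_def] \<phi>m[unfolded \<phi>_def[abs_def]])
  then show ?thesis using r(1) lim by blast
qed

end

section \<open>Coercivity of the second derivative\<close>

lemma bilinear_parallelogram:
  assumes V: "fun_subspace V" and B: "bilinear_form V B" and f: "f \<in> V" and g: "g \<in> V"
  shows "B (\<lambda>x. f x + g x) (\<lambda>x. f x + g x) + B (\<lambda>x. f x + -1 *\<^sub>R g x) (\<lambda>x. f x + -1 *\<^sub>R g x) = 2 * B f f + 2 * B g g"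
    and "B (\<lambda>x. a *\<^sub>R f x) (\<lambda>x. a *\<^sub>R f x) = a\<^sup>2 * B f f"
proof -
  have add1: "B (\<lambda>x. p x + q x) h = B p h + B q h" and add2: "B h (\<lambda>x. p x + q x) = B h p + B h q"
    if "p \<in> V" "q \<in> V" "h \<in> V" for p q h
    using B that unfolding bilinear_form_def linear_form_def by blast+
  have sc1: "B (\<lambda>x. a *\<^sub>R p x) h = a * B p h" and sc2: "B h (\<lambda>x. a *\<^sub>R p x) = a * B h p"
    if "p \<in> V" "h \<in> V" for p h a
    using B that unfolding bilinear_form_def linear_form_def by blast+
  have V': "(\<lambda>x. p x + q x) \<in> V" "(\<lambda>x. a *\<^sub>R p x) \<in> V" if "p \<in> V" "q \<in> V" for p q a
    using V that unfolding fun_subspace_def by blast+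
  show "B (\<lambda>x. a *\<^sub>R f x) (\<lambda>x. a *\<^sub>R f x) = a\<^sup>2 * B f f"
    using f by (simp add: sc1 sc2 V' power2_eq_square)
  define k where "k = (\<lambda>x. -1 *\<^sub>R g x)"
  have k: "k \<in> V" unfolding k_def by (rule V'(2)[OF g g])
  have "B k h = - B g h" "B h k = - B h g" if "h \<in> V" for h
    using sc1[OF g that, of "-1"] sc2[OF g that, of "-1"] unfolding k_def by simp_all
  note kk = this
  have "B (\<lambda>x. f x + k x) (\<lambda>x. f x + k x) = B f f + B f k + (B k f + B k k)"
    using f k by (simp only: add1 add2 V')
  also have "\<dots> = B f f - B f g - B g f + B g g" using kk f g k by simp
  finally show "B (\<lambda>x. f x + g x) (\<lambda>x. f x + g x) + B (\<lambda>x. f x + -1 *\<^sub>R g x) (\<lambda>x. f x + -1 *\<^sub>R g x) = 2 * B f f + 2 * B g g"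
    using f g unfolding k_def by (simp only: add1 add2 V')
qed

context regular_domain
begin

lemma eventually_smooth_nhds:
  "eventually P (smooth_nhds s \<Omega> \<phi>) \<longleftrightarrow> (\<exists>\<epsilon>>0. \<forall>\<psi>\<in>S. Hs_norm_sq s \<Omega> (\<lambda>x. \<psi> x - \<phi> x) < \<epsilon> \<longrightarrow> P \<psi>)"
proof -
  have "eventually P (smooth_nhds s \<Omega> \<phi>)
    \<longleftrightarrow> (\<exists>\<epsilon>\<in>{0<..}. eventually P (principal {\<psi> \<in> S. Hs_norm_sq s \<Omega> (\<lambda>x. \<psi> x - \<phi> x) < \<epsilon>}))"
    unfolding smooth_nhds_def
  proof (rule eventually_INF_base)
    fix a b :: ennreal assume "a \<in> {0<..}" "b \<in> {0<..}"
    then show "\<exists>x\<in>{0<..}. principal {\<psi> \<in> S. Hs_norm_sq s \<Omega> (\<lambda>x. \<psi> x - \<phi> x) < x}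
        \<le> inf (principal {\<psi> \<in> S. Hs_norm_sq s \<Omega> (\<lambda>x. \<psi> x - \<phi> x) < a}) (principal {\<psi> \<in> S. Hs_norm_sq s \<Omega> (\<lambda>x. \<psi> x - \<phi> x) < b})"
      by (intro bexI[of _ "min a b"]) auto
  next
    have "(1::ennreal) \<in> {0<..}" by simp
    then show "{0::ennreal<..} \<noteq> {}" by blast
  qed
  then show ?thesis by (auto simp: eventually_principal)
qed

lemma L2_parallelogram: "f \<in> S \<Longrightarrow> g \<in> S \<Longrightarrow> L2 (\<lambda>x. f x + g x) + L2 (\<lambda>x. f x - g x) = 2 * L2 f + 2 * L2 g"
proof -
  assume f: "f \<in> S" and g: "g \<in> S"
  note i = Cinf_sq_integrable[OF f f] Cinf_sq_integrable[OF g g] Cinf_sq_integrable[OF f g]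
  have e: "(f x + g x) * (f x + g x) = f x * f x + g x * g x + 2 * (f x * g x)"
    "(f x - g x) * (f x - g x) = f x * f x + g x * g x - 2 * (f x * g x)" for x
    by (simp_all add: algebra_simps)
  have "L2 (\<lambda>x. f x + g x) = L2 f + L2 g + 2 * (\<integral>x. f x * g x \<partial>M)"
    unfolding L2_def power2_eq_square e using i by simp
  moreover have "L2 (\<lambda>x. f x - g x) = L2 f + L2 g - 2 * (\<integral>x. f x * g x \<partial>M)"
    unfolding L2_def power2_eq_square e using i by simp
  ultimately show ?thesis by simp
qed

lemma L2_cmult: "L2 (\<lambda>x. a * f x) = a\<^sup>2 * L2 f"
  by (simp add: L2_def power_mult_distrib)

text \<open>\<open>lm\<close> dominates the squared semi-norm, which is the squared norm minus the
  L^2 part. By the Ehrling inequality, \<open>lr\<close> costs at most half of that constant and a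
  further multiple of the L^2 part.\<close>

lemma garding:
  assumes s: "0 < s2" "s2 \<le> 1" and C: "condition_C s2 \<Omega> l"
  shows "\<exists>c>0. \<exists>C\<ge>0. \<forall>\<phi>\<in>S. l \<phi> \<phi> \<ge> c * (Hs_norm s2 \<Omega> \<phi>)\<^sup>2 - C * L2 \<phi>"
proof -
  from C obtain s1 c1 lm lr where *: "0 \<le> s1" "s1 < s2" "0 < c1"
    "\<forall>\<phi>\<in>S. \<forall>\<psi>\<in>S. l \<phi> \<psi> = lm \<phi> \<psi> + lr \<phi> \<psi>"
    "\<forall>\<phi>\<in>S. lm \<phi> \<phi> \<ge> c1 * (Hs_seminorm s2 \<Omega> \<phi>)\<^sup>2" "form_continuous s1 \<Omega> lr"
    unfolding condition_C_def by blast
  from *(6) obtain K where K: "\<forall>\<phi>\<in>S. \<forall>\<psi>\<in>S. \<bar>lr \<phi> \<psi>\<bar> \<le> K * Hs_norm s1 \<Omega> \<phi> * Hs_norm s1 \<Omega> \<psi>"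
    unfolding form_continuous_def by blast
  \<comment> \<open>Makes \<open>\<bar>K\<bar> * \<eta> \<le> c1 / 2\<close>; absolute value and
    \<open>1\<close>, because \<open>K\<close> may be zero or negative.\<close>
  define \<eta> where "\<eta> = c1 / (2 * (\<bar>K\<bar> + 1))"
  have \<eta>: "\<eta> > 0" using *(3) by (simp add: \<eta>_def)
  have K\<eta>: "\<bar>K\<bar> * \<eta> \<le> c1 / 2" using *(3) by (simp add: \<eta>_def divide_simps)
  from ehrling[OF *(1,2) s(2) \<eta>] obtain D where D: "D \<ge> 0" "\<forall>\<phi>\<in>S. (Hs_norm s1 \<Omega> \<phi>)\<^sup>2 \<le> \<eta> * (Hs_norm s2 \<Omega> \<phi>)\<^sup>2 + D * L2 \<phi>"
    by blast
  have "l \<phi> \<phi> \<ge> c1 / 2 * (Hs_norm s2 \<Omega> \<phi>)\<^sup>2 - (c1 + \<bar>K\<bar> * D) * L2 \<phi>" if \<phi>: "\<phi> \<in> S" for \<phi>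
  proof -
    let ?N = "(Hs_norm s2 \<Omega> \<phi>)\<^sup>2"
    have "(Hs_seminorm s2 \<Omega> \<phi>)\<^sup>2 = ?N - L2 \<phi>" using Hs_norm_sq_split[of s2 \<phi>] s \<phi> by simp
    then have 1: "lm \<phi> \<phi> \<ge> c1 * ?N - c1 * L2 \<phi>" using bspec[OF *(5) \<phi>] by (simp add: right_diff_distrib)
    have "\<bar>lr \<phi> \<phi>\<bar> \<le> K * (Hs_norm s1 \<Omega> \<phi>)\<^sup>2"
      using K \<phi> by (simp add: power2_eq_square mult.assoc)
    also have "\<dots> \<le> \<bar>K\<bar> * (Hs_norm s1 \<Omega> \<phi>)\<^sup>2" by (intro mult_right_mono) auto
    also have "\<dots> \<le> \<bar>K\<bar> * (\<eta> * ?N + D * L2 \<phi>)" using D(2) \<phi> by (intro mult_left_mono) auto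
    also have "\<dots> = (\<bar>K\<bar> * \<eta>) * ?N + \<bar>K\<bar> * D * L2 \<phi>" by (simp add: distrib_left)
    also have "\<dots> \<le> c1 / 2 * ?N + \<bar>K\<bar> * D * L2 \<phi>" using K\<eta> by (intro add_right_mono mult_right_mono) auto
    finally have "lr \<phi> \<phi> \<ge> - (c1 / 2 * ?N + \<bar>K\<bar> * D * L2 \<phi>)" by linarith
    moreover have "l \<phi> \<phi> = lm \<phi> \<phi> + lr \<phi> \<phi>" using *(4) \<phi> by blast
    ultimately show ?thesis using 1 by (simp add: algebra_simps)
  qed
  then show ?thesis using *(3) D(1) by (intro exI[of _ "c1 / 2"] conjI exI[of _ "c1 + \<bar>K\<bar> * D"]) auto
qed

text \<open>\<open>shape_l2\<close> is a definite description; its algebra on smooth functions is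
  read off the bilinear summands \<open>lm\<close> and \<open>lr\<close> of the splitting.\<close>

lemma condition_C_quadratic:
  assumes "condition_C s2 \<Omega> l" "f \<in> S" "g \<in> S"
  shows "l (\<lambda>x. f x + g x) (\<lambda>x. f x + g x) + l (\<lambda>x. f x - g x) (\<lambda>x. f x - g x) = 2 * l f f + 2 * l g g"
    and "l (\<lambda>x. a * f x) (\<lambda>x. a * f x) = a\<^sup>2 * l f f"
proof -
  from assms(1) obtain lm lr where *: "bilinear_form S lm" "bilinear_form S lr"
    "\<forall>\<phi>\<in>S. \<forall>\<psi>\<in>S. l \<phi> \<psi> = lm \<phi> \<psi> + lr \<phi> \<psi>"
    unfolding condition_C_def by blast
  have q: "l h h = lm h h + lr h h" if "h \<in> S" for h using *(3) that by blast
  note m = bilinear_parallelogram[OF Cinf_subspace *(1) assms(2,3)]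
  note r = bilinear_parallelogram[OF Cinf_subspace *(2) assms(2,3)]
  show "l (\<lambda>x. f x + g x) (\<lambda>x. f x + g x) + l (\<lambda>x. f x - g x) (\<lambda>x. f x - g x) = 2 * l f f + 2 * l g g"
    using m(1) r(1) q[OF Cinf_add[OF assms(2,3)]] q[OF Cinf_diff[OF assms(2,3)]] q[OF assms(2)] q[OF assms(3)] by simp
  show "l (\<lambda>x. a * f x) (\<lambda>x. a * f x) = a\<^sup>2 * l f f"
    using m(2)[of a] r(2)[of a] q[OF Cinf_cmult[OF assms(2)]] q[OF assms(2)] by (simp add: distrib_left)
qed

text \<open>\<Lambda> is the infimum of the form on smooth functions of unit L^2 norm. For members
  \<open>u m\<close>, \<open>u n\<close> of a minimising sequence, the lower bound \<Lambda> for
  their sum and the parallelogram identities of \<open>q\<close> and \<open>L2\<close> bound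
  \<open>q\<close> of their difference by a small term plus \<Lambda> times its squared L^2 norm.
  The Garding inequality turns this into smallness in H^s.\<close>

lemma coercive:
  assumes s: "0 < s2" "s2 \<le> 1" and C: "condition_C s2 \<Omega> l"
    and pos: "\<forall>\<phi>\<in>Hs s2 \<Omega>. \<not> (AE x in M. \<phi> x = 0) \<longrightarrow> density_ext s2 \<Omega> l \<phi> > 0"
  shows "\<exists>c>0. \<forall>\<phi>\<in>S. l \<phi> \<phi> \<ge> c * (Hs_norm s2 \<Omega> \<phi>)\<^sup>2"
proof -
  from garding[OF s C] obtain c D where c: "c > 0" and D: "D \<ge> 0"
    and gard: "\<forall>\<phi>\<in>S. l \<phi> \<phi> \<ge> c * (Hs_norm s2 \<Omega> \<phi>)\<^sup>2 - D * L2 \<phi>" by blast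
  define q where "q f = l f f" for f
  have gard: "c * (Hs_norm s2 \<Omega> f)\<^sup>2 \<le> q f + D * L2 f" if "f \<in> S" for f
    using gard that by (auto simp: q_def algebra_simps)
  note par = condition_C_quadratic(1)[OF C, folded q_def]
  have qc: "q (\<lambda>x. a * f x) = a\<^sup>2 * q f" if "f \<in> S" for a f
    unfolding q_def by (rule condition_C_quadratic(2)[OF C that that])
  have normalise: "\<exists>a. L2 (\<lambda>x. a * f x) = 1 \<and> a\<^sup>2 * L2 f = 1" if "L2 f > 0" for f
  proof -
    define a where "a = 1 / sqrt (L2 f)"
    have "a\<^sup>2 * L2 f = 1" using that by (simp add: a_def power_divide)
    then show ?thesis using L2_cmult[of a f] by (intro exI[of _ a]) simp
  qed
  define A where "A = {f \<in> S. L2 f = 1}"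
  show ?thesis
  \<comment> \<open>If there is no smooth function of unit L^2 norm, \<open>L2\<close> vanishes on
    all smooth functions and the Garding inequality is already coercivity.\<close>
  proof (cases "A = {}")
    case True
    have "L2 f = 0" if "f \<in> S" for f
    proof (rule ccontr)
      assume "L2 f \<noteq> 0"
      then have "L2 f > 0" using L2_nonneg[of f] by simp
      then obtain a where "L2 (\<lambda>x. a * f x) = 1" using normalise by blast
      then have "(\<lambda>x. a * f x) \<in> A" using Cinf_cmult[OF that] by (simp add: A_def)
      then show False using True by simp
    qed
    then have "l f f \<ge> c * (Hs_norm s2 \<Omega> f)\<^sup>2" if "f \<in> S" for f
      using gard[OF that] that by (simp add: q_def)
    then show ?thesis using c by blast
  next
    case False
    have lowA: "- D \<le> q f" if "f \<in> A" for f
    proof -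
      have "0 \<le> c * (Hs_norm s2 \<Omega> f)\<^sup>2" using c by simp
      then show ?thesis using gard[of f] that by (simp add: A_def)
    qed
    have bdd: "bdd_below (q ` A)" using lowA by (intro bdd_belowI2)
    define \<Lambda> where "\<Lambda> = Inf (q ` A)"
    have \<Lambda>_le: "\<Lambda> * L2 f \<le> q f" if f: "f \<in> S" for f
    proof (cases "L2 f = 0")
      case True
      have "0 \<le> c * (Hs_norm s2 \<Omega> f)\<^sup>2" using c by simp
      then show ?thesis using gard[OF f] True by simp
    next
      case False
      then have "L2 f > 0" using L2_nonneg[of f] by simp
      then obtain a where a: "L2 (\<lambda>x. a * f x) = 1" "a\<^sup>2 * L2 f = 1" using normalise by blast
      have "(\<lambda>x. a * f x) \<in> A" using a Cinf_cmult[OF f] by (simp add: A_def)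
      then have "\<Lambda> \<le> q (\<lambda>x. a * f x)" unfolding \<Lambda>_def using bdd by (intro cInf_lower) auto
      then have "\<Lambda> \<le> a\<^sup>2 * q f" using qc[OF f] by simp
      then have "\<Lambda> * L2 f \<le> a\<^sup>2 * q f * L2 f" using L2_nonneg[of f] by (rule mult_right_mono)
      also have "\<dots> = q f" using a(2) by (simp add: mult.commute mult.left_commute)
      finally show ?thesis .
    qed
    have "\<forall>n. \<exists>f. f \<in> A \<and> q f < \<Lambda> + 1 / Suc n"
    proof
      fix n
      have "Inf (q ` A) < \<Lambda> + 1 / Suc n" by (simp add: \<Lambda>_def)
      then show "\<exists>f. f \<in> A \<and> q f < \<Lambda> + 1 / Suc n" using cInf_less_iff[OF _ bdd] False by auto
    qed
    from choice[OF this] obtain \<psi> where \<psi>: "\<forall>n. \<psi> n \<in> A \<and> q (\<psi> n) < \<Lambda> + 1 / Suc n" by (rule exE)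
    have \<psi>S: "\<psi> n \<in> S" "L2 (\<psi> n) = 1" for n using \<psi> by (auto simp: A_def)
    have "(Hs_norm s2 \<Omega> (\<psi> n))\<^sup>2 \<le> (\<Lambda> + 1 + D) / c" for n
    proof -
      have "1 / real (Suc n) \<le> 1" by simp
      moreover have "q (\<psi> n) < \<Lambda> + 1 / Suc n" using \<psi> by blast
      ultimately have "c * (Hs_norm s2 \<Omega> (\<psi> n))\<^sup>2 \<le> \<Lambda> + 1 + D" using gard[OF \<psi>S(1)[of n], unfolded \<psi>S(2)] by linarith
      then show ?thesis using c by (simp add: pos_le_divide_eq mult.commute)
    qed
    from compactness[where \<phi> = \<psi>, OF s \<psi>S(1) this] obtain r :: "nat \<Rightarrow> nat" where r: "strict_mono r"
      "\<forall>\<epsilon>>0. \<exists>n0. \<forall>m\<ge>n0. \<forall>n\<ge>n0. L2 (\<lambda>x. \<psi> (r m) x - \<psi> (r n) x) < \<epsilon>" by blast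
    define u where "u n = \<psi> (r n)" for n
    have uS: "u n \<in> S" "L2 (u n) = 1" for n using \<psi>S by (simp_all add: u_def)
    have qu: "q (u n) < \<Lambda> + 1 / Suc n" for n
    proof -
      have "n \<le> r n" using seq_suble[OF r(1)] .
      then have "1 / real (Suc (r n)) \<le> 1 / real (Suc n)" by (intro divide_left_mono) auto
      moreover have "q (u n) < \<Lambda> + 1 / Suc (r n)" using \<psi> by (simp add: u_def)
      ultimately show ?thesis by linarith
    qed
    have cauchy: "\<exists>n0. \<forall>m\<ge>n0. \<forall>n\<ge>n0. Hs_norm_sq s2 \<Omega> (\<lambda>x. u m x - u n x) \<le> ennreal \<epsilon>" if \<epsilon>: "\<epsilon> > 0" for \<epsilon>
    proof -
      \<comment> \<open>A positive bound for \<open>\<Lambda> + D\<close>; at this stage \<Lambda>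
        may be negative.\<close>
      define K where "K = \<bar>\<Lambda>\<bar> + D + 1"
      have K: "K > 0" using D by (simp add: K_def)
      have "c * \<epsilon> / (2 * K) > 0" using c \<epsilon> K by simp
      with r(2) obtain n1 where n1: "\<forall>m\<ge>n1. \<forall>n\<ge>n1. L2 (\<lambda>x. u m x - u n x) < c * \<epsilon> / (2 * K)"
        unfolding u_def by blast
      obtain n2 where n2: "1 / real (Suc n2) < c * \<epsilon> / 8"
        using reals_Archimedean[of "c * \<epsilon> / 8"] c \<epsilon> by (auto simp: inverse_eq_divide)
      have "Hs_norm_sq s2 \<Omega> (\<lambda>x. u m x - u n x) \<le> ennreal \<epsilon>" if mn: "m \<ge> max n1 n2" "n \<ge> max n1 n2" for m n
      proof -
        let ?d = "\<lambda>x. u m x - u n x"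
        have dS: "?d \<in> S" by (rule Cinf_diff[OF uS(1) uS(1)])
        have "1 / real (Suc m) \<le> 1 / real (Suc n2)" "1 / real (Suc n) \<le> 1 / real (Suc n2)"
          using mn by (auto intro!: divide_left_mono)
        then have sm: "q (u m) \<le> \<Lambda> + c * \<epsilon> / 8" "q (u n) \<le> \<Lambda> + c * \<epsilon> / 8"
          using qu[of m] qu[of n] n2 by linarith+
        have "\<Lambda> * L2 (\<lambda>x. u m x + u n x) \<le> q (\<lambda>x. u m x + u n x)"
          by (rule \<Lambda>_le[OF Cinf_add[OF uS(1) uS(1)]])
        moreover have "L2 (\<lambda>x. u m x + u n x) = 4 - L2 ?d"
          using L2_parallelogram[OF uS(1) uS(1), of m n] by (simp add: uS(2))
        \<comment> \<open>The values of \<open>q\<close> at the two members add up to at most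
          \<open>4 * \<Lambda> + c * \<epsilon> / 2\<close> after doubling, and
          \<open>4 * \<Lambda>\<close> cancels in the parallelogram identity.\<close>
        ultimately have "\<Lambda> * (4 - L2 ?d) \<le> q (\<lambda>x. u m x + u n x)" by simp
        then have "q ?d \<le> c * \<epsilon> / 2 + \<Lambda> * L2 ?d"
          using par[OF uS(1) uS(1), of m n] sm by (simp add: algebra_simps)
        then have "c * (Hs_norm s2 \<Omega> ?d)\<^sup>2 \<le> c * \<epsilon> / 2 + (\<Lambda> + D) * L2 ?d"
          using gard[OF dS] by (simp add: algebra_simps)
        also have "(\<Lambda> + D) * L2 ?d \<le> K * L2 ?d"
          using L2_nonneg by (intro mult_right_mono) (auto simp: K_def)
        also have "K * L2 ?d \<le> K * (c * \<epsilon> / (2 * K))" using n1 mn K by (intro mult_left_mono less_imp_le) auto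
        also have "K * (c * \<epsilon> / (2 * K)) = c * \<epsilon> / 2" using K by simp
        finally have "c * (Hs_norm s2 \<Omega> ?d)\<^sup>2 \<le> c * \<epsilon> / 2 + c * \<epsilon> / 2" by simp
        then have "c * (Hs_norm s2 \<Omega> ?d)\<^sup>2 \<le> c * \<epsilon>" by linarith
        then have "(Hs_norm s2 \<Omega> ?d)\<^sup>2 \<le> \<epsilon>" using c by simp
        then show ?thesis using Hs_norm_sq_Cinf[OF less_imp_le[OF s(1)] s(2) dS] by (simp add: ennreal_leI)
      qed
      then show ?thesis by blast
    qed
    have "\<exists>\<phi>\<in>Hs s2 \<Omega>. \<exists>r. strict_mono r \<and> (\<lambda>n. Hs_norm_sq s2 \<Omega> (\<lambda>x. u (r n) x - \<phi> x)) \<longlonglongrightarrow> 0"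
      by (rule Cinf_complete[OF s uS(1)]) (rule cauchy)
    then obtain \<phi> r' where \<phi>: "\<phi> \<in> Hs s2 \<Omega>" "strict_mono r'" "(\<lambda>n. Hs_norm_sq s2 \<Omega> (\<lambda>x. u (r' n) x - \<phi> x)) \<longlonglongrightarrow> 0"
      by blast
    have \<phi>m: "\<phi> \<in> borel_measurable M" using \<phi>(1) by (simp add: Hs_def)
    \<comment> \<open>Otherwise every approximating member would have L^2 distance 1 from
      \<phi>.\<close>
    have "\<not> (AE x in M. \<phi> x = 0)"
    proof
      assume ae: "AE x in M. \<phi> x = 0"
      have "nL2 M (\<lambda>x. u (r' n) x - \<phi> x) = 1" for n
      proof -
        have "nL2 M (\<lambda>x. u (r' n) x - \<phi> x) = nL2 M (u (r' n))"
          unfolding nL2_def by (rule nn_integral_cong_AE) (use ae in eventually_elim, simp)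
        then show ?thesis using nL2_Cinf[OF uS(1)] uS(2) by simp
      qed
      then have ge: "1 \<le> Hs_norm_sq s2 \<Omega> (\<lambda>x. u (r' n) x - \<phi> x)" for n by (simp add: Hs_norm_sq_nL2)
      have "(1::ennreal) \<le> 0" by (rule tendsto_lowerbound[OF \<phi>(3)]) (use ge in auto)
      then show False by simp
    qed
    then have dpos: "density_ext s2 \<Omega> l \<phi> > 0" using pos \<phi>(1) by blast
    \<comment> \<open>The extension is a lower limit over H^s neighbourhoods, each of which the
      sequence eventually enters, with values of \<open>q\<close> approaching \<Lambda>.\<close>
    have "density_ext s2 \<Omega> l \<phi> \<le> ereal \<Lambda>"
    proof (rule ccontr)
      assume "\<not> density_ext s2 \<Omega> l \<phi> \<le> ereal \<Lambda>"
      then have "ereal \<Lambda> < density_ext s2 \<Omega> l \<phi>" by simp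
      then obtain y where y: "ereal \<Lambda> < ereal y" "ereal y < density_ext s2 \<Omega> l \<phi>" using ereal_dense2 by blast
      from less_LiminfD[OF y(2)[unfolded density_ext_def]]
      obtain \<epsilon> where \<epsilon>: "\<epsilon> > 0" "\<forall>\<psi>\<in>S. Hs_norm_sq s2 \<Omega> (\<lambda>x. \<psi> x - \<phi> x) < \<epsilon> \<longrightarrow> ereal y < ereal (l \<psi> \<psi>)"
        unfolding eventually_smooth_nhds by blast
      have "\<forall>\<^sub>F n in sequentially. Hs_norm_sq s2 \<Omega> (\<lambda>x. u (r' n) x - \<phi> x) < \<epsilon>"
        by (rule order_tendstoD(2)[OF \<phi>(3) \<epsilon>(1)])
      then obtain n1 where n1: "\<forall>n\<ge>n1. Hs_norm_sq s2 \<Omega> (\<lambda>x. u (r' n) x - \<phi> x) < \<epsilon>" by (auto simp: eventually_sequentially)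
      obtain n2 where n2: "1 / real (Suc n2) < y - \<Lambda>"
        using reals_Archimedean[of "y - \<Lambda>"] y(1) by (auto simp: inverse_eq_divide)
      define n where "n = max n1 n2"
      have "y < q (u (r' n))" using \<epsilon>(2) n1 uS(1) by (auto simp: n_def q_def)
      moreover have "n2 \<le> r' n" using seq_suble[OF \<phi>(2), of n] by (simp add: n_def)
      then have "1 / real (Suc (r' n)) \<le> 1 / real (Suc n2)" by (intro divide_left_mono) auto
      ultimately show False using qu[of "r' n"] n2 by linarith
    qed
    with dpos have \<Lambda>: "\<Lambda> > 0" by (metis ereal_less(2) less_le_trans)
    \<comment> \<open>From \<open>c * (Hs_norm s2 \<Omega> f)\<^sup>2 \<le> q f + D * L2 f\<close>
      and \<open>L2 f \<le> q f / \<Lambda>\<close>.\<close>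
    define c' where "c' = c / (1 + D / \<Lambda>)"
    have p1: "1 + D / \<Lambda> > 0" using \<Lambda> D by (simp add: add_pos_nonneg)
    have "c' > 0" using c p1 by (simp add: c'_def)
    moreover have "l f f \<ge> c' * (Hs_norm s2 \<Omega> f)\<^sup>2" if f: "f \<in> S" for f
    proof -
      have "L2 f \<le> q f / \<Lambda>" using \<Lambda>_le[OF f] \<Lambda> by (simp add: pos_le_divide_eq mult.commute)
      then have "D * L2 f \<le> D * (q f / \<Lambda>)" using D by (rule mult_left_mono)
      then have "c * (Hs_norm s2 \<Omega> f)\<^sup>2 \<le> q f * (1 + D / \<Lambda>)" using gard[OF f] by (simp add: algebra_simps)
      then show ?thesis using p1 by (simp add: c'_def q_def pos_divide_le_eq)
    qed
    ultimately show ?thesis by blast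
  qed
qed

text \<open>A smooth \<psi> near \<open>h\<close> satisfies \<open>(Hs_norm s \<Omega> h)\<^sup>2
  \<le> 2 * (Hs_norm s \<Omega> \<psi>)\<^sup>2\<close> up to a small error, by the triangle
  inequality for squares; its factor 2 is the reason for \<open>c / 2\<close>.\<close>

lemma density_ext_ge:
  assumes s: "0 \<le> s" "s \<le> 1" and c: "c > 0" and l: "\<forall>\<phi>\<in>S. l \<phi> \<phi> \<ge> c * (Hs_norm s \<Omega> \<phi>)\<^sup>2"
    and h [measurable]: "h \<in> borel_measurable M"
  shows "density_ext s \<Omega> l h \<ge> ereal (c / 2 * (Hs_norm s \<Omega> h)\<^sup>2)"
proof -
  define H where "H = (Hs_norm s \<Omega> h)\<^sup>2"
  have ev: "\<forall>\<^sub>F \<psi> in smooth_nhds s \<Omega> h. ereal (c / 2 * H - e) \<le> ereal (l \<psi> \<psi>)" if e: "e > 0" for e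
    unfolding eventually_smooth_nhds
  proof (intro exI conjI ballI impI)
    \<comment> \<open>With this radius the error \<open>2 * (e / c)\<close>, multiplied by
      \<open>c / 2\<close>, is exactly \<open>e\<close>.\<close>
    show "ennreal (e / c) > 0" using e c by simp
    fix \<psi> assume \<psi>: "\<psi> \<in> S" and small: "Hs_norm_sq s \<Omega> (\<lambda>x. \<psi> x - h x) < ennreal (e / c)"
    have [measurable]: "\<psi> \<in> borel_measurable M" by (rule Cinf_measurable[OF \<psi>])
    have "Hs_norm_sq s \<Omega> (\<lambda>x. \<psi> x - (\<psi> x - h x)) \<le> 2 * Hs_norm_sq s \<Omega> \<psi> + 2 * Hs_norm_sq s \<Omega> (\<lambda>x. \<psi> x - h x)"
      using s by (intro Hs_norm_sq_diff) auto
    also have "\<dots> \<le> 2 * ennreal ((Hs_norm s \<Omega> \<psi>)\<^sup>2) + 2 * ennreal (e / c)"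
      using small Hs_norm_sq_Cinf[OF s \<psi>] by (intro add_mono mult_left_mono) auto
    also have "\<dots> = ennreal (2 * (Hs_norm s \<Omega> \<psi>)\<^sup>2 + 2 * (e / c))"
    proof -
      have "e / c \<ge> 0" using e c by simp
      then have "2 * ennreal a + 2 * ennreal (e / c) = ennreal (2 * a + 2 * (e / c))" if "a \<ge> 0" for a
        using that by (simp only: ennreal_plus ennreal_mult ennreal_numeral zero_le_numeral mult_nonneg_nonneg)
      then show ?thesis by simp
    qed
    finally have "Hs_norm_sq s \<Omega> h \<le> ennreal (2 * (Hs_norm s \<Omega> \<psi>)\<^sup>2 + 2 * (e / c))" by simp
    then have "enn2real (Hs_norm_sq s \<Omega> h) \<le> 2 * (Hs_norm s \<Omega> \<psi>)\<^sup>2 + 2 * (e / c)"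
      using e c by (intro enn2real_leI) auto
    then have "H \<le> 2 * (Hs_norm s \<Omega> \<psi>)\<^sup>2 + 2 * (e / c)" by (simp add: H_def Hs_norm_def)
    from mult_left_mono[OF this, of "c / 2"] have "c / 2 * H \<le> c * (Hs_norm s \<Omega> \<psi>)\<^sup>2 + e"
      using c by (simp add: distrib_left)
    then show "ereal (c / 2 * H - e) \<le> ereal (l \<psi> \<psi>)" using bspec[OF l \<psi>] by simp
  qed
  show ?thesis
  proof (rule ccontr)
    assume "\<not> ?thesis"
    then have "density_ext s \<Omega> l h < ereal (c / 2 * H)" by (simp add: H_def)
    then obtain y where y: "density_ext s \<Omega> l h < ereal y" "ereal y < ereal (c / 2 * H)" using ereal_dense2 by blast
    have "c / 2 * H - y > 0" using y(2) by simp
    from Liminf_bounded[OF ev[OF this]] have "ereal y \<le> density_ext s \<Omega> l h" by (simp add: density_ext_def)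
    then show False using y(1) by simp
  qed
qed

lemma Hs_norm_zero:
  assumes "0 \<le> s" "s \<le> 1"
  shows "Hs_norm s \<Omega> (\<lambda>_. 0) = 0"
proof -
  have "Hs_semi_sq s \<Omega> (\<lambda>_. 0) = 0"
  proof (cases "s = 1")
    case True
    \<comment> \<open>Writing zero as a difference of a smooth function with itself provides the
      zero gradient, without computing \<open>tgrad\<close> of zero.\<close>
    have "has_H1_gradient \<Omega> (\<lambda>x. 0 - 0) (\<lambda>x. tgrad (\<lambda>_. 0) x - tgrad (\<lambda>_. 0) x)"
      by (intro has_H1_gradient_diff has_H1_gradient_Cinf Cinf_0) auto
    then have "Hs_semi_sq 1 \<Omega> (\<lambda>_. 0) \<le> nL2 M (\<lambda>x. tgrad (\<lambda>_. 0) x - tgrad (\<lambda>_. 0) x)"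
      unfolding Hs_semi_sq_1 by (intro INF_lower) simp
    then show ?thesis by (simp add: True nL2_def)
  qed (use assms in \<open>simp add: Hs_semi_sq_def\<close>)
  then show ?thesis by (simp add: Hs_norm_def Hs_norm_sq_nL2 nL2_def)
qed

end

section \<open>Absorbing the remainder of the second-order expansion\<close>

theorem theorem1p1:
  fixes \<Omega> :: "'a::euclidean_space set" and J :: "'a set \<Rightarrow> real"
    and s2 :: real and X :: "('a \<Rightarrow> real) set" and nX :: "('a \<Rightarrow> real) \<Rightarrow> real"
  assumes "bounded_Ck_domain 3 \<Omega>"
    and "shape_twice_differentiable J \<Omega>"
    and "0 < s2" and "s2 \<le> 1"
    and "banach_fun_space X nX"
    and "Cinf_boundary \<Omega> \<subseteq> X" and "X \<subseteq> W1inf (frontier \<Omega>)"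
    and "condition_C s2 \<Omega> (shape_l2 J \<Omega>)"
    and "condition_IT s2 X nX J \<Omega>"
    and "\<forall>h\<in>X. shape_l1 J \<Omega> h = 0"
    and "\<forall>\<phi>\<in>Hs s2 \<Omega>. \<not> (AE x in surface_measure \<Omega>. \<phi> x = 0) \<longrightarrow>
           density_ext s2 \<Omega> (shape_l2 J \<Omega>) \<phi> > 0"
  shows "\<exists>\<eta>>0. \<exists>c>0. \<forall>h\<in>X. nX h \<le> \<eta> \<longrightarrow>
           J (normal_graph \<Omega> h) \<ge> J \<Omega> + c * (Hs_norm s2 \<Omega> h)\<^sup>2"
proof -
  have dom: "bounded_Ck_domain (Suc 2) \<Omega>" using assms(1) by (simp add: numeral_3_eq_3 numeral_2_eq_2)
  interpret regular_domain \<Omega> 2 by standard (rule dom)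
  from coercive[OF assms(3,4,8,11)] obtain c where c: "c > 0"
    "\<forall>\<phi>\<in>S. shape_l2 J \<Omega> \<phi> \<phi> \<ge> c * (Hs_norm s2 \<Omega> \<phi>)\<^sup>2" by blast
  from assms(9) obtain \<eta> \<omega> where IT: "\<eta> > 0" "(\<omega> \<longlongrightarrow> 0) (at_right 0)"
    "\<forall>h\<in>X. nX h \<le> \<eta> \<longrightarrow>
       \<bar>ereal (J (normal_graph \<Omega> h) - J \<Omega> - shape_l1 J \<Omega> h)
          - ereal (1/2) * density_ext s2 \<Omega> (shape_l2 J \<Omega>) h\<bar> \<le> ereal (\<omega> (nX h) * (Hs_norm s2 \<Omega> h)\<^sup>2)"
    unfolding condition_IT_def by blast
  \<comment> \<open>Half of the second derivative contributes at least \<open>c / 4\<close> times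
    the squared norm; a remainder below \<open>c / 8\<close> leaves \<open>c / 8\<close>.\<close>
  have "\<forall>\<^sub>F r in at_right 0. \<omega> r < c / 8" using IT(2) c(1) by (intro order_tendstoD(2)) auto
  then obtain d where d: "d > 0" "\<forall>r>0. r < d \<longrightarrow> \<omega> r < c / 8" by (auto simp: eventually_at_right_field)
  define \<eta>' where "\<eta>' = min \<eta> (d / 2)"
  have \<eta>': "\<eta>' > 0" "\<eta>' \<le> \<eta>" "\<eta>' < d" using IT(1) d(1) by (auto simp: \<eta>'_def)
  have "J (normal_graph \<Omega> h) \<ge> J \<Omega> + c / 8 * (Hs_norm s2 \<Omega> h)\<^sup>2" if h: "h \<in> X" "nX h \<le> \<eta>'" for h
  proof -
    let ?N = "(Hs_norm s2 \<Omega> h)\<^sup>2" and ?D = "density_ext s2 \<Omega> (shape_l2 J \<Omega>) h"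
    have "h \<in> W1inf F" using h(1) assms(7) by blast
    then obtain L where "L-lipschitz_on F h" unfolding W1inf_def by blast
    then have "h \<in> borel_measurable M" by (intro continuous_measurable_M lipschitz_on_continuous_on)
    then have D: "ereal (c / 2 * ?N) \<le> ?D"
      using assms(3,4) c by (intro density_ext_ge) auto
    have IT': "\<bar>ereal (J (normal_graph \<Omega> h) - J \<Omega>) - ereal (1/2) * ?D\<bar> \<le> ereal (\<omega> (nX h) * ?N)"
      using IT(3) h \<eta>'(2) assms(10) by (auto dest!: bspec)
    \<comment> \<open>The expansion has a finite remainder, which rules out an infinite extension at
      \<open>h\<close>.\<close>
    have "?D \<noteq> \<infinity>" using IT' by auto
    moreover have "?D \<noteq> -\<infinity>" using D by auto
    ultimately obtain y where y: "?D = ereal y" by (cases ?D) auto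
    have "\<bar>J (normal_graph \<Omega> h) - J \<Omega> - y / 2\<bar> \<le> \<omega> (nX h) * ?N" using IT' unfolding y by simp
    moreover have "c / 2 * ?N \<le> y" using D unfolding y by simp
    moreover have "\<omega> (nX h) * ?N \<le> c / 8 * ?N"
    \<comment> \<open>The modulus is controlled only to the right of zero and
      \<open>\<omega> 0\<close> is arbitrary; for \<open>h = 0\<close> both sides vanish.\<close>
    proof (cases "nX h = 0")
      case True
      then have "h = (\<lambda>_. 0)" using assms(5) h(1) unfolding banach_fun_space_def by blast
      then have "Hs_norm s2 \<Omega> h = 0" using Hs_norm_zero[of s2] assms(3,4) by simp
      then show ?thesis by simp
    next
      case False
      then have "nX h > 0" using assms(5) h(1) unfolding banach_fun_space_def by (metis order_le_less)
      then have "\<omega> (nX h) < c / 8" using d(2) h(2) \<eta>'(3) by auto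
      then show ?thesis by (intro mult_right_mono) auto
    qed
    ultimately show ?thesis by linarith
  qed
  then show ?thesis using \<eta>'(1) c(1) by (intro exI[of _ \<eta>'] conjI exI[of _ "c / 8"]) auto
qed

end
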